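(* Let $\mathcal{K}$ be a $\mu$-AEC (with $\mu$ a regular cardinal) and let $\kappa > \mathrm{LS}(\mathcal{K})$ be an almost strongly compact cardinal. Then $\mathcal{K}$ is fully $(<\kappa)$-tame and short.
   Context: For an infinite cardinal $\mu$, a $\mu$-ary language $L$ consists of function and relation symbols, each with an arity that is an ordinal $<\mu$. A $\mu$-abstract class is a pair $(\mathcal{K}, \le_{\mathcal{K}})$ where $\mathcal{K}$ is a class of $L$-structures for a fixed $\mu$-ary language $L = L(\mathcal{K})$, $\le_{\mathcal{K}}$ is a reflexive and transitive relation on $\mathcal{K}$ such that $M \le_{\mathcal{K}} N$ implies $M$ is an $L$-substructure of $N$, and which respects isomorphisms. A poset $I$ is $\mu$-directed if every subset of size $<\mu$ has an upper bound. For $\mu$ regular, a $\mu$-abstract class is a $\mu$-AEC if: (Coherence) if $M_0, M_1, M_2 \in \mathcal{K}$, $M_0 \le_{\mathcal{K}} M_2$, $M_1 \le_{\mathcal{K}} M_2$ and $M_0 \subseteq M_1$, then $M_0 \le_{\mathcal{K}} M_1$; (Tarski–Vaught) if $\{M_i : i \in I\} \subseteq \mathcal{K}$ with $I$ $\mu$-directed and $i \le j \Rightarrow M_i \le_{\mathcal{K}} M_j$, then (a) $\bigcup_i M_i \in \mathcal{K}$ and $M_j \le_{\mathcal{K}} \bigcup_i M_i$ for all $j$, and (b) if $N \in \mathcal{K}$ with $M_i \le_{\mathcal{K}} N$ for all $i$, then $\bigcup_i M_i \le_{\mathcal{K}} N$; (Löwenheim–Skolem–Tarski) there is a cardinal $\lambda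 = \lambda^{<\mu} \ge |L(\mathcal{K})| + \mu$ such that for every $M \in \mathcal{K}$ and $A \subseteq |M|$ there is $N \le_{\mathcal{K}} M$ with $A \subseteq |N|$ and $|N| \le |A|^{<\mu} + \lambda$; $\mathrm{LS}(\mathcal{K})$ is the least such $\lambda$. A $\mathcal{K}$-embedding $f: M \to N$ is an $L$-isomorphism from $M$ onto some $f[M] \le_{\mathcal{K}} N$. Galois types: for $N_1, N_2 \in \mathcal{K}$, a set $A \subseteq |N_1| \cap |N_2|$ and sequences $\mathbf{a}_\ell \in {}^{\alpha}|N_\ell|$, write $(\mathbf{a}_1, A, N_1) E_{at} (\mathbf{a}_2, A, N_2)$ if there are $N \in \mathcal{K}$ and $\mathcal{K}$-embeddings $f_\ell : N_\ell \to N$ fixing $A$ pointwise with $f_1(\mathbf{a}_1) = f_2(\mathbf{a}_2)$; let $E$ be the transitive closure of $E_{at}$, and $\mathrm{gtp}(\mathbf{a}/A; N)$ the $E$-class of $(\mathbf{a}, A, N)$. For $M \in \mathcal{K}$, $\mathrm{gS}^\alpha(M) = \{\mathrm{gtp}(\mathbf{a}/|M|; N) : M \le_{\mathcal{K}} N, \mathbf{a} \in {}^\alpha|N|\}$. For $p = \mathrm{gtp}(\mathbf{a}/|M|;N)$, $I \subseteq \alpha$ and $A \subseteq |M|$, $p^I \upharpoonright A := \mathrm{gtp}(\mathbf{a}\upharpoonright I / A; N)$. $\mathcal{K}$ is fully $(<\kappa)$-tame and short if for every $M \in \mathcal{K}$, every ordinal $\alpha$ and all distinct $p, q \in \mathrm{gS}^\alpha(M)$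 there are $I \subseteq \alpha$ and $A \subseteq |M|$ with $|I| + |A| < \kappa$ and $p^I \upharpoonright A \ne q^I \upharpoonright A$. An uncountable limit cardinal $\kappa$ is almost strongly compact if for every $\mu < \kappa$, every $\kappa$-complete filter extends to a $\mu$-complete ultrafilter. *)

theory Defs
  imports Main "HOL-Library.FuncSet"
begin

unbundle cardinal_syntax

text \<open>
  Structures, ordinals, index sets etc. all live in one type \<open>'u\<close>. The main result assumes that the
  cardinality of \<open>'u\<close> is strongly inaccessible, so that \<open>'u\<close> plays the role of a Grothendieck
  universe: up to bijection, a set in the sense of the universe is a \<open>small\<close> subset of \<open>'u\<close>, i.e. one
  of cardinality less than that of \<open>'u\<close>, and a proper class of structures is an arbitrary
  HOL set of structures with small carriers. Ordinals and cardinals of the universe are the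
  well-orders, respectively the cardinal orders, on \<open>'u\<close> that are strictly shorter than
  \<open>|UNIV :: 'u set|\<close>. Since they are only determined up to \<open>=o\<close>, sequences
  of length \<open>\<alpha>\<close> are the extensional functions on \<open>Field \<alpha>\<close>.
\<close>

definition inaccessible :: "'a rel \<Rightarrow> bool" where
  "inaccessible \<theta> \<longleftrightarrow>
     Card_order \<theta> \<and> natLeq <o \<theta> \<and> regularCard \<theta> \<and>
     (\<forall>\<nu> :: 'a rel. Card_order \<nu> \<and> \<nu> <o \<theta> \<longrightarrow> ctwo ^c \<nu> <o \<theta>)"

definition small :: "'u set \<Rightarrow> bool" where
  "small A \<longleftrightarrow> |A| <o |UNIV :: 'u set|"

definition ordinal :: "'u rel \<Rightarrow> bool" where
  "ordinal \<alpha> \<longleftrightarrow> Well_order \<alpha> \<and> \<alpha> <o |UNIV :: 'u set|"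

definition cardinal :: "'u rel \<Rightarrow> bool" where
  "cardinal \<kappa> \<longleftrightarrow> Card_order \<kappa> \<and> \<kappa> <o |UNIV :: 'u set|"

text \<open>
  The number of sequences in \<open>X\<close> of length less than \<open>\<mu>\<close>. For infinite \<open>\<mu>\<close> and \<open>|X| \<ge> 2\<close> this is the
  supremum of the powers \<open>|X|\<^sup>\<nu>\<close> with \<open>\<nu>\<close> less than \<open>\<mu>\<close>. For smaller \<open>X\<close> both numbers are at most \<open>\<mu>\<close>, which
  makes no difference below, where a cardinal \<open>\<ge> \<mu>\<close> is added.
\<close>
definition cpow_less :: "'x set \<Rightarrow> 'm rel \<Rightarrow> ('m \<times> ('m \<Rightarrow> 'x)) rel" where
  "cpow_less X \<mu> = |SIGMA i : Field \<mu>. underS \<mu> i \<rightarrow>\<^sub>E X|"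


section \<open>Languages and structures\<close>

record ('f, 'r, 'u) language =
  Funs :: "'f set"
  Rels :: "'r set"
  farity :: "'f \<Rightarrow> 'u rel"
  rarity :: "'r \<Rightarrow> 'u rel"

definition ary_language :: "'u rel \<Rightarrow> ('f, 'r, 'u) language \<Rightarrow> bool" where
  "ary_language \<mu> L \<longleftrightarrow>
     (\<forall>F \<in> Funs L. Well_order (farity L F) \<and> farity L F <o \<mu>) \<and>
     (\<forall>R \<in> Rels L. Well_order (rarity L R) \<and> rarity L R <o \<mu>)"

record ('f, 'r, 'u) struct =
  carr :: "'u set"
  fint :: "'f \<Rightarrow> ('u \<Rightarrow> 'u) \<Rightarrow> 'u"
  rint :: "'r \<Rightarrow> ('u \<Rightarrow> 'u) set"

abbreviation fargs :: "('f, 'r, 'u) language \<Rightarrow> 'f \<Rightarrow> 'u set \<Rightarrow> ('u \<Rightarrow> 'u) set" where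
  "fargs L F X \<equiv> Field (farity L F) \<rightarrow>\<^sub>E X"

abbreviation rargs :: "('f, 'r, 'u) language \<Rightarrow> 'r \<Rightarrow> 'u set \<Rightarrow> ('u \<Rightarrow> 'u) set" where
  "rargs L R X \<equiv> Field (rarity L R) \<rightarrow>\<^sub>E X"

text \<open>
  Interpretations are normalised outside their domain, so that HOL equality of structures is
  equality of structures.
\<close>
definition is_struct :: "('f, 'r, 'u) language \<Rightarrow> ('f, 'r, 'u) struct \<Rightarrow> bool" where
  "is_struct L M \<longleftrightarrow>
     small (carr M) \<and>
     (\<forall>F \<in> Funs L. fint M F \<in> fargs L F (carr M) \<rightarrow>\<^sub>E carr M) \<and>
     (\<forall>F. F \<notin> Funs L \<longrightarrow> fint M F = (\<lambda>_. undefined)) \<and>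
     (\<forall>R \<in> Rels L. rint M R \<subseteq> rargs L R (carr M)) \<and>
     (\<forall>R. R \<notin> Rels L \<longrightarrow> rint M R = {})"

definition substruct ::
  "('f, 'r, 'u) language \<Rightarrow> ('f, 'r, 'u) struct \<Rightarrow> ('f, 'r, 'u) struct \<Rightarrow> bool" where
  "substruct L M N \<longleftrightarrow>
     is_struct L M \<and> is_struct L N \<and> carr M \<subseteq> carr N \<and>
     (\<forall>F \<in> Funs L. \<forall>x \<in> fargs L F (carr M). fint M F x = fint N F x) \<and>
     (\<forall>R \<in> Rels L. rint M R = rint N R \<inter> rargs L R (carr M))"

definition struct_iso ::
  "('f, 'r, 'u) language \<Rightarrow> ('u \<Rightarrow> 'u) \<Rightarrow> ('f, 'r, 'u) struct \<Rightarrow> ('f, 'r, 'u) struct \<Rightarrow> bool" where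
  "struct_iso L f M N \<longleftrightarrow>
     is_struct L M \<and> is_struct L N \<and> bij_betw f (carr M) (carr N) \<and>
     (\<forall>F \<in> Funs L. \<forall>x \<in> fargs L F (carr M).
        f (fint M F x) = fint N F (compose (Field (farity L F)) f x)) \<and>
     (\<forall>R \<in> Rels L. \<forall>x \<in> rargs L R (carr M).
        x \<in> rint M R \<longleftrightarrow> compose (Field (rarity L R)) f x \<in> rint N R)"

text \<open>
  Meaningful for a \<open>\<mu>\<close>-directed system of substructures over a \<open>\<mu>\<close>-ary language: then every argument
  tuple from the union already lies in some \<open>M i\<close>, and the choice of \<open>i\<close> is immaterial.
\<close>
definition union_struct ::
  "('f, 'r, 'u) language \<Rightarrow> 'i set \<Rightarrow> ('i \<Rightarrow> ('f, 'r, 'u) struct) \<Rightarrow> ('f, 'r, 'u) struct" where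
  "union_struct L I M =
     \<lparr> carr = (\<Union>i\<in>I. carr (M i)),
       fint = (\<lambda>F x. if F \<in> Funs L \<and> (\<exists>i\<in>I. x \<in> fargs L F (carr (M i)))
                     then fint (M (SOME i. i \<in> I \<and> x \<in> fargs L F (carr (M i)))) F x
                     else undefined),
       rint = (\<lambda>R. \<Union>i\<in>I. rint (M i) R) \<rparr>"


section \<open>\<open>\<mu>\<close>-abstract elementary classes\<close>

record ('f, 'r, 'u) aclass =
  Lang :: "('f, 'r, 'u) language"
  Mods :: "('f, 'r, 'u) struct set"
  Le :: "('f, 'r, 'u) struct \<Rightarrow> ('f, 'r, 'u) struct \<Rightarrow> bool"

definition abstract_class :: "'u rel \<Rightarrow> ('f, 'r, 'u) aclass \<Rightarrow> bool" where
  "abstract_class \<mu> K \<longleftrightarrow>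
     cardinal \<mu> \<and> cinfinite \<mu> \<and> ary_language \<mu> (Lang K) \<and>
     (\<forall>M \<in> Mods K. is_struct (Lang K) M) \<and>
     (\<forall>M N. Le K M N \<longrightarrow> M \<in> Mods K \<and> N \<in> Mods K) \<and>
     (\<forall>M \<in> Mods K. Le K M M) \<and>
     (\<forall>M N P. Le K M N \<and> Le K N P \<longrightarrow> Le K M P) \<and>
     (\<forall>M N. Le K M N \<longrightarrow> substruct (Lang K) M N) \<and>
     (\<forall>M N f. M \<in> Mods K \<and> struct_iso (Lang K) f M N \<longrightarrow> N \<in> Mods K) \<and>
     (\<forall>M N M' N' f. Le K M N \<and> struct_iso (Lang K) f N N' \<and> struct_iso (Lang K) f M M' \<and>
        substruct (Lang K) M' N' \<longrightarrow> Le K M' N')"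

definition directed :: "'m rel \<Rightarrow> 'i set \<Rightarrow> 'i rel \<Rightarrow> bool" where
  "directed \<mu> I r \<longleftrightarrow>
     partial_order_on I r \<and>
     (\<forall>X. X \<subseteq> I \<and> |X| <o \<mu> \<longrightarrow> (\<exists>b \<in> I. \<forall>x \<in> X. (x, b) \<in> r))"

definition coherence :: "('f, 'r, 'u) aclass \<Rightarrow> bool" where
  "coherence K \<longleftrightarrow>
     (\<forall>M0 M1 M2. M0 \<in> Mods K \<and> M1 \<in> Mods K \<and> M2 \<in> Mods K \<and>
        Le K M0 M2 \<and> Le K M1 M2 \<and> substruct (Lang K) M0 M1 \<longrightarrow> Le K M0 M1)"

definition tarski_vaught :: "'u rel \<Rightarrow> ('f, 'r, 'u) aclass \<Rightarrow> bool" where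
  "tarski_vaught \<mu> K \<longleftrightarrow>
     (\<forall>(I :: 'u set) r M.
        small I \<and> directed \<mu> I r \<and> (\<forall>i\<in>I. M i \<in> Mods K) \<and>
        (\<forall>i\<in>I. \<forall>j\<in>I. (i, j) \<in> r \<longrightarrow> Le K (M i) (M j)) \<longrightarrow>
          union_struct (Lang K) I M \<in> Mods K \<and>
          (\<forall>j\<in>I. Le K (M j) (union_struct (Lang K) I M)) \<and>
          (\<forall>N \<in> Mods K. (\<forall>i\<in>I. Le K (M i) N) \<longrightarrow> Le K (union_struct (Lang K) I M) N))"

definition LST_cardinal :: "'u rel \<Rightarrow> ('f, 'r, 'u) aclass \<Rightarrow> 'u rel \<Rightarrow> bool" where
  "LST_cardinal \<mu> K \<rho> \<longleftrightarrow>
     cardinal \<rho> \<and> \<rho> =o cpow_less (Field \<rho>) \<mu> \<and>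
     |Funs (Lang K) <+> Rels (Lang K)| +c \<mu> \<le>o \<rho> \<and>
     (\<forall>M \<in> Mods K. \<forall>A. A \<subseteq> carr M \<longrightarrow>
        (\<exists>N. Le K N M \<and> A \<subseteq> carr N \<and> |carr N| \<le>o cpow_less A \<mu> +c \<rho>))"

definition mu_AEC :: "'u rel \<Rightarrow> ('f, 'r, 'u) aclass \<Rightarrow> bool" where
  "mu_AEC \<mu> K \<longleftrightarrow>
     regularCard \<mu> \<and> abstract_class \<mu> K \<and> coherence K \<and> tarski_vaught \<mu> K \<and>
     (\<exists>\<rho>. LST_cardinal \<mu> K \<rho>)"

text \<open>The least such \<open>\<rho>\<close>; it exists by well-foundedness and is unique up to \<open>=o\<close>.\<close>
definition LS :: "'u rel \<Rightarrow> ('f, 'r, 'u) aclass \<Rightarrow> 'u rel" where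
  "LS \<mu> K = (SOME \<rho>. LST_cardinal \<mu> K \<rho> \<and> (\<forall>\<rho>'. LST_cardinal \<mu> K \<rho>' \<longrightarrow> \<rho> \<le>o \<rho>'))"


section \<open>Galois types\<close>

definition K_embedding ::
  "('f, 'r, 'u) aclass \<Rightarrow> ('u \<Rightarrow> 'u) \<Rightarrow> ('f, 'r, 'u) struct \<Rightarrow> ('f, 'r, 'u) struct \<Rightarrow> bool" where
  "K_embedding K f M N \<longleftrightarrow>
     M \<in> Mods K \<and> N \<in> Mods K \<and> (\<exists>M'. struct_iso (Lang K) f M M' \<and> Le K M' N)"

type_synonym ('f, 'r, 'u) ptriple = "('u \<Rightarrow> 'u) \<times> 'u set \<times> ('f, 'r, 'u) struct"

text \<open>
  The first set argument is the index set of the sequences; sequences indexed by a set \<open>I \<subseteq> \<alpha>\<close>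
  are needed for the restrictions \<open>p\<^sup>I\<close>.
\<close>
definition E_at ::
  "('f, 'r, 'u) aclass \<Rightarrow> 'u set \<Rightarrow> ('f, 'r, 'u) ptriple \<Rightarrow> ('f, 'r, 'u) ptriple \<Rightarrow> bool" where
  "E_at K J = (\<lambda>(a1, A1, N1) (a2, A2, N2).
     A1 = A2 \<and> N1 \<in> Mods K \<and> N2 \<in> Mods K \<and> A1 \<subseteq> carr N1 \<inter> carr N2 \<and>
     a1 \<in> J \<rightarrow>\<^sub>E carr N1 \<and> a2 \<in> J \<rightarrow>\<^sub>E carr N2 \<and>
     (\<exists>N f1 f2. N \<in> Mods K \<and> K_embedding K f1 N1 N \<and> K_embedding K f2 N2 N \<and>
        (\<forall>x\<in>A1. f1 x = x \<and> f2 x = x) \<and> compose J f1 a1 = compose J f2 a2))"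

definition gtp ::
  "('f, 'r, 'u) aclass \<Rightarrow> 'u set \<Rightarrow> ('u \<Rightarrow> 'u) \<Rightarrow> 'u set \<Rightarrow> ('f, 'r, 'u) struct \<Rightarrow>
     ('f, 'r, 'u) ptriple set" where
  "gtp K J a A N = {t. (E_at K J)\<^sup>+\<^sup>+ (a, A, N) t}"

definition gS ::
  "('f, 'r, 'u) aclass \<Rightarrow> 'u rel \<Rightarrow> ('f, 'r, 'u) struct \<Rightarrow> ('f, 'r, 'u) ptriple set set" where
  "gS K \<alpha> M = {gtp K (Field \<alpha>) a (carr M) N | a N. Le K M N \<and> a \<in> Field \<alpha> \<rightarrow>\<^sub>E carr N}"

text \<open>
  The type \<open>p\<^sup>I \<restriction> A\<close>, as the common value over all representatives of \<open>p\<close>; the lemma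
  \<open>gtp_restrict_gtp\<close> below shows that it does not depend on the representative.
\<close>
definition gtp_restrict ::
  "('f, 'r, 'u) aclass \<Rightarrow> 'u set \<Rightarrow> 'u set \<Rightarrow> ('f, 'r, 'u) ptriple set \<Rightarrow>
     ('f, 'r, 'u) ptriple set" where
  "gtp_restrict K I A p = the_elem ((\<lambda>(a, B, N). gtp K I (restrict a I) A N) ` p)"

definition fully_tame_short :: "'u rel \<Rightarrow> ('f, 'r, 'u) aclass \<Rightarrow> bool" where
  "fully_tame_short \<kappa> K \<longleftrightarrow>
     (\<forall>M \<in> Mods K. \<forall>\<alpha>. ordinal \<alpha> \<longrightarrow>
        (\<forall>p \<in> gS K \<alpha> M. \<forall>q \<in> gS K \<alpha> M. p \<noteq> q \<longrightarrow>
           (\<exists>I A. I \<subseteq> Field \<alpha> \<and> A \<subseteq> carr M \<and> |I| +c |A| <o \<kappa> \<and>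
              gtp_restrict K I A p \<noteq> gtp_restrict K I A q)))"


section \<open>Almost strongly compact cardinals\<close>

definition complete_filter :: "'k rel \<Rightarrow> 'a filter \<Rightarrow> bool" where
  "complete_filter \<kappa> F \<longleftrightarrow>
     (\<forall>S :: 'a set set. |S| <o \<kappa> \<and> (\<forall>A\<in>S. eventually (\<lambda>x. x \<in> A) F) \<longrightarrow>
        eventually (\<lambda>x. x \<in> \<Inter>S) F)"

definition ultrafilter :: "'a filter \<Rightarrow> bool" where
  "ultrafilter U \<longleftrightarrow>
     U \<noteq> bot \<and> (\<forall>P. eventually P U \<or> eventually (\<lambda>x. \<not> P x) U)"

text \<open>
  A filter on a set \<open>X\<close> is represented by a filter \<open>F \<le> principal X\<close>; properness is \<open>F \<noteq> bot\<close>, and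
  \<open>U \<le> F\<close> says that \<open>U\<close> extends \<open>F\<close>.
\<close>
definition almost_strongly_compact :: "'u rel \<Rightarrow> bool" where
  "almost_strongly_compact \<kappa> \<longleftrightarrow>
     cardinal \<kappa> \<and> natLeq <o \<kappa> \<and>
     (\<forall>\<nu> :: 'u rel. Card_order \<nu> \<and> \<nu> <o \<kappa> \<longrightarrow> cardSuc \<nu> <o \<kappa>) \<and>
     (\<forall>\<nu> :: 'u rel. Card_order \<nu> \<and> \<nu> <o \<kappa> \<longrightarrow>
        (\<forall>(X :: 'u set) F. small X \<and> F \<le> principal X \<and> F \<noteq> bot \<and> complete_filter \<kappa> F \<longrightarrow>
           (\<exists>U. U \<le> F \<and> ultrafilter U \<and> complete_filter \<nu> U)))"


section \<open>Restriction of Galois types is well defined\<close>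

lemma E_at_refl:
  fixes K :: "('f, 'r, 'u) aclass"
  assumes "abstract_class \<mu> K" "N \<in> Mods K" "A \<subseteq> carr N" "a \<in> J \<rightarrow>\<^sub>E carr N"
  shows "E_at K J (a, A, N) (a, A, N)"
proof -
  have "\<forall>M \<in> Mods K. is_struct (Lang K) M"
    using assms(1) unfolding abstract_class_def by (elim conjE) assumption
  then have s: "is_struct (Lang K) N"
    using assms(2) by (rule bspec)
  have "\<forall>M \<in> Mods K. Le K M M"
    using assms(1) unfolding abstract_class_def by (elim conjE) assumption
  then have le: "Le K N N"
    using assms(2) by (rule bspec)
  have "compose D id x = x" if "x \<in> D \<rightarrow>\<^sub>E X" for D X and x :: "'u \<Rightarrow> 'u"
    using that by (simp add: compose_def PiE_def extensional_restrict)
  then have "struct_iso (Lang K) id N N"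
    unfolding struct_iso_def using s by simp
  then have "K_embedding K id N N"
    unfolding K_embedding_def using assms(2) le by blast
  then have "\<exists>N' f1 f2. N' \<in> Mods K \<and> K_embedding K f1 N N' \<and> K_embedding K f2 N N' \<and>
      (\<forall>x\<in>A. f1 x = x \<and> f2 x = x) \<and> compose J f1 a = compose J f2 a"
    using assms(2) by (intro exI[of _ N] exI[of _ id]) simp
  then show ?thesis
    unfolding E_at_def prod.case using assms(2-4) by simp
qed

lemma E_at_sym:
  assumes "E_at K J s t"
  shows "E_at K J t s"
proof -
  obtain a1 A1 N1 a2 A2 N2 where st: "s = (a1, A1, N1)" "t = (a2, A2, N2)"
    by (cases s, cases t) blast
  have E: "A1 = A2" "N1 \<in> Mods K" "N2 \<in> Mods K" "A2 \<subseteq> carr N1 \<inter> carr N2"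
      "a1 \<in> J \<rightarrow>\<^sub>E carr N1" "a2 \<in> J \<rightarrow>\<^sub>E carr N2"
    using assms unfolding st E_at_def prod.case by auto
  obtain N f1 f2 where "N \<in> Mods K" "K_embedding K f1 N1 N" "K_embedding K f2 N2 N"
      "\<forall>x\<in>A1. f1 x = x \<and> f2 x = x" "compose J f1 a1 = compose J f2 a2"
    using assms unfolding st E_at_def prod.case by (elim conjE exE)
  then have "\<exists>N f2 f1. N \<in> Mods K \<and> K_embedding K f2 N2 N \<and> K_embedding K f1 N1 N \<and>
      (\<forall>x\<in>A2. f2 x = x \<and> f1 x = x) \<and> compose J f2 a2 = compose J f1 a1"
    using E(1) by (intro exI[of _ N] exI[of _ f1] exI[of _ f2]) simp
  then show ?thesis
    using E unfolding st E_at_def prod.case by simp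
qed

lemma E_at_restrict:
  assumes "E_at K J (a1, B, N1) (a2, B', N2)" "I \<subseteq> J" "A \<subseteq> B"
  shows "E_at K I (restrict a1 I, A, N1) (restrict a2 I, A, N2)"
proof -
  obtain N f1 f2 where *: "N \<in> Mods K" "K_embedding K f1 N1 N" "K_embedding K f2 N2 N"
      "\<forall>x\<in>B. f1 x = x \<and> f2 x = x" "compose J f1 a1 = compose J f2 a2"
    using assms(1) unfolding E_at_def prod.case by (elim conjE exE)
  have "f1 (a1 i) = f2 (a2 i)" if "i \<in> I" for i
    using fun_cong[OF *(5), of i] that assms(2) by (auto simp: compose_def)
  then have "compose I f1 (restrict a1 I) = compose I f2 (restrict a2 I)"
    by (auto simp: compose_def)
  moreover have "A \<subseteq> carr N1 \<inter> carr N2" "N1 \<in> Mods K" "N2 \<in> Mods K"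
      "restrict a1 I \<in> I \<rightarrow>\<^sub>E carr N1" "restrict a2 I \<in> I \<rightarrow>\<^sub>E carr N2"
    using assms unfolding E_at_def by auto
  moreover have "\<forall>x\<in>A. f1 x = x \<and> f2 x = x"
    using *(4) assms(3) by blast
  ultimately show ?thesis
    using *(1-3) unfolding E_at_def prod.case by blast
qed

lemma gtp_restrict_gtp:
  assumes "abstract_class \<mu> K" "N \<in> Mods K" "B \<subseteq> carr N" "a \<in> J \<rightarrow>\<^sub>E carr N"
    and "I \<subseteq> J" "A \<subseteq> B"
  shows "gtp_restrict K I A (gtp K J a B N) = gtp K I (restrict a I) A N"
proof -
  let ?g = "\<lambda>(a, B, N). gtp K I (restrict a I) A N"
  have sym: "(E_at K I)\<^sup>+\<^sup>+ t s" if "(E_at K I)\<^sup>+\<^sup>+ s t" for s t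
    using that
  proof induction
    case (base t)
    then show ?case by (blast intro: E_at_sym)
  next
    case (step t u)
    then show ?case by (meson E_at_sym tranclp_into_tranclp2)
  qed
  have one: "fst (snd t) = fst (snd s) \<and>
      E_at K I (restrict (fst s) I, A, snd (snd s)) (restrict (fst t) I, A, snd (snd t))"
    if "E_at K J s t" "fst (snd s) = B" for s t
  proof -
    obtain a1 A1 N1 a2 A2 N2 where st: "s = (a1, A1, N1)" "t = (a2, A2, N2)"
      by (cases s, cases t) blast
    have "A1 = A2"
      using that(1) unfolding st E_at_def prod.case by (elim conjE)
    then show ?thesis
      using E_at_restrict[OF that(1)[unfolded st] assms(5), of A] that(2) assms(6)
      unfolding st by simp
  qed
  have step: "fst (snd t) = B \<and> (E_at K I)\<^sup>+\<^sup>+ (restrict a I, A, N) (restrict (fst t) I, A, snd (snd t))"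
    if "(E_at K J)\<^sup>+\<^sup>+ (a, B, N) t" for t
    using that
  proof induction
    case (base t)
    then show ?case
      using one[of "(a, B, N)" t] by (simp only: fst_conv snd_conv tranclp.r_into_trancl simp_thms)
  next
    case (step s t)
    then have "fst (snd t) = fst (snd s)"
      and "E_at K I (restrict (fst s) I, A, snd (snd s)) (restrict (fst t) I, A, snd (snd t))"
      using one by blast+
    with step.IH show ?case
      by (simp only: tranclp.trancl_into_trancl[of "E_at K I" _ "(restrict (fst s) I, A, snd (snd s))"] simp_thms)
  qed
  have eq: "?g t = gtp K I (restrict a I) A N" if "t \<in> gtp K J a B N" for t
  proof -
    have "(E_at K I)\<^sup>+\<^sup>+ (restrict a I, A, N) (restrict (fst t) I, A, snd (snd t))"
      using step[of t] that unfolding gtp_def by blast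
    from this sym[OF this]
    have "gtp K I (restrict (fst t) I) A (snd (snd t)) = gtp K I (restrict a I) A N"
      unfolding gtp_def by (intro Collect_cong iffI) (erule (1) tranclp_trans)+
    then show ?thesis by (cases t) simp
  qed
  have "(a, B, N) \<in> gtp K J a B N"
    unfolding gtp_def using E_at_refl[OF assms(1-4)] by blast
  then have "gtp K J a B N \<noteq> {}" by blast
  then have "?g ` gtp K J a B N = {gtp K I (restrict a I) A N}"
    using eq by (simp only: image_cong[OF refl eq] image_constant_conv if_False)
  then show ?thesis
    unfolding gtp_restrict_def by simp
qed

end

theory Submission
  imports Defs
begin

text \<open>
  Fix \<open>\<rho> = LS(K)\<close> and a \<open>\<rho>\<^sup>+\<close>-complete ultrafilter \<open>U\<close>. For models of size at most \<open>\<rho>\<close>, the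
  ultraproduct modulo \<open>U\<close> is isomorphic to almost all of its factors, compatibly with the order of
  the class. By the Loewenheim-Skolem-Tarski axiom an arbitrary ultraproduct of models is the
  \<open>\<mu>\<close>-directed union of the ultraproducts of submodels of size at most \<open>\<rho>\<close>, so by the Tarski-Vaught
  axioms it lies in the class, and ultraproducts preserve the order and \<open>K\<close>-embeddings. Given two
  types over \<open>M\<close> all of whose small restrictions agree, take \<open>U\<close> fine on the small sets of indices and
  parameters: the ultraproduct of the chains of amalgamation steps witnessing these agreements is a
  chain witnessing the equality of the two types.

  Ultraproducts are realised inside the universe by coding an ultrapower of a small set \<open>V\<close> as a
  small \<open>W \<supseteq> V\<close> with evaluation maps \<open>e x\<close> from \<open>W\<close> to \<open>V\<close>, so that the diagonal embedding is an
  inclusion.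
\<close>

section \<open>Cardinality below an inaccessible\<close>

text \<open>An abstract class has no formulas, so Los's theorem is available for atomic facts only,
  while membership in the class and the relation \<open>Le\<close> have to be transported along
  isomorphisms. This is why models of size at most \<rho> are singled out: \<rho> bounds the
  language and \<rho>^{<\<mu>} = \<rho>, so such a model has at most \<rho> atomic facts, and
  completeness decides all of them on a single set of the ultrafilter. That much completeness is
  available because \<kappa> is a limit cardinal above \<rho>, so that the successor of \<rho> is
  still below \<kappa>.

  Two obstacles shape the rest. The cardinal \<kappa> may be singular, and then a fine ultrafilter
  on the sets of size less than \<kappa> is not an immediate extension of a \<kappa>-complete
  filter. Moreover, the index set of the types and their parameter set may be far larger than the
  completeness of the ultrafilter. What is known about them is known one element at a time, on a set
  of the ultrafilter that depends on the element; passing to codes in the ultraproduct turns these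
  separate facts into facts about all elements together.\<close>

lemma inaccessible_Cinfinite: "inaccessible \<theta> \<Longrightarrow> Cinfinite \<theta>"
  unfolding inaccessible_def using cinfinite_mono[OF ordLess_imp_ordLeq natLeq_cinfinite] by blast

lemma card_of_Pow_less:
  fixes A :: "'a set"
  assumes inac: "inaccessible |UNIV :: 'u set|" and A: "|A| <o |UNIV :: 'u set|"
  shows "|Pow A| <o |UNIV :: 'u set|"
proof -
  \<comment> \<open>\<open>inaccessible\<close> quantifies over cardinals on \<open>'u\<close> only,
    so the cardinality of \<open>A\<close> is first realised there.\<close>
  obtain B :: "'u set" where B: "|A| =o |B|" "|B| <o |UNIV :: 'u set|"
    using iffD1[OF internalize_card_of_ordLess A] by blast
  have 1: "|Pow A| =o ctwo ^c |A|"
    unfolding cexp_def ctwo_def Field_card_of by (rule card_of_Pow_Func)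
  have 2: "ctwo ^c |A| =o ctwo ^c |B|"
    using cexp_cong2[OF B(1) Card_order_ctwo card_of_Card_order] by blast
  have 3: "ctwo ^c |B| <o |UNIV :: 'u set|"
    using inac B(2) card_of_Card_order unfolding inaccessible_def by blast
  show ?thesis by (rule ordIso_ordLess_trans[OF 1 ordIso_ordLess_trans[OF 2 3]])
qed

lemma card_of_UN_less:
  assumes inac: "inaccessible |UNIV :: 'u set|"
    and "|I| <o |UNIV :: 'u set|" "\<And>i. i \<in> I \<Longrightarrow> |A i| <o |UNIV :: 'u set|"
  shows "|\<Union>i\<in>I. A i| <o |UNIV :: 'u set|"
  using card_of_UNION_ordLess_infinite_Field_regularCard[of "|UNIV :: 'u set|" I A]
    assms inaccessible_Cinfinite[OF inac] inac
  by (simp add: inaccessible_def)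

lemma card_of_subset_less: "A \<subseteq> B \<Longrightarrow> |B| <o r \<Longrightarrow> |A| <o r"
  using card_of_mono1 ordLeq_ordLess_trans by blast

lemma card_of_image_less: "|A| <o r \<Longrightarrow> |f ` A| <o r"
  using card_of_image ordLeq_ordLess_trans by blast

lemma finite_ordLess_Cinfinite: "finite A \<Longrightarrow> Cinfinite r \<Longrightarrow> |A| <o r"
  by (rule Cfinite_ordLess_Cinfinite) (simp_all add: cfinite_def Field_card_of card_of_card_order_on)

lemma finite_ordLeq_Cinfinite: "finite A \<Longrightarrow> Cinfinite r \<Longrightarrow> |A| \<le>o r"
  using finite_ordLess_Cinfinite ordLess_imp_ordLeq by blast

lemma countable_ordLeq_Cinfinite: "Cinfinite r \<Longrightarrow> |UNIV :: nat set| \<le>o r"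
  using infinite_iff_card_of_nat[of "Field r"] card_of_Field_ordIso[of r]
  unfolding cinfinite_def by (metis ordLeq_ordIso_trans)

text \<open>A function is determined by its graph, a subset of \<open>X \<times> V\<close>, and
  smallness is preserved by small unions and by power sets.\<close>

lemma card_of_PiE_less:
  fixes X :: "'a set" and V :: "'b set"
  assumes inac: "inaccessible |UNIV :: 'u set|"
    and X: "|X| <o |UNIV :: 'u set|" and V: "|V| <o |UNIV :: 'u set|"
  shows "|X \<rightarrow>\<^sub>E V| <o |UNIV :: 'u set|"
proof -
  have "|\<Union>x\<in>X. Pair x ` V| <o |UNIV :: 'u set|"
    by (intro card_of_UN_less[OF inac X] card_of_image_less V)
  moreover have "(\<Union>x\<in>X. Pair x ` V) = X \<times> V" by auto
  ultimately have "|X \<times> V| <o |UNIV :: 'u set|" by simp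
  then have P: "|Pow (X \<times> V)| <o |UNIV :: 'u set|"
    by (rule card_of_Pow_less[OF inac])
  let ?G = "\<lambda>f. (\<lambda>x. (x, f x)) ` X"
  have inj: "inj_on ?G (X \<rightarrow>\<^sub>E V)"
  proof (rule inj_onI)
    fix f g assume fg: "f \<in> X \<rightarrow>\<^sub>E V" "g \<in> X \<rightarrow>\<^sub>E V" "?G f = ?G g"
    show "f = g"
    proof (rule PiE_ext[OF fg(1,2)])
      fix x assume "x \<in> X"
      then have "(x, f x) \<in> ?G g" using fg(3) by blast
      then show "f x = g x" by auto
    qed
  qed
  have "?G ` (X \<rightarrow>\<^sub>E V) \<subseteq> Pow (X \<times> V)" by auto
  then have "|X \<rightarrow>\<^sub>E V| \<le>o |Pow (X \<times> V)|"
    using inj by (intro card_of_ordLeqI[of ?G]) blast+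
  then show ?thesis using P ordLeq_ordLess_trans by blast
qed

text \<open>The axioms on directed systems and on filters speak about subsets of \<open>'u\<close>.
  This moves small sets over other types, such as sets of structures or of subsets, into
  \<open>'u\<close>.\<close>

lemma ex_inj_less:
  assumes "|A| <o |UNIV :: 'u set|"
  obtains c :: "'a \<Rightarrow> 'u" where "inj_on c A" "small (c ` A)"
proof -
  obtain c :: "'a \<Rightarrow> 'u" where c: "inj_on c A"
    using assms card_of_ordLeq[of A "UNIV :: 'u set"] ordLess_imp_ordLeq by blast
  moreover have "small (c ` A)"
    unfolding small_def using assms by (rule card_of_image_less)
  ultimately show ?thesis using that by blast
qed

section \<open>Complete ultrafilters\<close>

lemma complete_filter_ball:
  fixes I :: "'i set"
  assumes "complete_filter \<nu> U" "|I| <o \<nu>" "\<And>i. i \<in> I \<Longrightarrow> eventually (P i) U"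
  shows "eventually (\<lambda>x. \<forall>i\<in>I. P i x) U"
proof -
  let ?S = "(\<lambda>i. Collect (P i)) ` I"
  have "|?S| <o \<nu>" by (rule card_of_image_less[OF assms(2)])
  moreover have "\<forall>A\<in>?S. eventually (\<lambda>x. x \<in> A) U" using assms(3) by simp
  ultimately have "eventually (\<lambda>x. x \<in> \<Inter>?S) U"
    using assms(1) unfolding complete_filter_def by blast
  then show ?thesis by (rule eventually_mono) auto
qed

text \<open>Fewer than \<nu> null sets cannot cover a set of a \<nu>-complete ultrafilter. The main
  use is that a function with fewer than \<nu> values is constant almost everywhere.\<close>

lemma complete_ultrafilter_bex:
  assumes "ultrafilter U" "complete_filter \<nu> U" "|I| <o \<nu>" "eventually (\<lambda>x. \<exists>i\<in>I. P i x) U"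
  shows "\<exists>i\<in>I. eventually (P i) U"
proof (rule ccontr)
  assume "\<not> ?thesis"
  then have "\<And>i. i \<in> I \<Longrightarrow> eventually (\<lambda>x. \<not> P i x) U"
    using assms(1) unfolding ultrafilter_def by blast
  from complete_filter_ball[OF assms(2,3), of "\<lambda>i x. \<not> P i x", OF this]
  have "eventually (\<lambda>x. False) U"
    using assms(4) by (rule eventually_elim2) auto
  then show False using assms(1) unfolding ultrafilter_def by (simp add: trivial_limit_def)
qed

lemma ultrafilter_not: "ultrafilter U \<Longrightarrow> \<not> eventually P U \<longleftrightarrow> eventually (\<lambda>x. \<not> P x) U"
proof (rule iffI)
  assume U: "ultrafilter U" and n: "eventually (\<lambda>x. \<not> P x) U"
  show "\<not> eventually P U"
  proof
    assume "eventually P U"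
    then have "eventually (\<lambda>x. False) U" using n by eventually_elim blast
    then show False using U unfolding ultrafilter_def trivial_limit_def by blast
  qed
qed (auto simp: ultrafilter_def)

lemma ultrafilter_ex: "ultrafilter U \<Longrightarrow> eventually P U \<Longrightarrow> \<exists>x. P x"
  unfolding ultrafilter_def by (metis eventually_happens)

text \<open>The compactness hypothesis concerns filters on small subsets of \<open>'u\<close>. A
  filter on a small set over another type is pushed forward along an injection, and \<open>d\<close>
  decodes the points of the resulting ultrafilter.\<close>

lemma almost_strongly_compact_extend:
  fixes \<kappa> :: "'u rel" and F :: "'a filter"
  assumes "almost_strongly_compact \<kappa>" "Card_order (\<nu> :: 'u rel)" "\<nu> <o \<kappa>"
    and Y: "|Y| <o |UNIV :: 'u set|" "F \<le> principal Y"
    and F: "F \<noteq> bot" "complete_filter \<kappa> F"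
  obtains X :: "'u set" and U and d :: "'u \<Rightarrow> 'a"
  where "small X" "U \<le> principal X" "ultrafilter U" "complete_filter \<nu> U"
    "\<And>x. x \<in> X \<Longrightarrow> d x \<in> Y" "\<And>P. eventually P F \<Longrightarrow> eventually (\<lambda>x. P (d x)) U"
proof -
  obtain c :: "'a \<Rightarrow> 'u" where c: "inj_on c Y" "small (c ` Y)"
    using ex_inj_less[OF Y(1)] .
  have evY: "eventually (\<lambda>y. y \<in> Y) F"
    using Y(2) by (simp add: le_principal)
  have 1: "filtermap c F \<le> principal (c ` Y)"
    using evY by (auto simp: le_principal eventually_filtermap elim: eventually_mono)
  have 2: "filtermap c F \<noteq> bot" using F(1) by (simp add: filtermap_bot_iff)
  have 3: "complete_filter \<kappa> (filtermap c F)"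
    unfolding complete_filter_def
  proof (intro allI impI)
    fix S :: "'u set set"
    assume S: "|S| <o \<kappa> \<and> (\<forall>A\<in>S. eventually (\<lambda>x. x \<in> A) (filtermap c F))"
    then have "eventually (\<lambda>y. \<forall>A\<in>S. c y \<in> A) F"
      by (intro complete_filter_ball[OF F(2)]) (auto simp: eventually_filtermap)
    then show "eventually (\<lambda>x. x \<in> \<Inter> S) (filtermap c F)"
      by (simp add: eventually_filtermap)
  qed
  obtain U where U: "U \<le> filtermap c F" "ultrafilter U" "complete_filter \<nu> U"
    using assms(1-3) c(2) 1 2 3 unfolding almost_strongly_compact_def by blast
  show ?thesis
  proof (rule that[of "c ` Y" U "inv_into Y c"])
    show "U \<le> principal (c ` Y)" using U(1) 1 by order
    show "eventually (\<lambda>x. P (inv_into Y c x)) U" if "eventually P F" for P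
    proof -
      have "eventually (\<lambda>y. P (inv_into Y c (c y))) F"
        using that evY by eventually_elim (simp add: c(1))
      then show ?thesis using U(1) by (simp add: filter_leD eventually_filtermap)
    qed
  qed (use c U in \<open>auto intro: inv_into_into\<close>)
qed

text \<open>The cones of all \<open>Z\<close> containing a given \<open>Y\<close> generate a
  \<kappa>-complete filter, since a union of fewer than \<kappa> sets of size less than \<tau> has
  size less than the regular \<tau>. The bound \<tau> is kept apart from \<kappa> for two uses:
  \<tau> = \<kappa> when \<kappa> is regular, and \<tau> the successor of \<kappa> as a starting
  point when it is singular.\<close>

lemma fine_ultrafilter_regular:
  fixes \<kappa> :: "'u rel" and S :: "'s set" and \<tau> :: "'t rel"
  assumes inac: "inaccessible |UNIV :: 'u set|"
    and asc: "almost_strongly_compact \<kappa>" and \<nu>: "Card_order (\<nu> :: 'u rel)" "\<nu> <o \<kappa>"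
    and \<tau>: "Cinfinite \<tau>" "regularCard \<tau>" "\<kappa> \<le>o \<tau>"
    and S: "|S| <o |UNIV :: 'u set|"
  obtains X :: "'u set" and U and d :: "'u \<Rightarrow> 's set"
  where "small X" "U \<le> principal X" "ultrafilter U" "complete_filter \<nu> U"
    "\<And>x. x \<in> X \<Longrightarrow> d x \<subseteq> S \<and> |d x| <o \<tau>" "\<And>s. s \<in> S \<Longrightarrow> eventually (\<lambda>x. s \<in> d x) U"
proof -
  define PS where "PS = {Y. Y \<subseteq> S \<and> |Y| <o \<tau>}"
  define F where "F = (INF Y\<in>PS. principal {Z \<in> PS. Y \<subseteq> Z})"
  have empty: "{} \<in> PS"
    using finite_ordLess_Cinfinite[OF _ \<tau>(1), of "{}"] by (simp add: PS_def)
  have UN: "(\<Union>i\<in>I. A i) \<in> PS" if "|I| <o \<tau>" "\<And>i. i \<in> I \<Longrightarrow> A i \<in> PS" for I :: "'i set" and A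
    using card_of_UNION_ordLess_infinite_Field_regularCard[OF \<tau>(2,1) that(1), of A] that(2)
    unfolding PS_def by blast
  have ev: "eventually P F \<longleftrightarrow> (\<exists>Y\<in>PS. \<forall>Z\<in>PS. Y \<subseteq> Z \<longrightarrow> P Z)" for P
  proof -
    have "\<exists>C\<in>PS. principal {Z \<in> PS. C \<subseteq> Z} \<le>
        inf (principal {Z \<in> PS. A \<subseteq> Z}) (principal {Z \<in> PS. B \<subseteq> Z})"
      if "A \<in> PS" "B \<in> PS" for A B
    proof -
      have "(\<Union>i\<in>UNIV. if i then A else B) \<in> PS"
        using that finite_ordLess_Cinfinite[OF _ \<tau>(1), of "UNIV :: bool set"] by (intro UN) auto
      then have "A \<union> B \<in> PS" by (simp add: UNIV_bool Un_commute)
      then show ?thesis by (intro bexI[of _ "A \<union> B"]) auto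
    qed
    then have "eventually P F \<longleftrightarrow> (\<exists>Y\<in>PS. eventually P (principal {Z \<in> PS. Y \<subseteq> Z}))"
      unfolding F_def using empty by (intro eventually_INF_base) auto
    then show ?thesis by (simp add: eventually_principal) blast
  qed
  have 1: "|PS| <o |UNIV :: 'u set|"
    using card_of_subset_less[of PS "Pow S"] card_of_Pow_less[OF inac S] unfolding PS_def by blast
  have 2: "F \<le> principal PS" unfolding le_principal ev using empty by blast
  have 3: "F \<noteq> bot" unfolding trivial_limit_def ev by blast
  have 4: "complete_filter \<kappa> F"
    unfolding complete_filter_def
  proof (intro allI impI)
    fix \<A> :: "'s set set set"
    assume A: "|\<A>| <o \<kappa> \<and> (\<forall>A\<in>\<A>. eventually (\<lambda>x. x \<in> A) F)"
    then obtain Y where Y: "\<And>A. A \<in> \<A> \<Longrightarrow> Y A \<in> PS \<and> (\<forall>Z\<in>PS. Y A \<subseteq> Z \<longrightarrow> Z \<in> A)"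
      unfolding ev by metis
    have "(\<Union>A\<in>\<A>. Y A) \<in> PS" using A \<tau>(3) Y by (intro UN) (blast intro: ordLess_ordLeq_trans)+
    moreover have "\<forall>Z\<in>PS. (\<Union>A\<in>\<A>. Y A) \<subseteq> Z \<longrightarrow> Z \<in> \<Inter>\<A>" using Y by blast
    ultimately show "eventually (\<lambda>x. x \<in> \<Inter>\<A>) F" unfolding ev by blast
  qed
  obtain X :: "'u set" and U and d :: "'u \<Rightarrow> 's set"
    where "small X" "U \<le> principal X" "ultrafilter U" "complete_filter \<nu> U"
      and d: "\<And>x. x \<in> X \<Longrightarrow> d x \<in> PS" "\<And>P. eventually P F \<Longrightarrow> eventually (\<lambda>x. P (d x)) U"
    using almost_strongly_compact_extend[OF asc \<nu> 1 2 3 4] by blast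
  moreover have "eventually (\<lambda>x. s \<in> d x) U" if "s \<in> S" for s
  proof (rule d(2))
    have "{s} \<in> PS"
      using that finite_ordLess_Cinfinite[OF _ \<tau>(1), of "{s}"] by (simp add: PS_def)
    then show "eventually (\<lambda>x. s \<in> x) F" unfolding ev by blast
  qed
  ultimately show ?thesis using that unfolding PS_def by blast
qed

text \<open>The cofinality of a well-order of size at most \<kappa> is finite or a regular cardinal
  at most \<kappa>, hence smaller than a singular \<kappa>. Argued directly: enumerate
  \<open>D\<close> along \<kappa> and take the initial segments at the points of a short cofinal
  \<open>K\<close>. If no small cofinal \<open>E\<close> existed, each segment would have an upper
  bound in \<open>D\<close>, and these bounds, at most \<open>|K|\<close> many, would form a small
  cofinal set.\<close>

lemma small_cofinal_subset:
  assumes \<kappa>: "Cinfinite \<kappa>" "\<not> regularCard \<kappa>" and r: "Well_order r"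
    and D: "D \<subseteq> Field r" "|D| \<le>o \<kappa>"
  shows "\<exists>E \<subseteq> D. |E| <o \<kappa> \<and> (\<forall>d\<in>D. \<exists>e\<in>E. (d, e) \<in> r)"
proof (rule ccontr)
  assume "\<not> ?thesis"
  then have no: "\<exists>d\<in>D. \<forall>e\<in>E. (d, e) \<notin> r" if "E \<subseteq> D" "|E| <o \<kappa>" for E
    using that by simp
  have wo: "Well_order \<kappa>" using \<kappa>(1) by (simp add: card_order_on_def)
  obtain K where K: "K \<subseteq> Field \<kappa>" "cofinal K \<kappa>" "\<not> |K| =o \<kappa>"
    using \<kappa>(2) unfolding regularCard_def by blast
  have "|K| \<le>o \<kappa>"
    by (rule ordLeq_ordIso_trans[OF card_of_mono1[OF K(1)] card_of_Field_ordIso]) (simp add: \<kappa>)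
  then have K_less: "|K| <o \<kappa>" using K(3) unfolding ordLeq_iff_ordLess_or_ordIso by simp
  have ne: "D \<noteq> {}"
  proof
    assume "D = {}"
    moreover have "|{} :: 'b set| <o \<kappa>" by (rule finite_ordLess_Cinfinite[OF _ \<kappa>(1)]) simp
    ultimately show False using no[of "{}"] by simp
  qed
  have "|D| \<le>o |Field \<kappa>|"
    by (rule ordLeq_ordIso_trans[OF D(2) ordIso_symmetric[OF card_of_Field_ordIso]]) (simp add: \<kappa>)
  then obtain g where g: "g ` Field \<kappa> = D"
    unfolding card_of_ordLeq2[OF ne, symmetric] by (rule exE)
  have "\<exists>d\<in>D. \<forall>e\<in>g ` underS \<kappa> k. (e, d) \<in> r" if "k \<in> K" for k
  proof -
    have less: "|g ` underS \<kappa> k| <o \<kappa>"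
      using card_of_underS[of \<kappa> k] \<kappa>(1) K(1) that by (intro card_of_image_less) blast
    have sub: "g ` underS \<kappa> k \<subseteq> D"
      using g unfolding underS_def Field_def by blast
    obtain d where d: "d \<in> D" "\<forall>e\<in>g ` underS \<kappa> k. (d, e) \<notin> r"
      using no[OF sub less] by blast
    have "(e, d) \<in> r" if "e \<in> g ` underS \<kappa> k" for e
      using wo_rel.in_notinI[of r d e] r d D(1) sub that unfolding wo_rel_def by blast
    then show ?thesis using d(1) by blast
  qed
  then obtain b where b: "\<And>k. k \<in> K \<Longrightarrow> b k \<in> D \<and> (\<forall>e\<in>g ` underS \<kappa> k. (e, b k) \<in> r)"
    by metis
  have "\<exists>e\<in>b ` K. (d, e) \<in> r" if d: "d \<in> D" for d
  proof -
    obtain j where j: "j \<in> Field \<kappa>" "d = g j" using d g by blast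
    then obtain k where k: "k \<in> K" "j \<noteq> k" "(j, k) \<in> \<kappa>"
      using K(2) unfolding cofinal_def by blast
    then have "d \<in> g ` underS \<kappa> k" using j(2) unfolding underS_def by blast
    then show ?thesis using b k(1) by blast
  qed
  moreover have "b ` K \<subseteq> D" using b by blast
  ultimately show False using no[of "b ` K", OF _ card_of_image_less[OF K_less]] by blast
qed

text \<open>A set of size less than \<gamma> is not cofinal in a regular \<gamma>, which gives a
  weak bound; as an infinite cardinal has no last element, any larger point is a strict
  bound.\<close>

lemma regularCard_strict_bound:
  assumes \<gamma>: "Cinfinite \<gamma>" "regularCard \<gamma>" and A: "A \<subseteq> Field \<gamma>" "|A| <o \<gamma>"
  shows "\<exists>b\<in>Field \<gamma>. \<forall>a\<in>A. a \<in> underS \<gamma> b"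
proof -
  have wo: "wo_rel \<gamma>" using \<gamma>(1) by (simp add: wo_rel_def card_order_on_def)
  have "\<not> cofinal A \<gamma>"
    using \<gamma>(2) A(1) not_ordLess_ordIso[OF A(2)] unfolding regularCard_def by blast
  then obtain a where a: "a \<in> Field \<gamma>" "\<And>b. b \<in> A \<Longrightarrow> a = b \<or> (a, b) \<notin> \<gamma>"
    unfolding cofinal_def by blast
  obtain b where b: "b \<in> Field \<gamma>" "a \<noteq> b" "(a, b) \<in> \<gamma>"
    using infinite_Card_order_limit[OF _ _ a(1)] \<gamma>(1) unfolding cinfinite_def by blast
  have "c \<in> underS \<gamma> b" if "c \<in> A" for c
  proof -
    have ca: "(c, a) \<in> \<gamma>"
      using wo_rel.in_notinI[OF wo, of a c] a that A(1) b(3)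
        wo_rel.REFL[OF wo] by (metis refl_onD subsetD)
    have "c \<noteq> b" using ca b(2,3) wo_rel.ANTISYM[OF wo] by (auto dest: antisymD)
    then show ?thesis using ca b(3) wo_rel.TRANS[OF wo] unfolding underS_def by (auto dest: transD)
  qed
  then show ?thesis using b(1) by blast
qed

text \<open>Countable completeness suffices: the countably many sets on which consecutive members of
  a descending sequence are related have a common point, and there the values descend in
  \<open>R\<close>.\<close>

lemma wf_ultrapower:
  assumes "ultrafilter U" "complete_filter \<nu> U" "|UNIV :: nat set| <o \<nu>" "wf R"
  shows "wf {(g, h). eventually (\<lambda>x. (g x, h x) \<in> R) U}"
  unfolding wf_iff_no_infinite_down_chain
proof
  assume "\<exists>f. \<forall>i. (f (Suc i), f i) \<in> {(g, h). eventually (\<lambda>x. (g x, h x) \<in> R) U}"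
  then obtain f where "\<And>i. eventually (\<lambda>x. (f (Suc i) x, f i x) \<in> R) U" by blast
  then have "eventually (\<lambda>x. \<forall>i\<in>UNIV. (f (Suc i) x, f i x) \<in> R) U"
    by (intro complete_filter_ball[OF assms(2,3)])
  then obtain x where "\<forall>i. (f (Suc i) x, f i x) \<in> R"
    using ultrafilter_ex[OF assms(1)] by blast
  then show False
    using assms(4)[unfolded wf_iff_no_infinite_down_chain, THEN notE, OF exI[of _ "\<lambda>i. f i x"]] by simp
qed

text \<open>
  For singular \<open>\<kappa>\<close> the filter generated by the sets \<open>{x. Y \<subseteq> x}\<close> on the subsets of size less than \<open>\<kappa>\<close>
  is not \<open>\<kappa>\<close>-complete. Starting from subsets of size at most \<open>\<kappa>\<close> of a regular \<open>\<gamma>\<close>, Ketonen's argument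
  cuts them down: in the ultrapower, the supremum of the image of \<open>\<gamma>\<close> has a cofinal subset \<open>E\<close> of size
  less than \<open>\<kappa>\<close>, and the intervals meeting \<open>E\<close> among \<open>\<gamma>\<close> many disjoint ones form the required cover.
\<close>
lemma fine_ultrafilter_singular:
  fixes \<kappa> :: "'u rel" and S :: "'s set"
  assumes inac: "inaccessible |UNIV :: 'u set|"
    and asc: "almost_strongly_compact \<kappa>" and \<nu>: "Card_order (\<nu> :: 'u rel)" "\<nu> <o \<kappa>"
    and unc: "|UNIV :: nat set| <o \<nu>" and sing: "\<not> regularCard \<kappa>"
    and S: "|S| <o |UNIV :: 'u set|"
  obtains X :: "'u set" and U and d :: "'u \<Rightarrow> 's set"
  where "small X" "U \<le> principal X" "ultrafilter U" "complete_filter \<nu> U"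
    "\<And>x. x \<in> X \<Longrightarrow> d x \<subseteq> S \<and> |d x| <o \<kappa>" "\<And>s. s \<in> S \<Longrightarrow> eventually (\<lambda>x. s \<in> d x) U"
proof -
  have \<kappa>: "Card_order \<kappa>" "\<kappa> <o |UNIV :: 'u set|" "natLeq <o \<kappa>"
    using asc unfolding almost_strongly_compact_def cardinal_def by blast+
  have \<kappa>_inf: "Cinfinite \<kappa>"
    using \<kappa>(1,3) cinfinite_mono[OF ordLess_imp_ordLeq natLeq_cinfinite] by blast
  note inf = inaccessible_Cinfinite[OF inac]
  \<comment> \<open>The cardinal \<gamma> is regular and exceeds both |S| and \<kappa>: sets of size
    at most \<kappa> are bounded in it, and it has room for |S| many disjoint intervals.\<close>
  define T where "T = S <+> Field \<kappa>"
  define \<gamma> where "\<gamma> = cardSuc |T|"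
  define F where "F = Field \<gamma>"
  have T: "|T| <o |UNIV :: 'u set|"
    unfolding T_def
    using card_of_Plus_ordLess_infinite_Field[of "|UNIV :: 'u set|" S "Field \<kappa>"] inf S
      ordIso_ordLess_trans[OF card_of_Field_ordIso[OF \<kappa>(1)] \<kappa>(2)] unfolding cinfinite_def by blast
  have T_inf: "Cinfinite |T|"
    using \<kappa>_inf unfolding cinfinite_def T_def by (simp add: Field_card_of card_of_card_order_on)
  have \<gamma>: "Cinfinite \<gamma>" "regularCard \<gamma>"
    unfolding \<gamma>_def using Cinfinite_cardSuc[OF T_inf] regularCard_cardSuc[OF T_inf] .
  have wo: "wo_rel \<gamma>" using \<gamma>(1) by (simp add: wo_rel_def card_order_on_def)
  have T\<gamma>: "|T| <o \<gamma>" unfolding \<gamma>_def by (rule cardSuc_greater[OF card_of_Card_order])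
  have S\<gamma>: "|S| <o \<gamma>"
    using ordLeq_ordLess_trans[OF card_of_Plus1 T\<gamma>[unfolded T_def]] .
  have "|Field \<kappa>| <o \<gamma>"
    using ordLeq_ordLess_trans[OF card_of_Plus2 T\<gamma>[unfolded T_def]] .
  then have \<kappa>\<gamma>: "\<kappa> <o \<gamma>"
    by (rule ordIso_ordLess_trans[OF ordIso_symmetric[OF card_of_Field_ordIso[OF \<kappa>(1)]]])
  have "\<gamma> \<le>o |Pow T|"
    unfolding \<gamma>_def by (rule cardSuc_least[OF card_of_Card_order card_of_Card_order card_of_Pow])
  then have F_small: "|F| <o |UNIV :: 'u set|"
    unfolding F_def using \<gamma>(1)
    by (intro ordIso_ordLess_trans[OF card_of_Field_ordIso
          ordLeq_ordLess_trans[OF _ card_of_Pow_less[OF inac T]]]) simp_all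
  define lt where "lt a b \<longleftrightarrow> a \<in> underS \<gamma> b" for a b
  have lin: "lt a b \<or> (b, a) \<in> \<gamma>" if "a \<in> F" "b \<in> F" for a b
    using wo_rel.in_notinI[OF wo, of b a] wo_rel.REFL[OF wo] that
    unfolding lt_def underS_def F_def by (cases "a = b") (auto dest: refl_onD)
  have lt_le: "lt a b \<Longrightarrow> (a, b) \<in> \<gamma>" for a b
    unfolding lt_def underS_def by blast
  have lt_F: "a \<in> F" "b \<in> F" if "(a, b) \<in> \<gamma>" for a b
    using that unfolding F_def Field_def by auto
  have lt_not_le: "lt a b \<Longrightarrow> (b, a) \<notin> \<gamma>" for a b
    using wo_rel.ANTISYM[OF wo] unfolding lt_def underS_def by (auto dest: antisymD)
  have le_trans: "(a, b) \<in> \<gamma> \<Longrightarrow> (b, c) \<in> \<gamma> \<Longrightarrow> (a, c) \<in> \<gamma>" for a b c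
    using wo_rel.TRANS[OF wo] by (auto dest: transD)
  have le_refl: "a \<in> F \<Longrightarrow> (a, a) \<in> \<gamma>" for a
    using wo_rel.REFL[OF wo] unfolding F_def by (auto dest: refl_onD)
  have bound: "\<exists>b\<in>F. \<forall>a\<in>A. lt a b" if "A \<subseteq> F" "|A| <o \<gamma>" for A
    using regularCard_strict_bound[OF \<gamma>] that unfolding lt_def F_def by blast
  obtain X :: "'u set" and U and d
    where XU: "small X" "U \<le> principal X" "ultrafilter U" "complete_filter \<nu> U"
      and d: "\<And>x. x \<in> X \<Longrightarrow> d x \<subseteq> F \<and> |d x| <o cardSuc \<kappa>"
        "\<And>i. i \<in> F \<Longrightarrow> eventually (\<lambda>x. i \<in> d x) U"
    using fine_ultrafilter_regular[OF inac asc \<nu> Cinfinite_cardSuc[OF \<kappa>_inf]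
        regularCard_cardSuc[OF \<kappa>_inf] cardSuc_ordLeq[OF \<kappa>(1)] F_small] by blast
  have d_le: "|d x| \<le>o \<kappa>" if "x \<in> X" for x
    using d(1)[OF that] cardSuc_ordLeq_ordLess[OF \<kappa>(1) card_of_Card_order] by blast
  have evX: "eventually (\<lambda>x. x \<in> X) U"
    using XU(2) by (simp add: le_principal)
  \<comment> \<open>\<open>G\<close> represents the strict upper bounds, in the ultrapower of
    \<gamma>, of all constants. It is inhabited by a pointwise bound \<open>h0\<close> of the sets
    \<open>d x\<close>, because \<open>d\<close> is fine, and a minimal member \<open>g\<close>
    represents the supremum of the constants.\<close>
  define G where "G = {h. (\<forall>x. h x \<in> F) \<and> (\<forall>i\<in>F. eventually (\<lambda>x. lt i (h x)) U)}"
  \<comment> \<open>The size of \<open>d x\<close> is controlled for \<open>x\<close> in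
    \<open>X\<close> only; the default \<open>{}\<close> elsewhere makes \<open>h0\<close> total
    with values in \<open>F\<close>.\<close>
  have "\<exists>b\<in>F. \<forall>a\<in>(if x \<in> X then d x else {}). lt a b" for x
  proof (rule bound)
    show "(if x \<in> X then d x else {}) \<subseteq> F" using d(1) by simp
    show "|if x \<in> X then d x else {}| <o \<gamma>"
      using ordLeq_ordLess_trans[OF d_le \<kappa>\<gamma>]
        finite_ordLess_Cinfinite[OF finite.emptyI[where 'a = "('s + 'u) set"] \<gamma>(1)] by simp
  qed
  then obtain h0 where h0: "\<And>x. h0 x \<in> F" "\<And>x a. x \<in> X \<Longrightarrow> a \<in> d x \<Longrightarrow> lt a (h0 x)"
    by metis
  have "h0 \<in> G"
  proof -
    have "eventually (\<lambda>x. lt i (h0 x)) U" if "i \<in> F" for i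
      using evX d(2)[OF that] by eventually_elim (rule h0(2))
    then show ?thesis unfolding G_def using h0(1) by simp
  qed
  moreover have "wf {(g, h). eventually (\<lambda>x. (g x, h x) \<in> \<gamma> - Id) U}"
    using wo_rel.WF[OF wo] by (rule wf_ultrapower[OF XU(3,4) unc])
  ultimately have "\<exists>g\<in>G. \<forall>h. (h, g) \<in> {(g, h). eventually (\<lambda>x. (g x, h x) \<in> \<gamma> - Id) U} \<longrightarrow> h \<notin> G"
    unfolding wf_eq_minimal by blast
  then obtain g where g: "g \<in> G"
      and g_min: "\<forall>h. (h, g) \<in> {(g, h). eventually (\<lambda>x. (g x, h x) \<in> \<gamma> - Id) U} \<longrightarrow> h \<notin> G"
    by (rule bexE)
  \<comment> \<open>By minimality of \<open>g\<close>, a function below \<open>g\<close> fails to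
    exceed some constant \<open>i\<close> almost everywhere; the ultrafilter turns this failure into
    the bound \<open>i\<close>.\<close>
  have below: "\<exists>i\<in>F. eventually (\<lambda>x. (h x, i) \<in> \<gamma>) U"
    if h: "\<And>x. h x \<in> F" "eventually (\<lambda>x. lt (h x) (g x)) U" for h
  proof -
    have "eventually (\<lambda>x. (h x, g x) \<in> \<gamma> - Id) U"
      using h(2) by (rule eventually_mono) (auto simp: lt_def underS_def)
    then have "h \<notin> G" using g_min by simp
    then obtain i where i: "i \<in> F" "\<not> eventually (\<lambda>x. lt i (h x)) U"
      using h(1) unfolding G_def by blast
    then have "eventually (\<lambda>x. \<not> lt i (h x)) U" using ultrafilter_not[OF XU(3)] by blast
    then have "eventually (\<lambda>x. (h x, i) \<in> \<gamma>) U"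
      by (rule eventually_mono) (use lin h(1) i(1) in blast)
    then show ?thesis using i(1) by blast
  qed
  have "\<exists>E \<subseteq> {a \<in> d x. lt a (g x)}. |E| <o \<kappa> \<and> (\<forall>a\<in>{a \<in> d x. lt a (g x)}. \<exists>e\<in>E. (a, e) \<in> \<gamma>)"
    if x: "x \<in> X" for x
  proof (rule small_cofinal_subset[OF \<kappa>_inf sing])
    show "Well_order \<gamma>" using wo by (simp add: wo_rel_def)
    show "{a \<in> d x. lt a (g x)} \<subseteq> Field \<gamma>" using d(1)[OF x] unfolding F_def by blast
    show "|{a \<in> d x. lt a (g x)}| \<le>o \<kappa>"
      by (rule ordLeq_transitive[OF card_of_mono1 d_le[OF x]]) blast
  qed
  then obtain E where E: "\<forall>x\<in>X. E x \<subseteq> {a \<in> d x. lt a (g x)} \<and> |E x| <o \<kappa> \<and>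
      (\<forall>a\<in>{a \<in> d x. lt a (g x)}. \<exists>e\<in>E x. (a, e) \<in> \<gamma>)"
    using bchoice[of X "\<lambda>x E. E \<subseteq> {a \<in> d x. lt a (g x)} \<and> |E| <o \<kappa> \<and>
      (\<forall>a\<in>{a \<in> d x. lt a (g x)}. \<exists>e\<in>E. (a, e) \<in> \<gamma>)"] by auto
  \<comment> \<open>Almost everywhere \<open>i\<close> lies in \<open>d x\<close> and below
    \<open>g x\<close>, so the cofinal \<open>E x\<close> has a member \<open>e x\<close> above it.
    The function \<open>e\<close> stays below the supremum \<open>g\<close>, hence below a constant
    \<open>j\<close>. Thus one interval from \<open>i\<close> to \<open>j\<close> meets
    \<open>E x\<close> for almost all \<open>x\<close>.\<close>
  have "\<exists>j\<in>F. eventually (\<lambda>x. \<exists>e\<in>E x. (i, e) \<in> \<gamma> \<and> (e, j) \<in> \<gamma>) U" if i: "i \<in> F" for i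
  proof -
    define good where "good x e \<longleftrightarrow> e \<in> E x \<and> (i, e) \<in> \<gamma> \<and> lt e (g x)" for x e
    define e where "e x = (if \<exists>e. good x e then SOME e. good x e else i)" for x
    have "eventually (\<lambda>x. lt i (g x)) U" using g i unfolding G_def by blast
    then have ev: "eventually (\<lambda>x. good x (e x)) U"
      using evX d(2)[OF i]
    proof eventually_elim
      case (elim x)
      then have "\<exists>e. good x e" using bspec[OF E elim(2)] unfolding good_def by blast
      then show ?case unfolding e_def by (simp add: someI_ex)
    qed
    have "e x \<in> F" for x
    proof (cases "\<exists>e. good x e")
      case True
      then have "good x (e x)" unfolding e_def by (simp add: someI_ex)
      then show ?thesis using lt_F unfolding good_def by blast
    qed (simp add: e_def i)
    moreover have "eventually (\<lambda>x. lt (e x) (g x)) U"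
      using ev by (rule eventually_mono) (simp add: good_def)
    ultimately obtain j where j: "j \<in> F" "eventually (\<lambda>x. (e x, j) \<in> \<gamma>) U"
      using below by blast
    have "eventually (\<lambda>x. \<exists>e\<in>E x. (i, e) \<in> \<gamma> \<and> (e, j) \<in> \<gamma>) U"
      using ev j(2) by eventually_elim (auto simp: good_def)
    then show ?thesis using j(1) by blast
  qed
  then have "\<forall>i\<in>F. \<exists>j. j \<in> F \<and> eventually (\<lambda>x. \<exists>e\<in>E x. (i, e) \<in> \<gamma> \<and> (e, j) \<in> \<gamma>) U"
    by blast
  from bchoice[OF this] obtain h where h: "\<And>i. i \<in> F \<Longrightarrow> h i \<in> F"
      "\<And>i. i \<in> F \<Longrightarrow> eventually (\<lambda>x. \<exists>e\<in>E x. (i, e) \<in> \<gamma> \<and> (e, h i) \<in> \<gamma>) U"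
    by blast
  \<comment> \<open>Sets of left endpoints \<open>c\<close> whose intervals from \<open>c\<close> to
    \<open>h c\<close> are pairwise disjoint.\<close>
  define CC where "CC = {C. C \<subseteq> F \<and> (\<forall>c\<in>C. \<forall>c'\<in>C. lt c c' \<longrightarrow> lt (h c) c')}"
  have "\<exists>C\<in>CC. \<forall>C'\<in>CC. C \<subseteq> C' \<longrightarrow> C' = C"
  proof (rule subset_Zorn_nonempty)
    show "CC \<noteq> {}" unfolding CC_def by blast
    fix \<C> assume \<C>: "\<C> \<noteq> {}" "subset.chain CC \<C>"
    have "lt (h c) c'" if cc: "c \<in> A" "A \<in> \<C>" "c' \<in> B" "B \<in> \<C>" "lt c c'" for c c' A B
    proof -
      have "A \<subseteq> B \<or> B \<subseteq> A" "A \<in> CC" "B \<in> CC"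
        using \<C>(2) cc unfolding subset_chain_def by blast+
      then show ?thesis using cc unfolding CC_def by blast
    qed
    moreover have "\<Union>\<C> \<subseteq> F" using \<C>(2) unfolding subset_chain_def CC_def by blast
    ultimately show "\<Union>\<C> \<in> CC" unfolding CC_def by blast
  qed
  then obtain C where C: "C \<in> CC" "\<And>C'. C' \<in> CC \<Longrightarrow> C \<subseteq> C' \<Longrightarrow> C' = C" by blast
  \<comment> \<open>A smaller \<open>C\<close>, together with its right endpoints, would be strictly
    bounded in the regular \<gamma>, and the bound could be added as a new left endpoint.\<close>
  have "\<not> |C| <o \<gamma>"
  proof
    assume less: "|C| <o \<gamma>"
    have un: "|C \<union> h ` C| <o \<gamma>"
      using less by (intro Un_Cinfinite_bound_strict card_of_image_less \<gamma>(1))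
    have sub: "C \<union> h ` C \<subseteq> F" using C(1) h(1) unfolding CC_def by blast
    obtain b where b: "b \<in> F" "\<And>a. a \<in> C \<union> h ` C \<Longrightarrow> lt a b"
      using bound[OF sub un] by blast
    have "\<not> lt b c" if "c \<in> C" for c
      using b(2)[of c] that lt_not_le lt_le by blast
    moreover have "\<not> lt b b" unfolding lt_def underS_def by blast
    ultimately have "insert b C \<in> CC" using C(1) b unfolding CC_def by blast
    then have "b \<in> C" using C(2) by blast
    then show False using b(2)[of b] \<open>\<not> lt b b\<close> by blast
  qed
  then have "\<gamma> \<le>o |C|"
    using not_ordLess_iff_ordLeq[of \<gamma> "|C|"] wo card_of_Well_order[of C]
    unfolding wo_rel_def by blast
  then have "|S| \<le>o |C|"
    by (rule ordLess_imp_ordLeq[OF ordLess_ordLeq_trans[OF S\<gamma>]])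
  then obtain \<iota> where \<iota>: "inj_on \<iota> S" "\<iota> ` S \<subseteq> C"
    unfolding card_of_ordLeq[symmetric] by (elim exE conjE)
  have C_F: "C \<subseteq> F" using C(1) unfolding CC_def by blast
  \<comment> \<open>The indices whose interval meets \<open>E x\<close>. By disjointness a point of
    \<open>E x\<close> lies in at most one interval, so \<open>d' x\<close> is no larger than
    \<open>E x\<close>; fineness is the choice of \<open>h\<close>.\<close>
  define d' where "d' x = {s \<in> S. \<exists>e\<in>E x. (\<iota> s, e) \<in> \<gamma> \<and> (e, h (\<iota> s)) \<in> \<gamma>}" for x
  show ?thesis
  proof (rule that[OF XU, of d'])
    fix x assume x: "x \<in> X"
    have "\<forall>s\<in>d' x. \<exists>e. e \<in> E x \<and> (\<iota> s, e) \<in> \<gamma> \<and> (e, h (\<iota> s)) \<in> \<gamma>"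
      unfolding d'_def by blast
    from bchoice[OF this] obtain f
      where f: "\<And>s. s \<in> d' x \<Longrightarrow> f s \<in> E x \<and> (\<iota> s, f s) \<in> \<gamma> \<and> (f s, h (\<iota> s)) \<in> \<gamma>"
      by blast
    have no: "\<not> lt (\<iota> s) (\<iota> t)" if "s \<in> d' x" "t \<in> d' x" "f s = f t" for s t
    proof
      assume "lt (\<iota> s) (\<iota> t)"
      moreover have "\<iota> s \<in> C" "\<iota> t \<in> C" using that \<iota>(2) unfolding d'_def by blast+
      ultimately have "lt (h (\<iota> s)) (\<iota> t)" using C(1) unfolding CC_def by blast
      moreover have "(\<iota> t, h (\<iota> s)) \<in> \<gamma>" using le_trans[of "\<iota> t" "f t" "h (\<iota> s)"] f[OF that(1)] f[OF that(2)] that(3) by simp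
      ultimately show False using lt_not_le by blast
    qed
    have "inj_on f (d' x)"
    proof (rule inj_onI)
      fix s t assume st: "s \<in> d' x" "t \<in> d' x" "f s = f t"
      then have "\<iota> s \<in> F" "\<iota> t \<in> F" using \<iota>(2) C_F unfolding d'_def by blast+
      then have "\<iota> s = \<iota> t"
        using no[OF st] no[OF st(2,1)] st(3) lin[of "\<iota> s" "\<iota> t"] lin[of "\<iota> t" "\<iota> s"]
          antisymD[OF wo_rel.ANTISYM[OF wo]] by simp
      then show "s = t" using \<iota>(1) st unfolding d'_def inj_on_def by blast
    qed
    then have "|d' x| \<le>o |E x|" using f by (intro card_of_ordLeqI[of f]) simp_all
    then show "d' x \<subseteq> S \<and> |d' x| <o \<kappa>"
      using bspec[OF E x] ordLeq_ordLess_trans[of "|d' x|" "|E x|" \<kappa>] unfolding d'_def by simp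
  next
    fix s assume s: "s \<in> S"
    then have "\<iota> s \<in> F" using \<iota>(2) C_F by blast
    from h(2)[OF this] show "eventually (\<lambda>x. s \<in> d' x) U"
      by (rule eventually_mono) (simp add: d'_def s)
  qed
qed

lemma fine_ultrafilter:
  fixes \<kappa> :: "'u rel" and S :: "'s set"
  assumes inac: "inaccessible |UNIV :: 'u set|"
    and asc: "almost_strongly_compact \<kappa>" and \<nu>: "Card_order (\<nu> :: 'u rel)" "\<nu> <o \<kappa>"
    and unc: "|UNIV :: nat set| <o \<nu>"
    and S: "|S| <o |UNIV :: 'u set|"
  obtains X :: "'u set" and U and d :: "'u \<Rightarrow> 's set"
  where "small X" "U \<le> principal X" "ultrafilter U" "complete_filter \<nu> U"
    "\<And>x. x \<in> X \<Longrightarrow> d x \<subseteq> S \<and> |d x| <o \<kappa>" "\<And>s. s \<in> S \<Longrightarrow> eventually (\<lambda>x. s \<in> d x) U"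
proof (cases "regularCard \<kappa>")
  case True
  have \<kappa>: "Card_order \<kappa>" "natLeq <o \<kappa>"
    using asc unfolding almost_strongly_compact_def cardinal_def by blast+
  then have "Cinfinite \<kappa>"
    using cinfinite_mono[OF ordLess_imp_ordLeq[of natLeq \<kappa>] natLeq_cinfinite] by simp
  from fine_ultrafilter_regular[OF inac asc \<nu> this True ordLeq_refl[OF \<kappa>(1)] S]
  show ?thesis using that by blast
next
  case False
  from fine_ultrafilter_singular[OF inac asc \<nu> unc False S]
  show ?thesis using that by blast
qed

section \<open>Structures\<close>

lemma is_struct_fint:
  "is_struct L M \<Longrightarrow> F \<in> Funs L \<Longrightarrow> z \<in> fargs L F (carr M) \<Longrightarrow> fint M F z \<in> carr M"
  unfolding is_struct_def by blast

lemma is_struct_rint: "is_struct L M \<Longrightarrow> R \<in> Rels L \<Longrightarrow> rint M R \<subseteq> rargs L R (carr M)"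
  unfolding is_struct_def by blast

text \<open>This is equality in HOL because \<open>is_struct\<close> also fixes the interpretations
  outside their domains.\<close>

lemma substruct_eqI:
  fixes M N :: "('f, 'r, 'u) struct"
  assumes "substruct L M N" "carr M = carr N"
  shows "M = N"
proof (rule struct.equality)
  have s: "is_struct L M" "is_struct L N" using assms(1) unfolding substruct_def by blast+
  show "fint M = fint N"
  proof
    fix F show "fint M F = fint N F"
    proof (cases "F \<in> Funs L")
      case True
      have "fint M F \<in> fargs L F (carr N) \<rightarrow>\<^sub>E carr N" "fint N F \<in> fargs L F (carr N) \<rightarrow>\<^sub>E carr N"
        using s True assms(2) unfolding is_struct_def by auto
      then show ?thesis
        by (rule PiE_ext) (use assms True in \<open>auto simp: substruct_def\<close>)
    qed (use s in \<open>simp add: is_struct_def\<close>)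
  qed
  show "rint M = rint N"
  proof
    fix R show "rint M R = rint N R"
    proof (cases "R \<in> Rels L")
      case True
      then show ?thesis
        using assms is_struct_rint[OF s(2) True] unfolding substruct_def by blast
    qed (use s in \<open>simp add: is_struct_def\<close>)
  qed
qed (use assms in simp_all)

lemma PiE_range_mono: "A \<subseteq> B \<Longrightarrow> D \<rightarrow>\<^sub>E A \<subseteq> D \<rightarrow>\<^sub>E B"
  by (rule PiE_mono)

lemma substruct_of_carr_subset:
  assumes M: "substruct L M Q" and N: "substruct L N Q" and sub: "carr M \<subseteq> carr N"
  shows "substruct L M N"
proof -
  have "fint M F z = fint N F z" if "F \<in> Funs L" "z \<in> fargs L F (carr M)" for F z
  proof -
    have "z \<in> fargs L F (carr N)" using that(2) PiE_range_mono[OF sub] by blast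
    then show ?thesis using that M N unfolding substruct_def by simp
  qed
  moreover have "rint M R = rint N R \<inter> rargs L R (carr M)" if "R \<in> Rels L" for R
  proof -
    have "rint M R = rint Q R \<inter> rargs L R (carr M)" "rint N R = rint Q R \<inter> rargs L R (carr N)"
      using that M N unfolding substruct_def by blast+
    then show ?thesis using PiE_range_mono[OF sub, of "Field (rarity L R)"] by blast
  qed
  ultimately show ?thesis
    using assms unfolding substruct_def by blast
qed

lemma compose_PiE: "z \<in> D \<rightarrow>\<^sub>E A \<Longrightarrow> (\<And>a. a \<in> A \<Longrightarrow> f a \<in> B) \<Longrightarrow> compose D f z \<in> D \<rightarrow>\<^sub>E B"
  unfolding compose_def by auto

lemma compose_cong: "(\<And>i. i \<in> D \<Longrightarrow> f (z i) = g (y i)) \<Longrightarrow> compose D f z = compose D g y"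
  unfolding compose_def by (rule restrict_ext)

lemma compose_eq_self: "z \<in> D \<rightarrow>\<^sub>E A \<Longrightarrow> (\<And>i. i \<in> D \<Longrightarrow> f (z i) = z i) \<Longrightarrow> compose D f z = z"
  unfolding compose_def by (rule ext) (auto simp: PiE_def extensional_def)

lemma struct_iso_inverse:
  fixes M N :: "('f, 'r, 'u) struct"
  assumes iso: "struct_iso L f M N" and g: "\<And>a. a \<in> carr M \<Longrightarrow> g (f a) = a"
  shows "struct_iso L g N M"
proof -
  have bij: "bij_betw f (carr M) (carr N)" and s: "is_struct L M" "is_struct L N"
    using iso unfolding struct_iso_def by blast+
  have fg: "g b \<in> carr M \<and> f (g b) = b" if b: "b \<in> carr N" for b
  proof -
    obtain a where "a \<in> carr M" "b = f a" using bij b unfolding bij_betw_def by blast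
    then show ?thesis using g by simp
  qed
  have z: "compose D f (compose D g z) = z" "compose D g z \<in> D \<rightarrow>\<^sub>E carr M"
    if "z \<in> D \<rightarrow>\<^sub>E carr N" for D and z :: "'u \<Rightarrow> 'u"
    using that fg
    by (auto simp: compose_def PiE_def extensional_def fun_eq_iff Pi_def)
  have "bij_betw g (carr N) (carr M)"
    by (rule bij_betw_byWitness[where f' = f]) (use fg g bij in \<open>auto simp: bij_betw_def\<close>)
  moreover have "g (fint N F y) = fint M F (compose (Field (farity L F)) g y)"
    if F: "F \<in> Funs L" and y: "y \<in> fargs L F (carr N)" for F y
  proof -
    have "f (fint M F (compose (Field (farity L F)) g y)) = fint N F y"
      using iso F z[OF y] unfolding struct_iso_def by metis
    then show ?thesis
      using g is_struct_fint[OF s(1) F z(2)[OF y]] by metis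
  qed
  moreover have "y \<in> rint N R \<longleftrightarrow> compose (Field (rarity L R)) g y \<in> rint M R"
    if R: "R \<in> Rels L" and y: "y \<in> rargs L R (carr N)" for R y
    using iso R z[OF y] unfolding struct_iso_def by metis
  ultimately show ?thesis
    using s unfolding struct_iso_def by blast
qed

text \<open>\<open>union_struct\<close> chooses, for each argument tuple, some member that contains
  it. Inside a common superstructure \<open>Q\<close> every choice computes the value of
  \<open>Q\<close>, so the union is \<open>Q\<close> as soon as each tuple of \<open>Q\<close> lies
  in a single member.\<close>

lemma union_struct_eq:
  fixes Q :: "('f, 'r, 'u) struct"
  assumes Q: "is_struct L Q" and sub: "\<And>i. i \<in> I \<Longrightarrow> substruct L (M i) Q"
    and carr: "carr Q = (\<Union>i\<in>I. carr (M i))"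
    and F: "\<And>F z. F \<in> Funs L \<Longrightarrow> z \<in> fargs L F (carr Q) \<Longrightarrow> \<exists>i\<in>I. z \<in> fargs L F (carr (M i))"
    and R: "\<And>R z. R \<in> Rels L \<Longrightarrow> z \<in> rargs L R (carr Q) \<Longrightarrow> \<exists>i\<in>I. z \<in> rargs L R (carr (M i))"
  shows "union_struct L I M = Q"
proof (rule struct.equality)
  show "carr (union_struct L I M) = carr Q" by (simp add: union_struct_def carr)
  show "fint (union_struct L I M) = fint Q"
  proof (intro ext)
    fix f z
    show "fint (union_struct L I M) f z = fint Q f z"
    proof (cases "f \<in> Funs L \<and> (\<exists>i\<in>I. z \<in> fargs L f (carr (M i)))")
      case True
      define i where "i = (SOME i. i \<in> I \<and> z \<in> fargs L f (carr (M i)))"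
      have i: "i \<in> I" "z \<in> fargs L f (carr (M i))"
        using someI_ex[of "\<lambda>i. i \<in> I \<and> z \<in> fargs L f (carr (M i))"] True
        unfolding i_def by blast+
      then have "fint (M i) f z = fint Q f z"
        using sub[OF i(1)] True unfolding substruct_def by blast
      then show ?thesis using True by (simp add: union_struct_def i_def)
    next
      case False
      have "fint Q f z = undefined"
      proof (cases "f \<in> Funs L")
        case True
        then have "z \<notin> fargs L f (carr Q)" using F False by blast
        moreover have "fint Q f \<in> fargs L f (carr Q) \<rightarrow>\<^sub>E carr Q"
          using Q True unfolding is_struct_def by blast
        ultimately show ?thesis by (rule PiE_arb[rotated])
      qed (use Q in \<open>simp add: is_struct_def\<close>)
      then show ?thesis using False by (auto simp: union_struct_def)
    qed
  qed
  show "rint (union_struct L I M) = rint Q"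
  proof
    fix r
    show "rint (union_struct L I M) r = rint Q r"
    proof (cases "r \<in> Rels L")
      case True
      have "\<exists>i\<in>I. z \<in> rint (M i) r" if z: "z \<in> rint Q r" for z
      proof -
        obtain i where i: "i \<in> I" "z \<in> rargs L r (carr (M i))"
          using R[OF True] is_struct_rint[OF Q True] z by blast
        then show ?thesis using sub[OF i(1)] z True unfolding substruct_def by blast
      qed
      moreover have "rint (M i) r \<subseteq> rint Q r" if "i \<in> I" for i
        using sub[OF that] True unfolding substruct_def by blast
      ultimately show ?thesis by (auto simp: union_struct_def)
    next
      case False
      have "rint N r = {}" if "is_struct L N" for N :: "('f, 'r, 'u) struct"
        using that False unfolding is_struct_def by simp
      then have "rint Q r = {}" "\<And>i. i \<in> I \<Longrightarrow> rint (M i) r = {}"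
        using Q sub unfolding substruct_def by simp_all
      then show ?thesis by (simp add: union_struct_def)
    qed
  qed
qed simp

section \<open>Ultraproducts inside a universe\<close>

text \<open>\<open>W\<close> codes the functions from \<open>X\<close> to \<open>V\<close> modulo
  \<open>U\<close>, and \<open>e x w\<close> is the value at \<open>x\<close> of a fixed
  representative of the class coded by \<open>w\<close>. Classes of constants are coded by the
  constants themselves. The remaining classes go to points outside \<open>V\<close>, where there is
  room because the complement of a small set is as large as the universe.\<close>

lemma ex_ultrapower_coding:
  fixes X V :: "'u set" and U :: "'u filter"
  assumes inac: "inaccessible |UNIV :: 'u set|"
    and X: "small X" "U \<le> principal X" and U: "ultrafilter U" and V: "small V"
  obtains W :: "'u set" and e :: "'u \<Rightarrow> 'u \<Rightarrow> 'u"
  where "small W" "V \<subseteq> W"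
    "\<And>v w. v \<in> W \<Longrightarrow> w \<in> W \<Longrightarrow> eventually (\<lambda>x. e x v = e x w) U \<Longrightarrow> v = w"
    "\<And>f. eventually (\<lambda>x. f x \<in> V) U \<Longrightarrow> \<exists>v\<in>W. eventually (\<lambda>x. e x v = f x) U"
    "\<And>v. v \<in> V \<Longrightarrow> eventually (\<lambda>x. e x v = v) U"
proof -
  note inf = inaccessible_Cinfinite[OF inac]
  have evX: "eventually (\<lambda>x. x \<in> X) U" using X(2) by (simp add: le_principal)
  define Y where "Y = (X \<rightarrow>\<^sub>E V)"
  define cl where "cl f = {g \<in> Y. eventually (\<lambda>x. f x = g x) U}" for f
  have cl_eq: "cl f = cl g \<longleftrightarrow> eventually (\<lambda>x. f x = g x) U" if "f \<in> Y" "g \<in> Y" for f g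
  proof
    assume "cl f = cl g"
    moreover have "g \<in> cl g" using that unfolding cl_def by simp
    ultimately show "eventually (\<lambda>x. f x = g x) U" unfolding cl_def by blast
  next
    assume fg: "eventually (\<lambda>x. f x = g x) U"
    have "eventually (\<lambda>x. f x = h x) U \<longleftrightarrow> eventually (\<lambda>x. g x = h x) U" for h
      by (rule eventually_subst) (use fg in eventually_elim, simp)
    then show "cl f = cl g" unfolding cl_def by simp
  qed
  have "|cl ` Y| <o |UNIV :: 'u set|"
    unfolding Y_def using X(1) V unfolding small_def
    by (intro card_of_image_less card_of_PiE_less[OF inac])
  moreover have "\<not> |UNIV - V| <o |UNIV :: 'u set|"
  proof
    assume "|UNIV - V| <o |UNIV :: 'u set|"
    then have "|(UNIV - V) \<union> V| <o |UNIV :: 'u set|"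
      using V unfolding small_def by (intro Un_Cinfinite_bound_strict inf)
    then show False using ordLess_irreflexive[of "|UNIV :: 'u set|"] by simp
  qed
  then have "|UNIV :: 'u set| \<le>o |UNIV - V|"
    using not_ordLess_iff_ordLeq[OF card_of_Well_order card_of_Well_order] by blast
  ultimately have "|cl ` Y| \<le>o |UNIV - V|"
    by (rule ordLess_imp_ordLeq[OF ordLess_ordLeq_trans])
  then obtain c where c: "inj_on c (cl ` Y)" "c ` cl ` Y \<subseteq> UNIV - V"
    unfolding card_of_ordLeq[symmetric] by (elim exE conjE)
  define k where "k v = (\<lambda>x\<in>X. v)" for v :: 'u
  have k: "k v \<in> Y" "eventually (\<lambda>x. k v x = v) U" if "v \<in> V" for v
    using that eventually_mono[OF evX, of "\<lambda>x. k v x = v"] unfolding Y_def k_def by auto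
  have k_inj: "v = w" if "v \<in> V" "w \<in> V" "cl (k v) = cl (k w)" for v w
  proof -
    have "eventually (\<lambda>x. k v x = k w x) U" using that k cl_eq by blast
    then have "eventually (\<lambda>x. v = w) U"
      using k(2)[OF that(1)] k(2)[OF that(2)] by eventually_elim simp
    then show ?thesis using ultrafilter_ex[OF U] by blast
  qed
  define code where "code C = (if C \<in> cl ` k ` V then inv_into V (cl \<circ> k) C else c C)" for C
  have inj_k: "inj_on (cl \<circ> k) V" using k_inj by (auto intro: inj_onI)
  have code_k: "code (cl (k v)) = v" if "v \<in> V" for v
    using inv_into_f_f[OF inj_k that] that unfolding code_def by auto
  have code_V: "code C \<in> V \<longleftrightarrow> C \<in> cl ` k ` V" if "C \<in> cl ` Y" for C
  proof
    assume "code C \<in> V"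
    then show "C \<in> cl ` k ` V" using c(2) that unfolding code_def by (auto split: if_splits)
  next
    assume "C \<in> cl ` k ` V"
    then show "code C \<in> V" using code_k by auto
  qed
  have code_inj: "C = D" if "C \<in> cl ` Y" "D \<in> cl ` Y" "code C = code D" for C D
  proof (cases "C \<in> cl ` k ` V")
    case True
    then have "D \<in> cl ` k ` V" using code_V that by metis
    then show ?thesis using True code_k that(3) by auto
  next
    case False
    then have "D \<notin> cl ` k ` V" using code_V that by metis
    then have "c C = c D" using False that(3) unfolding code_def by simp
    then show ?thesis by (rule inj_onD[OF c(1) _ that(1,2)])
  qed
  define W where "W = code ` cl ` Y"
  define r where "r w = (SOME f. f \<in> Y \<and> code (cl f) = w)" for w
  have r: "r w \<in> Y \<and> code (cl (r w)) = w" if "w \<in> W" for w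
    using someI_ex[of "\<lambda>f. f \<in> Y \<and> code (cl f) = w"] that unfolding r_def W_def by blast
  have r_code: "eventually (\<lambda>x. r (code (cl f)) x = f x) U" if "f \<in> Y" for f
  proof -
    have "code (cl f) \<in> W" using that unfolding W_def by blast
    from r[OF this] have "cl (r (code (cl f))) = cl f" using code_inj that by blast
    then show ?thesis using cl_eq r[OF \<open>code (cl f) \<in> W\<close>] that by blast
  qed
  show ?thesis
  proof (rule that[of W "\<lambda>x w. r w x"])
    show "small W"
      unfolding W_def small_def Y_def using X(1) V unfolding small_def
      by (intro card_of_image_less card_of_PiE_less[OF inac])
    show "V \<subseteq> W"
    proof
      fix v assume "v \<in> V"
      then show "v \<in> W" using code_k[of v] k(1)[of v] unfolding W_def by (metis image_eqI)
    qed
    show "v = w" if "v \<in> W" "w \<in> W" "eventually (\<lambda>x. r v x = r w x) U" for v w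
      using r[OF that(1)] r[OF that(2)] cl_eq that(3) by metis
    show "eventually (\<lambda>x. r v x = v) U" if "v \<in> V" for v
      using r_code[OF k(1)[OF that]] k(2)[OF that] unfolding code_k[OF that]
      by eventually_elim simp
    show "\<exists>v\<in>W. eventually (\<lambda>x. r v x = f x) U" if f: "eventually (\<lambda>x. f x \<in> V) U" for f
    proof -
      \<comment> \<open>\<open>f\<close> takes values in \<open>V\<close> only almost everywhere;
        \<open>v0\<close> fills the exceptions, and exists because \<open>U\<close> is
        proper.\<close>
      obtain v0 where v0: "v0 \<in> V" using ultrafilter_ex[OF U f] by blast
      define g where "g = (\<lambda>x\<in>X. if f x \<in> V then f x else v0)"
      have "g \<in> Y" unfolding g_def Y_def using v0 by auto
      moreover have "eventually (\<lambda>x. g x = f x) U"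
        using f evX by eventually_elim (simp add: g_def)
      with r_code[OF \<open>g \<in> Y\<close>] have "eventually (\<lambda>x. r (code (cl g)) x = f x) U"
        by eventually_elim simp
      ultimately show ?thesis unfolding W_def by blast
    qed
  qed
qed

text \<open>Only a language is fixed here, and \<rho> stands for the later LS(K). As \<nu> exceeds
  \<rho>, the filter is complete for families of size at most \<rho>; \<open>tuples_le\<close> is
  the consequence of \<rho>^{<\<mu>} = \<rho> that counts argument tuples. The small set
  \<open>V\<close> has to contain almost all factors of an ultraproduct, so that functions into the
  factors have codes.\<close>

locale ultrapower_coding =
  fixes \<mu> \<rho> \<nu> :: "'u rel" and L :: "('f, 'r, 'u) language"
    and U :: "'u filter" and V W :: "'u set" and e :: "'u \<Rightarrow> 'u \<Rightarrow> 'u"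
  assumes uf: "ultrafilter U" and complete: "complete_filter \<nu> U" and \<rho>\<nu>: "\<rho> <o \<nu>"
    and \<rho>: "Cinfinite \<rho>" and ary: "ary_language \<mu> L" and \<mu>\<rho>: "\<mu> \<le>o \<rho>"
    and Lang_le: "|Funs L| \<le>o \<rho>" "|Rels L| \<le>o \<rho>"
    and tuples_le: "\<And>(\<alpha> :: 'u rel) (T :: 'u set). Well_order \<alpha> \<Longrightarrow> \<alpha> <o \<mu> \<Longrightarrow> |T| \<le>o \<rho> \<Longrightarrow> |Field \<alpha> \<rightarrow>\<^sub>E T| \<le>o \<rho>"
    and W_small: "small W" and V_W: "V \<subseteq> W"
    and code_eq: "\<And>v w. v \<in> W \<Longrightarrow> w \<in> W \<Longrightarrow> eventually (\<lambda>x. e x v = e x w) U \<Longrightarrow> v = w"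
    and code_ex: "\<And>f. eventually (\<lambda>x. f x \<in> V) U \<Longrightarrow> \<exists>v\<in>W. eventually (\<lambda>x. e x v = f x) U"
    and code_const: "\<And>v. v \<in> V \<Longrightarrow> eventually (\<lambda>x. e x v = v) U"
begin

section \<open>Ultraproducts of structures and Los's theorem for atomic formulas\<close>

lemma ev_ball:
  fixes I :: "'i set"
  assumes "|I| \<le>o \<rho>" "\<And>i. i \<in> I \<Longrightarrow> eventually (P i) U"
  shows "eventually (\<lambda>x. \<forall>i\<in>I. P i x) U"
  by (rule complete_filter_ball[OF complete ordLeq_ordLess_trans[OF assms(1) \<rho>\<nu>] assms(2)])

lemma ev_bex:
  fixes I :: "'i set"
  assumes "|I| \<le>o \<rho>" "eventually (\<lambda>x. \<exists>i\<in>I. P i x) U"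
  shows "\<exists>i\<in>I. eventually (P i) U"
  by (rule complete_ultrafilter_bex[OF uf complete ordLeq_ordLess_trans[OF assms(1) \<rho>\<nu>] assms(2)])

lemma farity_less: "F \<in> Funs L \<Longrightarrow> Well_order (farity L F) \<and> farity L F <o \<mu>"
  and rarity_less: "R \<in> Rels L \<Longrightarrow> Well_order (rarity L R) \<and> rarity L R <o \<mu>"
  using ary unfolding ary_language_def by blast+

lemma arity_le:
  assumes "\<alpha> <o \<mu>"
  shows "|Field \<alpha>| \<le>o \<rho>"
  by (rule ordLess_imp_ordLeq[OF ordLess_ordLeq_trans[OF ordLess_Field[OF assms] \<mu>\<rho>]])

lemma farity_le: "F \<in> Funs L \<Longrightarrow> |Field (farity L F)| \<le>o \<rho>"
  and rarity_le: "R \<in> Rels L \<Longrightarrow> |Field (rarity L R)| \<le>o \<rho>"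
  using arity_le farity_less rarity_less by blast+

definition ult_carr :: "('u \<Rightarrow> 'u set) \<Rightarrow> 'u set" where
  "ult_carr C = {v \<in> W. eventually (\<lambda>x. e x v \<in> C x) U}"

text \<open>The usual ultraproduct with codes in place of classes of functions. \<open>SOME\<close>
  has at most one candidate, because codes whose values agree almost everywhere coincide by
  \<open>code_eq\<close>.\<close>

definition ult :: "('u \<Rightarrow> ('f, 'r, 'u) struct) \<Rightarrow> ('f, 'r, 'u) struct" where
  "ult M =
     \<lparr> carr = ult_carr (\<lambda>x. carr (M x)),
       fint = (\<lambda>F z. if F \<in> Funs L \<and> z \<in> fargs L F (ult_carr (\<lambda>x. carr (M x)))
         then SOME v. v \<in> W \<and>
           eventually (\<lambda>x. e x v = fint (M x) F (compose (Field (farity L F)) (e x) z)) U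
         else undefined),
       rint = (\<lambda>R. if R \<in> Rels L
         then {z \<in> rargs L R (ult_carr (\<lambda>x. carr (M x))).
           eventually (\<lambda>x. compose (Field (rarity L R)) (e x) z \<in> rint (M x) R) U}
         else {}) \<rparr>"

definition family :: "('u \<Rightarrow> ('f, 'r, 'u) struct) \<Rightarrow> bool" where
  "family M \<longleftrightarrow> eventually (\<lambda>x. is_struct L (M x) \<and> carr (M x) \<subseteq> V) U"

lemma carr_ult: "v \<in> carr (ult M) \<longleftrightarrow> v \<in> W \<and> eventually (\<lambda>x. e x v \<in> carr (M x)) U"
  by (simp add: ult_def ult_carr_def)

lemma carr_ult_W: "carr (ult M) \<subseteq> W"
  using carr_ult by blast

text \<open>Arities may be infinite, so even a single tuple calls for completeness: each coordinate
  is a point of \<open>M x\<close> on its own set of \<open>U\<close>, and these sets have to be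
  intersected.\<close>

lemma ev_args:
  assumes "|D| \<le>o \<rho>" "z \<in> D \<rightarrow>\<^sub>E carr (ult M)"
  shows "eventually (\<lambda>x. compose D (e x) z \<in> D \<rightarrow>\<^sub>E carr (M x)) U"
proof -
  have "eventually (\<lambda>x. \<forall>i\<in>D. e x (z i) \<in> carr (M x)) U"
    by (rule ev_ball[OF assms(1)]) (use assms(2) carr_ult in blast)
  then show ?thesis
    by (rule eventually_mono) (auto simp: compose_def)
qed

lemma fint_ult:
  assumes M: "family M" and F: "F \<in> Funs L" and z: "z \<in> fargs L F (carr (ult M))"
  shows "fint (ult M) F z \<in> carr (ult M)"
    and "eventually (\<lambda>x. e x (fint (ult M) F z) = fint (M x) F (compose (Field (farity L F)) (e x) z)) U"
proof -
  let ?f = "\<lambda>x. fint (M x) F (compose (Field (farity L F)) (e x) z)"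
  have ev: "eventually (\<lambda>x. ?f x \<in> carr (M x) \<and> ?f x \<in> V) U"
    using ev_args[OF farity_le[OF F] z] M unfolding family_def
  proof eventually_elim
    case (elim x)
    then show ?case using is_struct_fint[of L "M x" F] F by blast
  qed
  then have "\<exists>v\<in>W. eventually (\<lambda>x. e x v = ?f x) U"
    by (intro code_ex) (auto elim: eventually_mono)
  then have "\<exists>v. v \<in> W \<and> eventually (\<lambda>x. e x v = ?f x) U" by blast
  then have *: "fint (ult M) F z \<in> W \<and> eventually (\<lambda>x. e x (fint (ult M) F z) = ?f x) U"
    using F z unfolding ult_def by (simp add: someI_ex[of "\<lambda>v. v \<in> W \<and> eventually (\<lambda>x. e x v = ?f x) U"])
  then show "eventually (\<lambda>x. e x (fint (ult M) F z) = ?f x) U" ..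
  then have "eventually (\<lambda>x. e x (fint (ult M) F z) \<in> carr (M x)) U"
    using ev by eventually_elim simp
  then show "fint (ult M) F z \<in> carr (ult M)" using * carr_ult by blast
qed

lemma rint_ult:
  "R \<in> Rels L \<Longrightarrow> z \<in> rint (ult M) R \<longleftrightarrow> z \<in> rargs L R (carr (ult M)) \<and>
     eventually (\<lambda>x. compose (Field (rarity L R)) (e x) z \<in> rint (M x) R) U"
  by (simp add: ult_def)

lemma is_struct_ult:
  assumes "family M"
  shows "is_struct L (ult M)"
proof -
  have "small (carr (ult M))"
    using W_small card_of_subset_less[OF carr_ult_W] unfolding small_def by blast
  moreover have "fint (ult M) F \<in> fargs L F (carr (ult M)) \<rightarrow>\<^sub>E carr (ult M)" if "F \<in> Funs L" for F
  proof (rule PiE_I)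
    show "fint (ult M) F z = undefined" if "z \<notin> fargs L F (carr (ult M))" for z
      using that by (auto simp: ult_def)
  qed (use fint_ult(1)[OF assms that] in blast)
  ultimately show ?thesis
    unfolding is_struct_def using rint_ult by (auto simp: ult_def)
qed

lemma substruct_ult:
  assumes M: "family M" and N: "family N" and sub: "eventually (\<lambda>x. substruct L (M x) (N x)) U"
  shows "substruct L (ult M) (ult N)"
proof -
  have carr: "carr (ult M) \<subseteq> carr (ult N)"
  proof
    fix v assume "v \<in> carr (ult M)"
    then have v: "v \<in> W" "eventually (\<lambda>x. e x v \<in> carr (M x)) U" using carr_ult by blast+
    from v(2) sub have "eventually (\<lambda>x. e x v \<in> carr (N x)) U"
      by eventually_elim (auto simp: substruct_def)
    then show "v \<in> carr (ult N)" using v(1) carr_ult by blast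
  qed
  moreover have "fint (ult M) F z = fint (ult N) F z"
    if F: "F \<in> Funs L" and z: "z \<in> fargs L F (carr (ult M))" for F z
  proof (rule code_eq)
    have z': "z \<in> fargs L F (carr (ult N))" using z PiE_range_mono[OF carr] by blast
    show "fint (ult M) F z \<in> W" "fint (ult N) F z \<in> W"
      using fint_ult(1)[OF M F z] fint_ult(1)[OF N F z'] carr_ult_W by blast+
    show "eventually (\<lambda>x. e x (fint (ult M) F z) = e x (fint (ult N) F z)) U"
      using fint_ult(2)[OF M F z] fint_ult(2)[OF N F z'] ev_args[OF farity_le[OF F] z] sub
      by eventually_elim (use F in \<open>simp add: substruct_def\<close>)
  qed
  moreover have "rint (ult M) R = rint (ult N) R \<inter> rargs L R (carr (ult M))" if R: "R \<in> Rels L" for R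
  proof -
    have "z \<in> rint (ult M) R \<longleftrightarrow> z \<in> rint (ult N) R" if z: "z \<in> rargs L R (carr (ult M))" for z
    proof -
      let ?z = "\<lambda>x. compose (Field (rarity L R)) (e x) z"
      have "eventually (\<lambda>x. ?z x \<in> rint (M x) R \<longleftrightarrow> ?z x \<in> rint (N x) R) U"
        using ev_args[OF rarity_le[OF R] z] sub
        by eventually_elim (use R in \<open>auto simp: substruct_def\<close>)
      from eventually_subst[OF this] show ?thesis
        using rint_ult[OF R, of z M] rint_ult[OF R, of z N] z PiE_range_mono[OF carr] by blast
    qed
    then show ?thesis using rint_ult[OF R, of _ M] by blast
  qed
  ultimately show ?thesis
    unfolding substruct_def using is_struct_ult[OF M] is_struct_ult[OF N] by blast
qed

definition ult_map :: "('u \<Rightarrow> 'u \<Rightarrow> 'u) \<Rightarrow> 'u \<Rightarrow> 'u" where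
  "ult_map f v = (SOME w. w \<in> W \<and> eventually (\<lambda>x. e x w = f x (e x v)) U)"

lemma ult_map:
  assumes "eventually (\<lambda>x. f x (e x v) \<in> V) U"
  shows "ult_map f v \<in> W" "eventually (\<lambda>x. e x (ult_map f v) = f x (e x v)) U"
  using someI_ex[of "\<lambda>w. w \<in> W \<and> eventually (\<lambda>x. e x w = f x (e x v)) U"] code_ex[OF assms]
  unfolding ult_map_def by blast+

lemma struct_iso_ult:
  assumes M: "family M" and N: "family N" and iso: "eventually (\<lambda>x. struct_iso L (f x) (M x) (N x)) U"
  shows "struct_iso L (ult_map f) (ult M) (ult N)"
proof -
  let ?g = "ult_map f"
  have ev_f: "eventually (\<lambda>x. f x (e x v) \<in> carr (N x)) U" if "v \<in> carr (ult M)" for v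
  proof -
    have "eventually (\<lambda>x. e x v \<in> carr (M x)) U" using that carr_ult by blast
    then show ?thesis using iso
      by eventually_elim (auto simp: struct_iso_def bij_betw_def)
  qed
  have g: "?g v \<in> W" "eventually (\<lambda>x. e x (?g v) = f x (e x v)) U" if "v \<in> carr (ult M)" for v
  proof -
    have "eventually (\<lambda>x. f x (e x v) \<in> V) U"
      using ev_f[OF that] N unfolding family_def by eventually_elim blast
    then show "?g v \<in> W" "eventually (\<lambda>x. e x (?g v) = f x (e x v)) U"
      by (rule ult_map)+
  qed
  have g_carr: "?g v \<in> carr (ult N)" if "v \<in> carr (ult M)" for v
  proof -
    have "eventually (\<lambda>x. e x (?g v) \<in> carr (N x)) U"
      using g(2)[OF that] ev_f[OF that] by eventually_elim simp
    then show ?thesis using g(1)[OF that] carr_ult by blast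
  qed
  have ev_z: "eventually (\<lambda>x. compose D (e x) (compose D ?g z) = compose D (f x) (compose D (e x) z)) U"
    if D: "|D| \<le>o \<rho>" and z: "z \<in> D \<rightarrow>\<^sub>E carr (ult M)" for D z
  proof -
    have "eventually (\<lambda>x. \<forall>i\<in>D. e x (?g (z i)) = f x (e x (z i))) U"
      by (rule ev_ball[OF D]) (use g z in blast)
    then show ?thesis by (rule eventually_mono) (auto simp: compose_def)
  qed
  have "inj_on ?g (carr (ult M))"
  proof (rule inj_onI)
    fix v w assume v: "v \<in> carr (ult M)" and w: "w \<in> carr (ult M)" and "?g v = ?g w"
    have "eventually (\<lambda>x. e x v \<in> carr (M x)) U" "eventually (\<lambda>x. e x w \<in> carr (M x)) U"
      using v w carr_ult by blast+
    then have "eventually (\<lambda>x. e x v = e x w) U"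
      using g(2)[OF v] g(2)[OF w] iso
    proof eventually_elim
      case (elim x)
      then have "f x (e x v) = f x (e x w)" using \<open>?g v = ?g w\<close> by simp
      then show ?case using elim unfolding struct_iso_def bij_betw_def by (blast dest: inj_onD)
    qed
    then show "v = w" using v w carr_ult_W code_eq by blast
  qed
  moreover have "?g ` carr (ult M) = carr (ult N)"
  proof
    show "carr (ult N) \<subseteq> ?g ` carr (ult M)"
    proof
      fix w assume "w \<in> carr (ult N)"
      then have w: "w \<in> W" "eventually (\<lambda>x. e x w \<in> carr (N x)) U" using carr_ult by blast+
      \<comment> \<open>Preimages are chosen in each factor separately; they lie in \<open>V\<close>
        almost everywhere, so the choice has a code.\<close>
      let ?a = "\<lambda>x. inv_into (carr (M x)) (f x) (e x w)"
      have a: "eventually (\<lambda>x. ?a x \<in> carr (M x) \<and> f x (?a x) = e x w) U"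
        using w(2) iso
        by eventually_elim (auto simp: struct_iso_def bij_betw_def intro: inv_into_into f_inv_into_f)
      then have "eventually (\<lambda>x. ?a x \<in> V) U"
        using M unfolding family_def by eventually_elim blast
      from code_ex[OF this] obtain v where v: "v \<in> W" "eventually (\<lambda>x. e x v = ?a x) U" by blast
      have v': "eventually (\<lambda>x. e x v \<in> carr (M x)) U"
        using v(2) a by eventually_elim simp
      then have vM: "v \<in> carr (ult M)" using v(1) carr_ult by blast
      have "eventually (\<lambda>x. e x (?g v) = e x w) U"
        using g(2)[OF vM] v(2) a by eventually_elim simp
      then have "?g v = w" using g(1)[OF vM] w(1) code_eq by blast
      then show "w \<in> ?g ` carr (ult M)" using vM by blast
    qed
  qed (use g_carr in blast)
  moreover have "?g (fint (ult M) F z) = fint (ult N) F (compose (Field (farity L F)) ?g z)"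
    if F: "F \<in> Funs L" and z: "z \<in> fargs L F (carr (ult M))" for F z
  proof (rule code_eq)
    have z': "compose (Field (farity L F)) ?g z \<in> fargs L F (carr (ult N))"
      using z g_carr by (rule compose_PiE)
    note FM = fint_ult[OF M F z] and FN = fint_ult[OF N F z']
    show "?g (fint (ult M) F z) \<in> W" by (rule g(1)[OF FM(1)])
    show "fint (ult N) F (compose (Field (farity L F)) ?g z) \<in> W" using FN(1) carr_ult_W by blast
    show "eventually (\<lambda>x. e x (?g (fint (ult M) F z)) =
        e x (fint (ult N) F (compose (Field (farity L F)) ?g z))) U"
      using g(2)[OF FM(1)] FM(2) FN(2) ev_z[OF farity_le[OF F] z] ev_args[OF farity_le[OF F] z] iso
      by eventually_elim (use F in \<open>simp add: struct_iso_def\<close>)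
  qed
  moreover have "z \<in> rint (ult M) R \<longleftrightarrow> compose (Field (rarity L R)) ?g z \<in> rint (ult N) R"
    if R: "R \<in> Rels L" and z: "z \<in> rargs L R (carr (ult M))" for R z
  proof -
    let ?D = "Field (rarity L R)"
    have z': "compose ?D ?g z \<in> rargs L R (carr (ult N))"
      using z g_carr by (rule compose_PiE)
    have "eventually (\<lambda>x. compose ?D (e x) z \<in> rint (M x) R \<longleftrightarrow>
        compose ?D (e x) (compose ?D ?g z) \<in> rint (N x) R) U"
      using ev_z[OF rarity_le[OF R] z] ev_args[OF rarity_le[OF R] z] iso
      by eventually_elim (use R in \<open>simp add: struct_iso_def\<close>)
    from eventually_subst[OF this] show ?thesis
      using rint_ult[OF R] z z' by simp
  qed
  ultimately show ?thesis
    unfolding struct_iso_def bij_betw_def using is_struct_ult[OF M] is_struct_ult[OF N] by blast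
qed

text \<open>Enumerate almost every carrier along \<rho>. An element of the ultraproduct then becomes
  a function into \<rho>, constant almost everywhere by completeness, and this constant index
  determines the element. Conversely, each of the \<rho> many functions that follow a fixed index
  has a code if it stays in the factors, so evaluation at almost every \<open>x\<close> hits the
  whole factor.\<close>

lemma card_carr_ult:
  assumes le: "eventually (\<lambda>x. |carr (M x)| \<le>o \<rho>) U"
  shows "|carr (ult M)| \<le>o \<rho>"
    and "family M \<Longrightarrow> eventually (\<lambda>x. carr (M x) \<subseteq> e x ` carr (ult M)) U"
proof -
  have \<rho>F: "|Field \<rho>| =o \<rho>" using card_of_Field_ordIso \<rho> by blast
  have F_le: "|Field \<rho>| \<le>o \<rho>" by (rule ordIso_imp_ordLeq[OF \<rho>F])
  have "\<exists>g. |carr (M x)| \<le>o \<rho> \<longrightarrow> carr (M x) \<subseteq> g ` Field \<rho>" for x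
  proof (cases "carr (M x) \<noteq> {} \<and> |carr (M x)| \<le>o \<rho>")
    case True
    then have "|carr (M x)| \<le>o |Field \<rho>|"
      by (intro ordLeq_ordIso_trans[OF _ ordIso_symmetric[OF \<rho>F]]) simp
    then obtain g where "g ` Field \<rho> = carr (M x)"
      using card_of_ordLeq2[of "carr (M x)" "Field \<rho>"] True by auto
    then show ?thesis by auto
  qed auto
  then obtain g where g: "\<And>x. |carr (M x)| \<le>o \<rho> \<Longrightarrow> carr (M x) \<subseteq> g x ` Field \<rho>"
    by metis
  have g_ev: "eventually (\<lambda>x. carr (M x) \<subseteq> g x ` Field \<rho>) U"
    using le by (rule eventually_mono) (rule g)
  have "\<exists>i\<in>Field \<rho>. eventually (\<lambda>x. e x v = g x i) U" if "v \<in> carr (ult M)" for v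
  proof (rule ev_bex[OF F_le])
    have "eventually (\<lambda>x. e x v \<in> carr (M x)) U" using that carr_ult by blast
    then show "eventually (\<lambda>x. \<exists>i\<in>Field \<rho>. e x v = g x i) U"
      using g_ev by eventually_elim blast
  qed
  then have "\<forall>v\<in>carr (ult M). \<exists>i. i \<in> Field \<rho> \<and> eventually (\<lambda>x. e x v = g x i) U" by blast
  from bchoice[OF this] obtain i where i: "\<And>v. v \<in> carr (ult M) \<Longrightarrow> i v \<in> Field \<rho>"
      "\<And>v. v \<in> carr (ult M) \<Longrightarrow> eventually (\<lambda>x. e x v = g x (i v)) U"
    by blast
  have "inj_on i (carr (ult M))"
  proof (rule inj_onI)
    fix v w assume v: "v \<in> carr (ult M)" and w: "w \<in> carr (ult M)" and eq: "i v = i w"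
    have "eventually (\<lambda>x. e x v = e x w) U"
      using i(2)[OF v] i(2)[OF w] by eventually_elim (simp add: eq)
    then show "v = w" using v w carr_ult_W code_eq by blast
  qed
  then have "|carr (ult M)| \<le>o |Field \<rho>|" using i(1) by (intro card_of_ordLeqI)
  then show "|carr (ult M)| \<le>o \<rho>" using \<rho>F by (rule ordLeq_ordIso_trans)
  assume M: "family M"
  \<comment> \<open>The premise covers indices whose value lies outside the carrier, for instance
    when \<open>carr (M x)\<close> is empty.\<close>
  have "eventually (\<lambda>x. g x i \<in> carr (M x) \<longrightarrow> g x i \<in> e x ` carr (ult M)) U" for i
  proof (cases "eventually (\<lambda>x. g x i \<in> carr (M x)) U")
    case True
    then have "eventually (\<lambda>x. g x i \<in> V) U"
      using M unfolding family_def by eventually_elim blast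
    from code_ex[OF this] obtain v where v: "v \<in> W" "eventually (\<lambda>x. e x v = g x i) U" by blast
    have "eventually (\<lambda>x. e x v \<in> carr (M x)) U"
      using v(2) True by eventually_elim simp
    then have "v \<in> carr (ult M)" using v(1) carr_ult by blast
    then have "g x i \<in> e x ` carr (ult M)" if "e x v = g x i" for x using that by force
    then show ?thesis using v(2) by (auto elim: eventually_mono)
  next
    case False
    then have "eventually (\<lambda>x. g x i \<notin> carr (M x)) U" using ultrafilter_not[OF uf] by blast
    then show ?thesis by (rule eventually_mono) simp
  qed
  then have "eventually (\<lambda>x. \<forall>i\<in>Field \<rho>. g x i \<in> carr (M x) \<longrightarrow> g x i \<in> e x ` carr (ult M)) U"
    by (intro ev_ball[OF F_le])
  then show "eventually (\<lambda>x. carr (M x) \<subseteq> e x ` carr (ult M)) U"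
    using g_ev by eventually_elim blast
qed

text \<open>
  The completeness of \<open>U\<close> decides all atomic formulas in at most \<open>\<rho>\<close> elements simultaneously.
\<close>
lemma struct_iso_eval:
  assumes M: "family M" and le: "eventually (\<lambda>x. |carr (M x)| \<le>o \<rho>) U"
  shows "eventually (\<lambda>x. struct_iso L (e x) (ult M) (M x)) U"
proof -
  let ?T = "carr (ult M)"
  have T: "|?T| \<le>o \<rho>" by (rule card_carr_ult(1)[OF le])
  have inf: "infinite (Field \<rho>)" "Card_order \<rho>" using \<rho> unfolding cinfinite_def by blast+
  have onto: "eventually (\<lambda>x. \<forall>v\<in>?T. e x v \<in> carr (M x)) U"
    by (rule ev_ball[OF T]) (use carr_ult in blast)
  have inj1: "eventually (\<lambda>x. \<forall>w\<in>?T. v \<noteq> w \<longrightarrow> e x v \<noteq> e x w) U" if v: "v \<in> ?T" for v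
  proof (rule ev_ball[OF T])
    fix w assume w: "w \<in> ?T"
    show "eventually (\<lambda>x. v \<noteq> w \<longrightarrow> e x v \<noteq> e x w) U"
    proof (cases "v = w")
      case False
      then have "\<not> eventually (\<lambda>x. e x v = e x w) U"
        using v w carr_ult_W code_eq by blast
      then show ?thesis using ultrafilter_not[OF uf] by (auto elim: eventually_mono)
    qed simp
  qed
  have inj: "eventually (\<lambda>x. \<forall>v\<in>?T. \<forall>w\<in>?T. v \<noteq> w \<longrightarrow> e x v \<noteq> e x w) U"
    by (rule ev_ball[OF T inj1])
  have bij: "eventually (\<lambda>x. bij_betw (e x) ?T (carr (M x))) U"
    using onto inj card_carr_ult(2)[OF le M]
  proof eventually_elim
    case (elim x)
    then show ?case unfolding bij_betw_def inj_on_def by blast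
  qed
  have "eventually (\<lambda>x. \<forall>z\<in>fargs L F ?T.
      e x (fint (ult M) F z) = fint (M x) F (compose (Field (farity L F)) (e x) z)) U"
    if F: "F \<in> Funs L" for F
  proof (rule ev_ball)
    show "|fargs L F ?T| \<le>o \<rho>" by (rule tuples_le[OF conjunct1[OF farity_less[OF F]] conjunct2[OF farity_less[OF F]] T])
  qed (rule fint_ult(2)[OF M F])
  then have funs: "eventually (\<lambda>x. \<forall>F\<in>Funs L. \<forall>z\<in>fargs L F ?T.
      e x (fint (ult M) F z) = fint (M x) F (compose (Field (farity L F)) (e x) z)) U"
    by (intro ev_ball[OF Lang_le(1)])
  have "eventually (\<lambda>x. \<forall>z\<in>rargs L R ?T.
      z \<in> rint (ult M) R \<longleftrightarrow> compose (Field (rarity L R)) (e x) z \<in> rint (M x) R) U"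
    if R: "R \<in> Rels L" for R
  proof (rule ev_ball)
    show "|rargs L R ?T| \<le>o \<rho>" by (rule tuples_le[OF conjunct1[OF rarity_less[OF R]] conjunct2[OF rarity_less[OF R]] T])
    fix z assume z: "z \<in> rargs L R ?T"
    let ?P = "\<lambda>x. compose (Field (rarity L R)) (e x) z \<in> rint (M x) R"
    have "z \<in> rint (ult M) R \<longleftrightarrow> eventually ?P U" using rint_ult[OF R] z by blast
    then show "eventually (\<lambda>x. z \<in> rint (ult M) R \<longleftrightarrow> ?P x) U"
      using ultrafilter_not[OF uf, of ?P] by (cases "eventually ?P U") simp_all
  qed
  then have rels: "eventually (\<lambda>x. \<forall>R\<in>Rels L. \<forall>z\<in>rargs L R ?T.
      z \<in> rint (ult M) R \<longleftrightarrow> compose (Field (rarity L R)) (e x) z \<in> rint (M x) R) U"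
    by (intro ev_ball[OF Lang_le(2)])
  show ?thesis
    using bij funs rels M[unfolded family_def]
    by eventually_elim (use is_struct_ult[OF M] in \<open>simp add: struct_iso_def\<close>)
qed

lemma substruct_ult_const:
  assumes M: "is_struct L M" and V: "carr M \<subseteq> V"
  shows "substruct L M (ult (\<lambda>_. M))"
proof -
  have fam: "family (\<lambda>_. M)" using assms unfolding family_def by simp
  have carr: "carr M \<subseteq> carr (ult (\<lambda>_. M))"
  proof
    fix v assume v: "v \<in> carr M"
    have "eventually (\<lambda>x. e x v \<in> carr M) U"
      using code_const[OF subsetD[OF V v]] by (rule eventually_mono) (simp add: v)
    then show "v \<in> carr (ult (\<lambda>_. M))" using v V V_W carr_ult by blast
  qed
  have ev: "eventually (\<lambda>x. compose D (e x) z = z) U" if D: "|D| \<le>o \<rho>" and z: "z \<in> D \<rightarrow>\<^sub>E carr M" for D z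
  proof -
    have "eventually (\<lambda>x. \<forall>i\<in>D. e x (z i) = z i) U"
      by (rule ev_ball[OF D]) (use code_const z V in blast)
    then show ?thesis using compose_eq_self[OF z] by (auto elim: eventually_mono)
  qed
  have "fint M F z = fint (ult (\<lambda>_. M)) F z" if F: "F \<in> Funs L" and z: "z \<in> fargs L F (carr M)" for F z
  proof (rule code_eq)
    have z': "z \<in> fargs L F (carr (ult (\<lambda>_. M)))" using z PiE_range_mono[OF carr] by blast
    have FV: "fint M F z \<in> V" using is_struct_fint[OF M F z] V by blast
    show "fint M F z \<in> W" "fint (ult (\<lambda>_. M)) F z \<in> W"
      using FV V_W fint_ult(1)[OF fam F z'] carr_ult_W by blast+
    show "eventually (\<lambda>x. e x (fint M F z) = e x (fint (ult (\<lambda>_. M)) F z)) U"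
      using code_const[OF FV] fint_ult(2)[OF fam F z'] ev[OF farity_le[OF F] z]
      by eventually_elim simp
  qed
  moreover have "rint M R = rint (ult (\<lambda>_. M)) R \<inter> rargs L R (carr M)" if R: "R \<in> Rels L" for R
  proof -
    have "z \<in> rint M R \<longleftrightarrow> z \<in> rint (ult (\<lambda>_. M)) R" if z: "z \<in> rargs L R (carr M)" for z
    proof -
      have "eventually (\<lambda>x. compose (Field (rarity L R)) (e x) z \<in> rint M R \<longleftrightarrow> z \<in> rint M R) U"
        using ev[OF rarity_le[OF R] z] by eventually_elim simp
      from eventually_subst[OF this]
      have "z \<in> rint (ult (\<lambda>_. M)) R \<longleftrightarrow> eventually (\<lambda>x. z \<in> rint M R) U"
        using rint_ult[OF R, of z "\<lambda>_. M"] subsetD[OF PiE_range_mono[OF carr] z] by simp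
      then show ?thesis using ultrafilter_ex[OF uf, of "\<lambda>x. z \<in> rint M R"] by auto
    qed
    then show ?thesis using is_struct_rint[OF M R] by blast
  qed
  ultimately show ?thesis
    unfolding substruct_def using M is_struct_ult[OF fam] carr by blast
qed

text \<open>A function into a set of size at most \<rho> is constant almost everywhere, and the code
  of a constant is that constant.\<close>

lemma ult_const_eq:
  assumes M: "is_struct L M" and V: "carr M \<subseteq> V" and le: "|carr M| \<le>o \<rho>"
  shows "ult (\<lambda>_. M) = M"
proof (rule substruct_eqI[OF substruct_ult_const[OF M V], symmetric])
  have "v \<in> carr M" if "v \<in> carr (ult (\<lambda>_. M))" for v
  proof -
    have v: "v \<in> W" "eventually (\<lambda>x. e x v \<in> carr M) U" using that carr_ult[of v "\<lambda>_. M"] by simp_all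
    from v(2) have "eventually (\<lambda>x. \<exists>a\<in>carr M. e x v = a) U" by simp
    from ev_bex[OF le this] obtain a where a: "a \<in> carr M" "eventually (\<lambda>x. e x v = a) U" by blast
    have "eventually (\<lambda>x. e x v = e x a) U"
      using a(2) code_const[OF subsetD[OF V a(1)]] by eventually_elim simp
    then have "v = a" using v(1) a(1) V V_W code_eq by blast
    then show ?thesis using a(1) by simp
  qed
  then show "carr M = carr (ult (\<lambda>_. M))"
    using substruct_ult_const[OF M V] unfolding substruct_def by blast
qed

end

section \<open>Ultraproducts in a \<open>\<mu>\<close>-AEC\<close>

lemma substruct_carr: "substruct L M N \<Longrightarrow> carr M \<subseteq> carr N"
  by (simp add: substruct_def)

lemma abstract_classD:
  assumes "abstract_class \<mu> K"
  shows "Cinfinite \<mu>" "ary_language \<mu> (Lang K)"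
    "\<forall>M \<in> Mods K. is_struct (Lang K) M"
    "\<forall>M N. Le K M N \<longrightarrow> M \<in> Mods K \<and> N \<in> Mods K"
    "\<forall>M \<in> Mods K. Le K M M"
    "\<forall>M N P. Le K M N \<and> Le K N P \<longrightarrow> Le K M P"
    "\<forall>M N. Le K M N \<longrightarrow> substruct (Lang K) M N"
    "\<forall>M N M' N' f. Le K M N \<and> struct_iso (Lang K) f N N' \<and> struct_iso (Lang K) f M M' \<and>
      substruct (Lang K) M' N' \<longrightarrow> Le K M' N'"
  using assms unfolding abstract_class_def cardinal_def
  by - (elim conjE, (assumption | (intro conjI; assumption)))+

lemma mu_AEC_abstract_class: "mu_AEC \<mu> K \<Longrightarrow> abstract_class \<mu> K"
  unfolding mu_AEC_def by (elim conjE)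

lemmas mu_AEC_Cinfinite = abstract_classD(1)[OF mu_AEC_abstract_class]
  and mu_AEC_ary = abstract_classD(2)[OF mu_AEC_abstract_class]
  and mu_AEC_struct = bspec[OF abstract_classD(3)[OF mu_AEC_abstract_class]]
  and mu_AEC_refl = bspec[OF abstract_classD(5)[OF mu_AEC_abstract_class]]

lemma mu_AEC_Mods: "mu_AEC \<mu> K \<Longrightarrow> Le K M N \<Longrightarrow> M \<in> Mods K \<and> N \<in> Mods K"
  using abstract_classD(4)[OF mu_AEC_abstract_class] by blast

lemma mu_AEC_trans: "mu_AEC \<mu> K \<Longrightarrow> Le K M N \<Longrightarrow> Le K N P \<Longrightarrow> Le K M P"
  using abstract_classD(6)[OF mu_AEC_abstract_class] by blast

lemma mu_AEC_substruct: "mu_AEC \<mu> K \<Longrightarrow> Le K M N \<Longrightarrow> substruct (Lang K) M N"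
  using abstract_classD(7)[OF mu_AEC_abstract_class] by blast

lemma mu_AEC_iso_Le:
  assumes "mu_AEC \<mu> K" "Le K M N" "struct_iso (Lang K) f N N'" "struct_iso (Lang K) f M M'"
    "substruct (Lang K) M' N'"
  shows "Le K M' N'"
  using abstract_classD(8)[OF mu_AEC_abstract_class[OF assms(1)]] assms(2-) by blast

lemma mu_AEC_coherence:
  assumes "mu_AEC \<mu> K" "Le K M N" "Le K M' N" "carr M \<subseteq> carr M'"
  shows "Le K M M'"
proof -
  have "substruct (Lang K) M M'"
    using mu_AEC_substruct[OF assms(1,2)] mu_AEC_substruct[OF assms(1,3)] assms(4)
    by (rule substruct_of_carr_subset)
  moreover have "coherence K" using assms(1) unfolding mu_AEC_def by blast
  ultimately show ?thesis
    using mu_AEC_Mods[OF assms(1,2)] mu_AEC_Mods[OF assms(1,3)] assms(2,3)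
    unfolding coherence_def by blast
qed

section \<open>Counting short tuples, and submodels of size at most \<rho>\<close>

lemma cpow_less_mono:
  fixes A :: "'a set" and B :: "'b set"
  assumes "|A| \<le>o |B|"
  shows "cpow_less A \<mu> \<le>o cpow_less B \<mu>"
proof -
  obtain j where j: "inj_on j A" "j ` A \<subseteq> B"
    using assms unfolding card_of_ordLeq[symmetric] by (elim exE conjE)
  let ?h = "\<lambda>(i, f). (i, compose (underS \<mu> i) j f)"
  have "inj_on ?h (SIGMA i : Field \<mu>. underS \<mu> i \<rightarrow>\<^sub>E A)"
  proof (rule inj_onI)
    fix p q assume p: "p \<in> (SIGMA i : Field \<mu>. underS \<mu> i \<rightarrow>\<^sub>E A)"
      and q: "q \<in> (SIGMA i : Field \<mu>. underS \<mu> i \<rightarrow>\<^sub>E A)" and pq: "?h p = ?h q"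
    obtain i f g where ifg: "p = (i, f)" "q = (i, g)" using pq by (cases p, cases q) auto
    have f: "f \<in> underS \<mu> i \<rightarrow>\<^sub>E A" and g: "g \<in> underS \<mu> i \<rightarrow>\<^sub>E A"
      and eq: "compose (underS \<mu> i) j f = compose (underS \<mu> i) j g"
      using p q pq unfolding ifg by simp_all
    have "f = g"
    proof (rule PiE_ext[OF f g])
      fix k assume k: "k \<in> underS \<mu> i"
      have "j (f k) = j (g k)" using fun_cong[OF eq, of k] k by (simp add: compose_def)
      then show "f k = g k"
        by (rule inj_onD[OF j(1) _ PiE_mem[OF f k] PiE_mem[OF g k]])
    qed
    then show "p = q" unfolding ifg by simp
  qed
  moreover have "?h p \<in> (SIGMA i : Field \<mu>. underS \<mu> i \<rightarrow>\<^sub>E B)"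
    if "p \<in> (SIGMA i : Field \<mu>. underS \<mu> i \<rightarrow>\<^sub>E A)" for p
  proof -
    have "compose (underS \<mu> i) j f \<in> underS \<mu> i \<rightarrow>\<^sub>E B" if "f \<in> underS \<mu> i \<rightarrow>\<^sub>E A" for i f
      using j(2) by (intro compose_PiE[OF that]) blast
    then show ?thesis using that by auto
  qed
  ultimately show ?thesis
    unfolding cpow_less_def by (rule card_of_ordLeqI)
qed

text \<open>A well-order shorter than \<mu> is isomorphic to the segment of \<mu> below some
  \<open>i\<close>, so tuples along it inject into one fibre of the sum in
  \<open>cpow_less\<close>.\<close>

lemma card_of_tuples_le_cpow_less:
  assumes \<mu>: "Well_order \<mu>" and \<alpha>: "Well_order \<alpha>" "\<alpha> <o \<mu>"
  shows "|Field \<alpha> \<rightarrow>\<^sub>E T| \<le>o cpow_less T \<mu>"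
proof -
  obtain i where i: "i \<in> Field \<mu>" "\<alpha> =o Restr \<mu> (underS \<mu> i)"
    using iffD1[OF ordLess_iff_ordIso_Restr[OF \<mu> \<alpha>(1)] \<alpha>(2)] by blast
  have "Field (Restr \<mu> (underS \<mu> i)) = underS \<mu> i"
    using \<mu> by (intro Refl_Field_Restr2) (auto simp: order_on_defs underS_def Field_def)
  then obtain b where b: "bij_betw b (Field \<alpha>) (underS \<mu> i)"
    using i(2) unfolding ordIso_def iso_def by auto
  let ?b = "inv_into (Field \<alpha>) b"
  have b': "bij_betw ?b (underS \<mu> i) (Field \<alpha>)" by (rule bij_betw_inv_into[OF b])
  let ?h = "\<lambda>z. (i, compose (underS \<mu> i) z ?b)"
  have "inj_on ?h (Field \<alpha> \<rightarrow>\<^sub>E T)"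
  proof (rule inj_onI)
    fix y z assume y: "y \<in> Field \<alpha> \<rightarrow>\<^sub>E T" and z: "z \<in> Field \<alpha> \<rightarrow>\<^sub>E T" and eq: "?h y = ?h z"
    show "y = z"
    proof (rule PiE_ext[OF y z])
      fix k assume k: "k \<in> Field \<alpha>"
      have "b k \<in> underS \<mu> i" "?b (b k) = k"
        using b k by (auto simp: bij_betw_def)
      moreover have "compose (underS \<mu> i) y ?b (b k) = compose (underS \<mu> i) z ?b (b k)"
        using eq by simp
      ultimately show "y k = z k" by (simp add: compose_def)
    qed
  qed
  moreover have "?h z \<in> (SIGMA i : Field \<mu>. underS \<mu> i \<rightarrow>\<^sub>E T)" if "z \<in> Field \<alpha> \<rightarrow>\<^sub>E T" for z
  proof -
    have "compose (underS \<mu> i) z ?b \<in> underS \<mu> i \<rightarrow>\<^sub>E T"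
      using that b' by (auto simp: compose_def bij_betw_def)
    then show ?thesis using i(1) by blast
  qed
  ultimately show ?thesis
    unfolding cpow_less_def by (rule card_of_ordLeqI)
qed

lemma LST_cpow_less:
  assumes "LST_cardinal \<mu> K \<rho>" "|A| \<le>o \<rho>"
  shows "cpow_less A \<mu> \<le>o \<rho>"
proof -
  have \<rho>: "Card_order \<rho>" "\<rho> =o cpow_less (Field \<rho>) \<mu>"
    using assms(1) unfolding LST_cardinal_def cardinal_def by blast+
  have "|A| \<le>o |Field \<rho>|"
    by (rule ordLeq_ordIso_trans[OF assms(2) ordIso_symmetric[OF card_of_Field_ordIso[OF \<rho>(1)]]])
  from cpow_less_mono[OF this] show ?thesis
    by (rule ordLeq_ordIso_trans[OF _ ordIso_symmetric[OF \<rho>(2)]])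
qed

lemma LST_mu_le:
  assumes "mu_AEC \<mu> K" "LST_cardinal \<mu> K \<rho>"
  shows "\<mu> \<le>o \<rho>" "Cinfinite \<rho>" "|Funs (Lang K)| \<le>o \<rho>" "|Rels (Lang K)| \<le>o \<rho>"
proof -
  have le: "|Funs (Lang K) <+> Rels (Lang K)| +c \<mu> \<le>o \<rho>" and \<rho>: "Card_order \<rho>"
    using assms(2) unfolding LST_cardinal_def cardinal_def by blast+
  note \<mu> = mu_AEC_Cinfinite[OF assms(1)]
  show 1: "\<mu> \<le>o \<rho>"
    by (rule ordLeq_transitive[OF ordLeq_csum2 le]) (use \<mu> in blast)
  show "Cinfinite \<rho>" using cinfinite_mono[OF 1] \<mu> \<rho> by blast
  have 2: "|Funs (Lang K) <+> Rels (Lang K)| \<le>o \<rho>"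
    by (rule ordLeq_transitive[OF ordLeq_csum1 le]) (rule card_of_Card_order)
  show "|Funs (Lang K)| \<le>o \<rho>" by (rule ordLeq_transitive[OF card_of_Plus1 2])
  show "|Rels (Lang K)| \<le>o \<rho>" by (rule ordLeq_transitive[OF card_of_Plus2 2])
qed

text \<open>For \<open>A\<close> of size at most \<rho> the bound in the axiom collapses to \<rho>,
  because \<rho>^{<\<mu>} = \<rho>.\<close>

lemma LST_submodel:
  assumes "mu_AEC \<mu> K" "LST_cardinal \<mu> K \<rho>" "M \<in> Mods K" "A \<subseteq> carr M" "|A| \<le>o \<rho>"
  shows "\<exists>N. Le K N M \<and> A \<subseteq> carr N \<and> |carr N| \<le>o \<rho>"
proof -
  have "\<forall>M \<in> Mods K. \<forall>A. A \<subseteq> carr M \<longrightarrow>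
      (\<exists>N. Le K N M \<and> A \<subseteq> carr N \<and> |carr N| \<le>o cpow_less A \<mu> +c \<rho>)"
    using assms(2) unfolding LST_cardinal_def by (elim conjE)
  then obtain N where N: "Le K N M" "A \<subseteq> carr N" "|carr N| \<le>o cpow_less A \<mu> +c \<rho>"
    using assms(3,4) by blast
  have "cpow_less A \<mu> +c \<rho> =o \<rho>"
    by (rule csum_absorb2[OF LST_mu_le(2)[OF assms(1,2)] LST_cpow_less[OF assms(2,5)]])
  then show ?thesis using N(1,2) ordLeq_ordIso_trans[OF N(3)] by blast
qed

text \<open>The Tarski-Vaught axioms for a set of models found inside a known structure
  \<open>Q\<close>. The set is indexed by codes in \<open>'u\<close> and ordered by
  \<open>Le\<close>, which is antisymmetric since mutual submodels have the same carrier. A tuple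
  has fewer than \<mu> coordinates, each in some member, and directedness puts it into one member;
  hence the union of the system is \<open>Q\<close>.\<close>

lemma directed_cover:
  fixes K :: "('f, 'r, 'u) aclass" and \<T> :: "('f, 'r, 'u) struct set"
  assumes AEC: "mu_AEC \<mu> K" and small: "|\<T>| <o |UNIV :: 'u set|"
    and Q: "is_struct (Lang K) Q" and sub: "\<And>A. A \<in> \<T> \<Longrightarrow> substruct (Lang K) A Q"
    and Mods: "\<T> \<subseteq> Mods K"
    and dir: "\<And>Z. Z \<subseteq> \<T> \<Longrightarrow> |Z| <o \<mu> \<Longrightarrow> \<exists>B\<in>\<T>. \<forall>A\<in>Z. Le K A B"
    and cover: "carr Q \<subseteq> (\<Union>A\<in>\<T>. carr A)"
  shows "Q \<in> Mods K" and "\<And>A. A \<in> \<T> \<Longrightarrow> Le K A Q"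
    and "\<And>N. N \<in> Mods K \<Longrightarrow> (\<And>A. A \<in> \<T> \<Longrightarrow> Le K A N) \<Longrightarrow> Le K Q N"
proof -
  note \<mu> = mu_AEC_Cinfinite[OF AEC]
  obtain c :: "('f, 'r, 'u) struct \<Rightarrow> 'u" where c: "inj_on c \<T>" "Defs.small (c ` \<T>)"
    using ex_inj_less[OF small] .
  define I where "I = c ` \<T>"
  define M where "M = inv_into \<T> c"
  define r where "r = {(i, j). i \<in> I \<and> j \<in> I \<and> Le K (M i) (M j)}"
  have M: "M (c A) = A" if "A \<in> \<T>" for A using c(1) that unfolding M_def by simp
  have MI: "M i \<in> \<T> \<and> c (M i) = i" if "i \<in> I" for i using that M unfolding I_def by auto
  have "directed \<mu> I r"
    unfolding directed_def
  proof (intro conjI allI impI)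
    have "refl_on I r"
      unfolding refl_on_def r_def using MI Mods mu_AEC_refl[OF AEC] by blast
    moreover have "trans r"
      unfolding trans_def r_def using mu_AEC_trans[OF AEC] by blast
    moreover have "antisym r"
    proof (rule antisymI)
      fix i j assume "(i, j) \<in> r" "(j, i) \<in> r"
      then have ij: "i \<in> I" "j \<in> I" "Le K (M i) (M j)" "Le K (M j) (M i)"
        unfolding r_def by blast+
      have "carr (M i) = carr (M j)"
        using substruct_carr[OF mu_AEC_substruct[OF AEC ij(3)]]
          substruct_carr[OF mu_AEC_substruct[OF AEC ij(4)]] by blast
      then have "M i = M j" by (rule substruct_eqI[OF mu_AEC_substruct[OF AEC ij(3)]])
      then show "i = j" using MI[OF ij(1)] MI[OF ij(2)] by metis
    qed
    moreover have "r \<subseteq> I \<times> I" unfolding r_def by blast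
    ultimately show "partial_order_on I r"
      unfolding order_on_defs by blast
  next
    fix Y assume Y: "Y \<subseteq> I \<and> |Y| <o \<mu>"
    have "M ` Y \<subseteq> \<T>" using Y MI by blast
    moreover have "|M ` Y| <o \<mu>" using Y card_of_image_less by blast
    ultimately obtain B where B: "B \<in> \<T>" "\<forall>A\<in>M ` Y. Le K A B" using dir by blast
    have "(y, c B) \<in> r" if "y \<in> Y" for y
      using that B Y M[OF B(1)] unfolding r_def I_def by auto
    then show "\<exists>b\<in>I. \<forall>x\<in>Y. (x, b) \<in> r" using B(1) unfolding I_def by blast
  qed
  moreover have "\<forall>i\<in>I. M i \<in> Mods K" using MI Mods by blast
  moreover have "\<forall>i\<in>I. \<forall>j\<in>I. (i, j) \<in> r \<longrightarrow> Le K (M i) (M j)" unfolding r_def by blast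
  moreover have "Defs.small I" using c(2) unfolding I_def .
  moreover have "tarski_vaught \<mu> K" using AEC unfolding mu_AEC_def by blast
  ultimately have TV: "union_struct (Lang K) I M \<in> Mods K \<and>
      (\<forall>j\<in>I. Le K (M j) (union_struct (Lang K) I M)) \<and>
      (\<forall>N \<in> Mods K. (\<forall>i\<in>I. Le K (M i) N) \<longrightarrow> Le K (union_struct (Lang K) I M) N)"
    unfolding tarski_vaught_def by blast
  have MT: "M ` I = \<T>" using M MI unfolding I_def by force
  have args: "\<exists>i\<in>I. z \<in> Field \<alpha> \<rightarrow>\<^sub>E carr (M i)" if \<alpha>: "\<alpha> <o \<mu>" and z: "z \<in> Field \<alpha> \<rightarrow>\<^sub>E carr Q"
    for \<alpha> :: "'u rel" and z
  proof -
    have "\<forall>k\<in>Field \<alpha>. \<exists>A. A \<in> \<T> \<and> z k \<in> carr A" using z cover by blast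
    from bchoice[OF this] obtain A where A: "\<And>k. k \<in> Field \<alpha> \<Longrightarrow> A k \<in> \<T> \<and> z k \<in> carr (A k)"
      by blast
    have "|A ` Field \<alpha>| <o \<mu>" by (rule card_of_image_less[OF ordLess_Field[OF \<alpha>]])
    moreover have "A ` Field \<alpha> \<subseteq> \<T>" using A by blast
    ultimately obtain B where B: "B \<in> \<T>" "\<forall>C\<in>A ` Field \<alpha>. Le K C B" using dir by blast
    have "z k \<in> carr B" if k: "k \<in> Field \<alpha>" for k
    proof -
      have "Le K (A k) B" using B(2) k by blast
      then show ?thesis using A[OF k] substruct_carr[OF mu_AEC_substruct[OF AEC]] by blast
    qed
    then have "z \<in> Field \<alpha> \<rightarrow>\<^sub>E carr B" using z by auto
    then show ?thesis using B(1) M unfolding I_def by force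
  qed
  have ary: "F \<in> Funs (Lang K) \<Longrightarrow> farity (Lang K) F <o \<mu>"
    "R \<in> Rels (Lang K) \<Longrightarrow> rarity (Lang K) R <o \<mu>" for F R
    using mu_AEC_ary[OF AEC] unfolding ary_language_def by blast+
  have carr_eq: "carr Q = (\<Union>i\<in>I. carr (M i))"
    using cover substruct_carr[OF sub] MT by blast
  have subI: "substruct (Lang K) (M i) Q" if "i \<in> I" for i using MI[OF that] sub by simp
  have "union_struct (Lang K) I M = Q"
    by (rule union_struct_eq[OF Q subI carr_eq args[OF ary(1)] args[OF ary(2)]])
  then have TVQ: "Q \<in> Mods K" "\<forall>j\<in>I. Le K (M j) Q"
    "\<forall>N \<in> Mods K. (\<forall>i\<in>I. Le K (M i) N) \<longrightarrow> Le K Q N"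
    using TV by simp_all
  show "Q \<in> Mods K" by (rule TVQ(1))
  show "Le K A Q" if "A \<in> \<T>" for A using TVQ(2) that MT by blast
  show "Le K Q N" if "N \<in> Mods K" "\<And>A. A \<in> \<T> \<Longrightarrow> Le K A N" for N
    using TVQ(3) that MT by blast
qed

section \<open>Closure of the class and its order under ultraproducts\<close>

locale mu_AEC_ultrapower = ultrapower_coding \<mu> \<rho> \<nu> "Lang K" U V W e
  for \<mu> \<rho> \<nu> :: "'u rel" and K :: "('f, 'r, 'u) aclass" and U V W e +
  assumes inac: "inaccessible |UNIV :: 'u set|" and AEC: "mu_AEC \<mu> K" and LST: "LST_cardinal \<mu> K \<rho>"
begin

definition model_family :: "('u \<Rightarrow> ('f, 'r, 'u) struct) \<Rightarrow> bool" where
  "model_family M \<longleftrightarrow> eventually (\<lambda>x. M x \<in> Mods K \<and> carr (M x) \<subseteq> V) U"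

lemma model_family: "model_family M \<Longrightarrow> family M"
  unfolding model_family_def family_def by (rule eventually_mono) (use mu_AEC_struct[OF AEC] in blast)+

lemma model_family_Le:
  assumes "model_family P" "eventually (\<lambda>x. Le K (M x) (P x)) U"
  shows "model_family M"
  using assms unfolding model_family_def
proof eventually_elim
  case (elim x)
  then show ?case
    using mu_AEC_Mods[OF AEC elim(2)] substruct_carr[OF mu_AEC_substruct[OF AEC elim(2)]] by blast
qed

text \<open>At almost every \<open>x\<close> the same evaluation \<open>e x\<close> maps both
  ultraproducts isomorphically onto their factors at \<open>x\<close>. Pulling \<open>Le\<close>
  back along its inverse at one such \<open>x\<close> is enough.\<close>

lemma Le_ult_of_small:
  assumes N': "model_family N'" and le: "eventually (\<lambda>x. |carr (N x)| \<le>o \<rho>) U"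
    and le': "eventually (\<lambda>x. |carr (N' x)| \<le>o \<rho>) U"
    and Le: "eventually (\<lambda>x. Le K (N x) (N' x)) U"
  shows "Le K (ult N) (ult N')"
proof -
  have fam: "family N" "family N'"
    using model_family N' model_family_Le[OF N' Le] by blast+
  have "eventually (\<lambda>x. substruct (Lang K) (N x) (N' x)) U"
    using Le by (rule eventually_mono) (rule mu_AEC_substruct[OF AEC])
  then have sub: "substruct (Lang K) (ult N) (ult N')" by (rule substruct_ult[OF fam])
  have "eventually (\<lambda>x. struct_iso (Lang K) (e x) (ult N) (N x) \<and>
      struct_iso (Lang K) (e x) (ult N') (N' x) \<and> Le K (N x) (N' x)) U"
    using struct_iso_eval[OF fam(1) le] struct_iso_eval[OF fam(2) le'] Le by eventually_elim blast
  then obtain x where x: "struct_iso (Lang K) (e x) (ult N) (N x)"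
      "struct_iso (Lang K) (e x) (ult N') (N' x)" "Le K (N x) (N' x)"
    using ultrafilter_ex[OF uf] by blast
  \<comment> \<open>The inverse is taken on the larger carrier, so that it serves both
    isomorphisms.\<close>
  let ?g = "inv_into (carr (ult N')) (e x)"
  have inj: "inj_on (e x) (carr (ult N'))"
    using x(2) unfolding struct_iso_def bij_betw_def by blast
  have g: "?g (e x v) = v" if "v \<in> carr (ult N')" for v
    by (rule inv_into_f_f[OF inj that])
  have g': "?g (e x v) = v" if "v \<in> carr (ult N)" for v
    using g substruct_carr[OF sub] that by blast
  show ?thesis
    by (rule mu_AEC_iso_Le[OF AEC x(3) struct_iso_inverse[OF x(2) g] struct_iso_inverse[OF x(1) g'] sub])
qed

definition small_ults :: "('u \<Rightarrow> ('f, 'r, 'u) struct) \<Rightarrow> ('f, 'r, 'u) struct set" where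
  "small_ults M = {ult N | N. eventually (\<lambda>x. Le K (N x) (M x)) U \<and> eventually (\<lambda>x. |carr (N x)| \<le>o \<rho>) U}"

lemma small_ults_substruct:
  assumes "model_family M" "A \<in> small_ults M"
  shows "substruct (Lang K) A (ult M)"
proof -
  obtain N where N: "A = ult N" "eventually (\<lambda>x. Le K (N x) (M x)) U"
    using assms(2) unfolding small_ults_def by blast
  show ?thesis unfolding N(1)
  proof (rule substruct_ult)
    show "family N" using model_family_Le[OF assms(1) N(2)] model_family by blast
    show "eventually (\<lambda>x. substruct (Lang K) (N x) (M x)) U"
      using N(2) by (rule eventually_mono) (rule mu_AEC_substruct[OF AEC])
  qed (rule model_family[OF assms(1)])
qed

text \<open>A substructure of \<open>Q\<close> is determined by its carrier. This yields the
  smallness of the directed systems to which \<open>directed_cover\<close> is applied.\<close>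

lemma card_of_substructs_less:
  assumes "is_struct L Q" "\<And>A. A \<in> \<T> \<Longrightarrow> substruct L A Q"
  shows "|\<T> :: ('a, 'b, 'u) struct set| <o |UNIV :: 'u set|"
proof -
  have Q: "|Pow (carr Q)| <o |UNIV :: 'u set|"
    using assms(1) unfolding is_struct_def small_def by (intro card_of_Pow_less[OF inac]) blast
  have "inj_on carr \<T>"
  proof (rule inj_onI)
    fix A B assume AB: "A \<in> \<T>" "B \<in> \<T>" "carr A = carr B"
    have "substruct L A B"
      by (rule substruct_of_carr_subset[OF assms(2)[OF AB(1)] assms(2)[OF AB(2)]]) (simp add: AB(3))
    then show "A = B" using AB(3) by (rule substruct_eqI)
  qed
  moreover have "carr A \<in> Pow (carr Q)" if "A \<in> \<T>" for A
    using substruct_carr[OF assms(2)[OF that]] by blast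
  ultimately have "|\<T>| \<le>o |Pow (carr Q)|" by (rule card_of_ordLeqI)
  then show ?thesis using Q by (rule ordLeq_ordLess_trans)
qed

lemma ex_small_family:
  assumes "model_family M" "eventually (\<lambda>x. A x \<subseteq> carr (M x)) U" "eventually (\<lambda>x. |A x| \<le>o \<rho>) U"
  shows "\<exists>N. eventually (\<lambda>x. Le K (N x) (M x) \<and> A x \<subseteq> carr (N x) \<and> |carr (N x)| \<le>o \<rho>) U"
proof -
  let ?N = "\<lambda>x. SOME N. Le K N (M x) \<and> A x \<subseteq> carr N \<and> |carr N| \<le>o \<rho>"
  have "eventually (\<lambda>x. \<exists>N. Le K N (M x) \<and> A x \<subseteq> carr N \<and> |carr N| \<le>o \<rho>) U"
    using assms unfolding model_family_def
    by eventually_elim (use LST_submodel[OF AEC LST] in blast)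
  then have "eventually (\<lambda>x. Le K (?N x) (M x) \<and> A x \<subseteq> carr (?N x) \<and> |carr (?N x)| \<le>o \<rho>) U"
    by (rule eventually_mono) (rule someI_ex)
  then show ?thesis by (rule exI[of _ ?N])
qed

text \<open>Fewer than \<mu> families of submodels of size at most \<rho> are handled at almost
  every \<open>x\<close> simultaneously. There the union of their carriers still has size at most
  \<rho>, so it lies in a small submodel \<open>B x\<close>, and coherence makes each given submodel
  a \<open>Le\<close>-submodel of \<open>B x\<close>.\<close>

lemma small_ults_directed:
  assumes M: "model_family M" and Z: "Z \<subseteq> small_ults M" "|Z| <o \<mu>"
  shows "\<exists>B\<in>small_ults M. \<forall>A\<in>Z. Le K A B"
proof -
  have Z\<rho>: "|Z| \<le>o \<rho>"
    by (rule ordLess_imp_ordLeq[OF ordLess_ordLeq_trans[OF Z(2) \<mu>\<rho>]])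
  have "\<forall>A\<in>Z. \<exists>N. A = ult N \<and> eventually (\<lambda>x. Le K (N x) (M x)) U \<and>
      eventually (\<lambda>x. |carr (N x)| \<le>o \<rho>) U"
    using Z(1) unfolding small_ults_def by blast
  from bchoice[OF this] obtain N where N: "\<forall>A\<in>Z. A = ult (N A) \<and>
      eventually (\<lambda>x. Le K (N A x) (M x)) U \<and> eventually (\<lambda>x. |carr (N A x)| \<le>o \<rho>) U" ..
  have ev: "eventually (\<lambda>x. \<forall>A\<in>Z. Le K (N A x) (M x)) U"
      "eventually (\<lambda>x. \<forall>A\<in>Z. |carr (N A x)| \<le>o \<rho>) U"
    by (rule ev_ball[OF Z\<rho>], use N in blast)+
  let ?A = "\<lambda>x. \<Union>A\<in>Z. carr (N A x)"
  have A1: "eventually (\<lambda>x. ?A x \<subseteq> carr (M x)) U"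
    using ev(1)
  proof (rule eventually_mono)
    fix x assume "\<forall>A\<in>Z. Le K (N A x) (M x)"
    then have "\<And>A. A \<in> Z \<Longrightarrow> carr (N A x) \<subseteq> carr (M x)"
      using substruct_carr[OF mu_AEC_substruct[OF AEC]] by blast
    then show "?A x \<subseteq> carr (M x)" by blast
  qed
  have A2: "eventually (\<lambda>x. |?A x| \<le>o \<rho>) U"
    using ev(2) by (rule eventually_mono) (rule UNION_Cinfinite_bound[OF Z\<rho> _ \<rho>])
  obtain B where B: "eventually (\<lambda>x. Le K (B x) (M x) \<and> ?A x \<subseteq> carr (B x) \<and> |carr (B x)| \<le>o \<rho>) U"
    using ex_small_family[OF M A1 A2] by (rule exE)
  have B1: "eventually (\<lambda>x. Le K (B x) (M x)) U" and B2: "eventually (\<lambda>x. |carr (B x)| \<le>o \<rho>) U"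
    using B by (auto elim: eventually_mono)
  have "Le K A (ult B)" if A: "A \<in> Z" for A
  proof -
    have NA: "A = ult (N A)" "eventually (\<lambda>x. Le K (N A x) (M x)) U"
        "eventually (\<lambda>x. |carr (N A x)| \<le>o \<rho>) U"
      using N A by blast+
    have "eventually (\<lambda>x. Le K (N A x) (B x)) U"
      using B NA(2)
      by eventually_elim (use A in \<open>blast intro: mu_AEC_coherence[OF AEC]\<close>)
    then show ?thesis
      using Le_ult_of_small[OF model_family_Le[OF M B1] NA(3) B2] NA(1) by simp
  qed
  moreover have "ult B \<in> small_ults M" using B1 B2 unfolding small_ults_def by blast
  ultimately show ?thesis by blast
qed

text \<open>Directedness for a singleton puts \<open>A\<close> below some \<open>B\<close>, and
  \<open>Le\<close> relates only members of the class.\<close>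

lemma small_ults_Mods:
  assumes "model_family M"
  shows "small_ults M \<subseteq> Mods K"
proof
  fix A assume A: "A \<in> small_ults M"
  have "|{A}| <o \<mu>" by (rule finite_ordLess_Cinfinite[OF _ mu_AEC_Cinfinite[OF AEC]]) simp
  then obtain B where "Le K A B" using small_ults_directed[OF assms, of "{A}"] A by blast
  then show "A \<in> Mods K" using mu_AEC_Mods[OF AEC] by blast
qed

lemma small_ults_cover:
  assumes "model_family M"
  shows "carr (ult M) \<subseteq> (\<Union>A\<in>small_ults M. carr A)"
proof
  fix v assume "v \<in> carr (ult M)"
  then have v: "v \<in> W" "eventually (\<lambda>x. e x v \<in> carr (M x)) U" using carr_ult by blast+
  have A1: "eventually (\<lambda>x. {e x v} \<subseteq> carr (M x)) U" using v(2) by simp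
  have "|{e x v}| \<le>o \<rho>" for x by (rule finite_ordLeq_Cinfinite[OF _ \<rho>]) simp
  then have A2: "eventually (\<lambda>x. |{e x v}| \<le>o \<rho>) U" by simp
  obtain N where N: "eventually (\<lambda>x. Le K (N x) (M x) \<and> {e x v} \<subseteq> carr (N x) \<and> |carr (N x)| \<le>o \<rho>) U"
    using ex_small_family[OF assms A1 A2] by (rule exE)
  then have "ult N \<in> small_ults M" unfolding small_ults_def by (auto elim: eventually_mono)
  moreover have "v \<in> carr (ult N)" using N v(1) carr_ult by (auto elim: eventually_mono)
  ultimately show "v \<in> (\<Union>A\<in>small_ults M. carr A)" by blast
qed

lemmas ult_directed_cover =
  directed_cover[OF AEC card_of_substructs_less is_struct_ult[OF model_family] small_ults_substruct
    small_ults_Mods small_ults_directed small_ults_cover,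
    OF is_struct_ult[OF model_family] small_ults_substruct]

lemma ult_in_Mods:
  assumes "model_family M"
  shows "ult M \<in> Mods K"
  by (rule ult_directed_cover(1)) (use assms in blast)+

text \<open>The small ultraproducts below \<open>ult M\<close> are among those below
  \<open>ult P\<close>, by transitivity in the factors. So \<open>ult P\<close> bounds the system
  whose union is \<open>ult M\<close>, and part (b) of Tarski-Vaught applies.\<close>

lemma Le_ult:
  assumes P: "model_family P" and Le: "eventually (\<lambda>x. Le K (M x) (P x)) U"
  shows "Le K (ult M) (ult P)"
proof -
  note M = model_family_Le[OF P Le]
  have sub: "small_ults M \<subseteq> small_ults P"
  proof
    fix A assume "A \<in> small_ults M"
    then obtain N where N: "A = ult N" "eventually (\<lambda>x. Le K (N x) (M x)) U"
        "eventually (\<lambda>x. |carr (N x)| \<le>o \<rho>) U"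
      unfolding small_ults_def by blast
    have "eventually (\<lambda>x. Le K (N x) (P x)) U"
      using N(2) Le by eventually_elim (rule mu_AEC_trans[OF AEC])
    then show "A \<in> small_ults P" using N unfolding small_ults_def by blast
  qed
  have P': "Le K A (ult P)" if "A \<in> small_ults P" for A
    by (rule ult_directed_cover(2)) (use P that in blast)+
  show ?thesis
    by (rule ult_directed_cover(3)[where M = M]) (use M P' sub ult_in_Mods[OF P] in blast)+
qed

text \<open>The ultrapower fixes every submodel of size at most \<rho>, so each of them lies below
  it by \<open>Le_ult\<close>. As \<open>M\<close> is the directed union of these submodels, part
  (b) of Tarski-Vaught gives the claim for \<open>M\<close>.\<close>

lemma Le_ult_const:
  assumes M: "M \<in> Mods K" and V: "carr M \<subseteq> V"
  shows "Le K M (ult (\<lambda>_. M))"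
proof -
  let ?T = "{N. Le K N M \<and> |carr N| \<le>o \<rho>}"
  have fam: "model_family (\<lambda>_. M)" using assms unfolding model_family_def by simp
  have s: "is_struct (Lang K) M" by (rule mu_AEC_struct[OF AEC M])
  have sub: "substruct (Lang K) N M" if "N \<in> ?T" for N
    using that mu_AEC_substruct[OF AEC] by blast
  have Mods: "?T \<subseteq> Mods K" using mu_AEC_Mods[OF AEC] by blast
  have dir: "\<exists>B\<in>?T. \<forall>A\<in>Z. Le K A B" if Z: "Z \<subseteq> ?T" "|Z| <o \<mu>" for Z
  proof -
    have Z\<rho>: "|Z| \<le>o \<rho>" by (rule ordLess_imp_ordLeq[OF ordLess_ordLeq_trans[OF Z(2) \<mu>\<rho>]])
    have "|\<Union>A\<in>Z. carr A| \<le>o \<rho>" by (rule UNION_Cinfinite_bound[OF Z\<rho> _ \<rho>]) (use Z(1) in blast)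
    moreover have "(\<Union>A\<in>Z. carr A) \<subseteq> carr M" using Z(1) substruct_carr[OF sub] by blast
    ultimately obtain B where B: "Le K B M" "(\<Union>A\<in>Z. carr A) \<subseteq> carr B" "|carr B| \<le>o \<rho>"
      using LST_submodel[OF AEC LST M] by blast
    have "Le K A B" if "A \<in> Z" for A
      using mu_AEC_coherence[OF AEC _ B(1)] B(2) Z(1) that by blast
    then show ?thesis using B by blast
  qed
  have cover: "carr M \<subseteq> (\<Union>A\<in>?T. carr A)"
  proof
    fix v assume v: "v \<in> carr M"
    then obtain N where "Le K N M" "{v} \<subseteq> carr N" "|carr N| \<le>o \<rho>"
      using LST_submodel[OF AEC LST M, of "{v}"] finite_ordLeq_Cinfinite[OF _ \<rho>, of "{v}"] by blast
    then show "v \<in> (\<Union>A\<in>?T. carr A)" by blast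
  qed
  have le: "Le K N (ult (\<lambda>_. M))" if N: "N \<in> ?T" for N
  proof -
    have "carr N \<subseteq> V" using substruct_carr[OF sub[OF N]] V by blast
    then have "ult (\<lambda>_. N) = N"
      using N Mods mu_AEC_struct[OF AEC] by (intro ult_const_eq) blast+
    moreover have "Le K (ult (\<lambda>_. N)) (ult (\<lambda>_. M))"
      by (rule Le_ult[OF fam]) (use N in simp)
    ultimately show ?thesis by simp
  qed
  show ?thesis
    by (rule directed_cover(3)[OF AEC card_of_substructs_less[OF s sub] s sub Mods dir cover
          ult_in_Mods[OF fam] le])
qed

lemma K_embedding_ult:
  assumes M: "model_family M" and P: "model_family P"
    and f: "eventually (\<lambda>x. K_embedding K (f x) (M x) (P x)) U"
  shows "K_embedding K (ult_map f) (ult M) (ult P)"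
proof -
  define M' where "M' x = (SOME M'. struct_iso (Lang K) (f x) (M x) M' \<and> Le K M' (P x))" for x
  have M': "eventually (\<lambda>x. struct_iso (Lang K) (f x) (M x) (M' x) \<and> Le K (M' x) (P x)) U"
    using f unfolding M'_def K_embedding_def by (rule eventually_mono) (rule someI_ex, blast)
  then have Le: "eventually (\<lambda>x. Le K (M' x) (P x)) U" by (rule eventually_mono) blast
  have "eventually (\<lambda>x. struct_iso (Lang K) (f x) (M x) (M' x)) U"
    using M' by (rule eventually_mono) blast
  then have "struct_iso (Lang K) (ult_map f) (ult M) (ult M')"
    using model_family M model_family_Le[OF P Le] by (intro struct_iso_ult) blast+
  then show ?thesis
    unfolding K_embedding_def using ult_in_Mods M P Le_ult[OF P Le] by blast
qed

end

section \<open>Compactness of Galois types\<close>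

lemma K_embedding_carr:
  assumes "mu_AEC \<mu> K" "K_embedding K f M N" "v \<in> carr M"
  shows "f v \<in> carr N"
proof -
  obtain M' where M': "struct_iso (Lang K) f M M'" "Le K M' N"
    using assms(2) unfolding K_embedding_def by (elim conjE exE)
  have "bij_betw f (carr M) (carr M')" using M'(1) unfolding struct_iso_def by (elim conjE)
  then have "f v \<in> carr M'" using assms(3) by (rule bij_betwE[rule_format])
  then show ?thesis using substruct_carr[OF mu_AEC_substruct[OF assms(1) M'(2)]] by blast
qed

lemma K_embedding_id:
  assumes "mu_AEC \<mu> K" "Le K M N"
  shows "K_embedding K id M N"
proof -
  have M: "M \<in> Mods K" "N \<in> Mods K" using mu_AEC_Mods[OF assms] by blast+
  have "struct_iso (Lang K) id M M"
    unfolding struct_iso_def using mu_AEC_struct[OF assms(1) M(1)]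
    by (simp add: compose_eq_self)
  then show ?thesis unfolding K_embedding_def using M assms(2) by blast
qed

lemma E_at_Le:
  assumes AEC: "mu_AEC \<mu> K" and Le: "Le K M N" and B: "B \<subseteq> carr M" and a: "a \<in> J \<rightarrow>\<^sub>E carr M"
  shows "E_at K J (a, B, M) (a, B, N)"
proof -
  have M: "M \<in> Mods K" "N \<in> Mods K" using mu_AEC_Mods[OF AEC Le] by blast+
  have sub: "carr M \<subseteq> carr N" by (rule substruct_carr[OF mu_AEC_substruct[OF AEC Le]])
  have aN: "a \<in> J \<rightarrow>\<^sub>E carr N" using a PiE_range_mono[OF sub] by blast
  have "\<exists>P f1 f2. P \<in> Mods K \<and> K_embedding K f1 M P \<and> K_embedding K f2 N P \<and>
      (\<forall>x\<in>B. f1 x = x \<and> f2 x = x) \<and> compose J f1 a = compose J f2 a"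
    using M K_embedding_id[OF AEC Le] K_embedding_id[OF AEC mu_AEC_refl[OF AEC M(2)]]
    by (intro exI[of _ N] exI[of _ id]) simp
  then show ?thesis
    unfolding E_at_def prod.case using M B sub a aN by simp
qed

lemma tranclp_E_at_sym: "(E_at K J)\<^sup>+\<^sup>+ s t \<Longrightarrow> (E_at K J)\<^sup>+\<^sup>+ t s"
proof (induction rule: tranclp_induct)
  case (base t)
  then show ?case by (blast intro: E_at_sym)
next
  case (step t u)
  then show ?case by (meson E_at_sym tranclp_into_tranclp2)
qed

lemma gtp_eqI:
  assumes "(E_at K J)\<^sup>+\<^sup>+ (a, A, N) (a', A', N')"
  shows "gtp K J a A N = gtp K J a' A' N'"
  unfolding gtp_def using assms tranclp_E_at_sym[OF assms]
  by (intro Collect_cong iffI) (erule (1) tranclp_trans)+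

section \<open>Ultraproducts of tuples and of single amalgamation steps\<close>

context mu_AEC_ultrapower
begin

lemma ult_cong:
  assumes M: "model_family M" and eq: "eventually (\<lambda>x. M x = N x) U"
  shows "ult M = ult N"
proof (rule substruct_eqI)
  have "eventually (\<lambda>x. Le K (N x) (M x)) U"
    using M[unfolded model_family_def] eq by eventually_elim (use mu_AEC_refl[OF AEC] in auto)
  from model_family_Le[OF M this] have N: "model_family N" .
  have "eventually (\<lambda>x. Le K (M x) (N x)) U"
    using M[unfolded model_family_def] eq by eventually_elim (use mu_AEC_refl[OF AEC] in auto)
  from Le_ult[OF N this] show "substruct (Lang K) (ult M) (ult N)" by (rule mu_AEC_substruct[OF AEC])
  have "eventually (\<lambda>x. e x v \<in> carr (M x)) U \<longleftrightarrow> eventually (\<lambda>x. e x v \<in> carr (N x)) U" for v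
    by (rule eventually_subst) (use eq in eventually_elim, simp)
  then show "carr (ult M) = carr (ult N)" using carr_ult[of _ M] carr_ult[of _ N] by blast
qed

text \<open>Coordinatewise coding: \<open>ult_map\<close> is applied to maps that ignore their
  argument, so it codes the function sending \<open>x\<close> to \<open>a x i\<close>, and
  \<open>undefined\<close> is a dummy argument.\<close>

definition ult_tuple :: "'u set \<Rightarrow> ('u \<Rightarrow> 'u \<Rightarrow> 'u) \<Rightarrow> 'u \<Rightarrow> 'u" where
  "ult_tuple J a = (\<lambda>i\<in>J. ult_map (\<lambda>x _. a x i) undefined)"

lemma ult_tuple:
  assumes "i \<in> J" "eventually (\<lambda>x. a x i \<in> V) U"
  shows "ult_tuple J a i \<in> W" "eventually (\<lambda>x. e x (ult_tuple J a i) = a x i) U"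
  using ult_map[of "\<lambda>x _. a x i" undefined] assms unfolding ult_tuple_def by simp_all

text \<open>The hypothesis is made coordinate by coordinate, since the exceptional set may vary with
  \<open>i\<close> and \<open>J\<close> may exceed the completeness of \<open>U\<close>. This
  applies to restrictions of \<open>a\<close> to varying index sets.\<close>

lemma ult_tuple_const:
  assumes a: "a \<in> J \<rightarrow>\<^sub>E V" and c: "\<And>i. i \<in> J \<Longrightarrow> eventually (\<lambda>x. c x i = a i) U"
  shows "ult_tuple J c = a"
proof
  fix i show "ult_tuple J c i = a i"
  proof (cases "i \<in> J")
    case True
    then have aV: "a i \<in> V" using a by blast
    have "eventually (\<lambda>x. c x i \<in> V) U" using c[OF True] by (rule eventually_mono) (simp add: aV)
    note t = ult_tuple[where a = c, OF True this]
    show ?thesis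
    proof (rule code_eq[OF t(1)])
      show "a i \<in> W" using aV V_W by blast
      show "eventually (\<lambda>x. e x (ult_tuple J c i) = e x (a i)) U"
        using t(2) c[OF True] code_const[OF aV] by eventually_elim simp
    qed
  next
    case False
    then show ?thesis using a by (simp add: ult_tuple_def PiE_def extensional_def)
  qed
qed

text \<open>The hypotheses on \<open>B\<close> and \<open>J\<close> hold for one parameter or one
  coordinate at a time, almost everywhere. That is enough because being fixed by
  \<open>ult_map\<close> and having equal images are equalities of codes, each decided by one
  condition on almost all \<open>x\<close>.\<close>

lemma E_at_ult:
  assumes N: "model_family N" and N': "model_family N'" and P: "model_family P"
    and f: "eventually (\<lambda>x. K_embedding K (f x) (N x) (P x)) U"
    and g: "eventually (\<lambda>x. K_embedding K (g x) (N' x) (P x)) U"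
    and B: "\<And>m. m \<in> B \<Longrightarrow> eventually (\<lambda>x. m \<in> carr (N x) \<and> m \<in> carr (N' x) \<and> f x m = m \<and> g x m = m) U"
    and a: "\<And>i. i \<in> J \<Longrightarrow>
      eventually (\<lambda>x. a x i \<in> carr (N x) \<and> b x i \<in> carr (N' x) \<and> f x (a x i) = g x (b x i)) U"
  shows "E_at K J (ult_tuple J a, B, ult N) (ult_tuple J b, B, ult N')"
proof -
  have BV: "m \<in> V" if "m \<in> B" for m
  proof -
    have "eventually (\<lambda>x. m \<in> V) U"
      using B[OF that] N[unfolded model_family_def] by eventually_elim blast
    then show ?thesis using ultrafilter_ex[OF uf] by blast
  qed
  have tuple: "ult_tuple J c i \<in> carr (ult M)"
      "eventually (\<lambda>x. e x (ult_tuple J c i) = c x i) U"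
    if "model_family M" "i \<in> J" "eventually (\<lambda>x. c x i \<in> carr (M x)) U" for M c i
  proof -
    have "eventually (\<lambda>x. c x i \<in> V) U"
      using that(1)[unfolded model_family_def] that(3) by eventually_elim blast
    note t = ult_tuple[where a = c, OF that(2) this]
    show "eventually (\<lambda>x. e x (ult_tuple J c i) = c x i) U" by (rule t(2))
    have "eventually (\<lambda>x. e x (ult_tuple J c i) \<in> carr (M x)) U"
      using t(2) that(3) by eventually_elim simp
    then show "ult_tuple J c i \<in> carr (ult M)" using t(1) carr_ult[of _ M] by simp
  qed
  have fixed: "m \<in> carr (ult M) \<and> ult_map h m = m"
    if m: "m \<in> B" and M: "eventually (\<lambda>x. m \<in> carr (M x) \<and> h x m = m) U" for m M h
  proof -
    note mV = BV[OF m] and ev = code_const[OF BV[OF m]]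
    have "eventually (\<lambda>x. e x m \<in> carr (M x)) U" using M ev by eventually_elim simp
    then have carr: "m \<in> carr (ult M)" using mV V_W carr_ult[of m M] by blast
    have h: "eventually (\<lambda>x. h x (e x m) = m) U" using M ev by eventually_elim simp
    then have "eventually (\<lambda>x. h x (e x m) \<in> V) U" by (rule eventually_mono) (simp add: mV)
    note t = ult_map[where f = h and v = m, OF this]
    have "ult_map h m = m"
    proof (rule code_eq[OF t(1)])
      show "m \<in> W" using mV V_W by blast
      show "eventually (\<lambda>x. e x (ult_map h m) = e x m) U"
        using t(2) h ev by eventually_elim simp
    qed
    then show ?thesis using carr by blast
  qed
  have BN: "m \<in> carr (ult N) \<and> ult_map f m = m" "m \<in> carr (ult N') \<and> ult_map g m = m" if "m \<in> B" for m
    using fixed[OF that, of N f] fixed[OF that, of N' g] B[OF that] by (simp_all add: eventually_conj_iff)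
  have aN: "eventually (\<lambda>x. a x i \<in> carr (N x)) U" and bN: "eventually (\<lambda>x. b x i \<in> carr (N' x)) U"
    and ab: "eventually (\<lambda>x. f x (a x i) = g x (b x i)) U" if "i \<in> J" for i
    using a[OF that] by (simp_all add: eventually_conj_iff)
  have ta: "ult_tuple J a i \<in> carr (ult N)" "eventually (\<lambda>x. e x (ult_tuple J a i) = a x i) U"
    and tb: "ult_tuple J b i \<in> carr (ult N')" "eventually (\<lambda>x. e x (ult_tuple J b i) = b x i) U"
    if "i \<in> J" for i
    using tuple[where c = a, OF N that aN[OF that]] tuple[where c = b, OF N' that bN[OF that]] .
  have map_W: "ult_map h v \<in> W" "eventually (\<lambda>x. e x (ult_map h v) = h x (e x v)) U"
    if h: "eventually (\<lambda>x. K_embedding K (h x) (M x) (P x)) U" and v: "v \<in> carr (ult M)" for h M v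
  proof -
    have "eventually (\<lambda>x. e x v \<in> carr (M x)) U" using v carr_ult[of v M] by blast
    then have "eventually (\<lambda>x. h x (e x v) \<in> V) U"
      using h P[unfolded model_family_def]
      by eventually_elim (use K_embedding_carr[OF AEC] in blast)
    from ult_map[where f = h and v = v, OF this] show "ult_map h v \<in> W" "eventually (\<lambda>x. e x (ult_map h v) = h x (e x v)) U" .
  qed
  have "ult_map f (ult_tuple J a i) = ult_map g (ult_tuple J b i)" if i: "i \<in> J" for i
  proof (rule code_eq)
    note F = map_W[OF f ta(1)[OF i]] and G = map_W[OF g tb(1)[OF i]]
    show "ult_map f (ult_tuple J a i) \<in> W" "ult_map g (ult_tuple J b i) \<in> W" using F(1) G(1) .
    show "eventually (\<lambda>x. e x (ult_map f (ult_tuple J a i)) = e x (ult_map g (ult_tuple J b i))) U"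
      using F(2) G(2) ta(2)[OF i] tb(2)[OF i] ab[OF i] by eventually_elim simp
  qed
  then have "compose J (ult_map f) (ult_tuple J a) = compose J (ult_map g) (ult_tuple J b)"
    by (rule compose_cong)
  then have "\<exists>Q h k. Q \<in> Mods K \<and> K_embedding K h (ult N) Q \<and> K_embedding K k (ult N') Q \<and>
      (\<forall>m\<in>B. h m = m \<and> k m = m) \<and> compose J h (ult_tuple J a) = compose J k (ult_tuple J b)"
    using ult_in_Mods[OF P] K_embedding_ult[OF N P f] K_embedding_ult[OF N' P g] BN
    by (intro exI[of _ "ult P"] exI[of _ "ult_map f"] exI[of _ "ult_map g"]) simp
  moreover have "B \<subseteq> carr (ult N) \<inter> carr (ult N')" using BN by blast
  moreover have "ult_tuple J a \<in> J \<rightarrow>\<^sub>E carr (ult N)" "ult_tuple J b \<in> J \<rightarrow>\<^sub>E carr (ult N')"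
    using ta(1) tb(1) by (auto simp: ult_tuple_def)
  ultimately show ?thesis
    unfolding E_at_def prod.case using ult_in_Mods[OF N] ult_in_Mods[OF N'] by blast
qed

end

section \<open>Ultraproducts of chains of amalgamation steps\<close>

lemma LST_LS:
  assumes "mu_AEC \<mu> K"
  shows "LST_cardinal \<mu> K (LS \<mu> K)"
proof -
  have "{\<rho>. LST_cardinal \<mu> K \<rho>} \<noteq> {}" using assms unfolding mu_AEC_def by blast
  moreover have "\<forall>\<rho>\<in>{\<rho>. LST_cardinal \<mu> K \<rho>}. Well_order \<rho>"
    unfolding LST_cardinal_def cardinal_def card_order_on_def by blast
  ultimately have "\<exists>\<rho>\<in>{\<rho>. LST_cardinal \<mu> K \<rho>}. \<forall>\<rho>'\<in>{\<rho>. LST_cardinal \<mu> K \<rho>}. \<rho> \<le>o \<rho>'"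
    by (rule exists_minim_Well_order)
  then have "\<exists>\<rho>. LST_cardinal \<mu> K \<rho> \<and> (\<forall>\<rho>'. LST_cardinal \<mu> K \<rho>' \<longrightarrow> \<rho> \<le>o \<rho>')" by simp
  from someI_ex[OF this] show ?thesis unfolding LS_def by (rule conjunct1)
qed

text \<open>The successor of \<rho> stays below the limit cardinal \<kappa>. It is a relation on
  \<open>'u set\<close>, and \<nu> is its copy on \<open>'u\<close>, where the completeness of
  ultrafilters is measured.\<close>

lemma almost_strongly_compact_above:
  fixes \<kappa> \<rho> :: "'u rel"
  assumes "almost_strongly_compact \<kappa>" "Card_order \<rho>" "\<rho> <o \<kappa>"
  obtains \<nu> :: "'u rel" where "Card_order \<nu>" "\<rho> <o \<nu>" "\<nu> <o \<kappa>"
proof -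
  have "cardSuc \<rho> <o \<kappa>" using assms unfolding almost_strongly_compact_def by blast
  then obtain \<nu> :: "'u rel" where \<nu>: "cardSuc \<rho> =o \<nu>" "\<nu> <o \<kappa>"
    using iffD1[OF internalize_ordLess] by blast
  have "Card_order \<nu>" using Card_order_ordIso2[OF cardSuc_Card_order[OF assms(2)] \<nu>(1)] .
  moreover have "\<rho> <o \<nu>" by (rule ordLess_ordIso_trans[OF cardSuc_greater[OF assms(2)] \<nu>(1)])
  ultimately show ?thesis using \<nu>(2) by (rule that)
qed

text \<open>A form of \<open>E_at\<close> for triples that are not given explicitly, such as the
  terms of a chain. The amalgam and its two embeddings are packed into one \<open>w\<close>, so that
  a single choice selects them.\<close>

lemma E_at_projections:
  "E_at K J s t \<Longrightarrow> fst (snd s) = fst (snd t) \<and>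
     snd (snd s) \<in> Mods K \<and> snd (snd t) \<in> Mods K \<and>
     fst (snd s) \<subseteq> carr (snd (snd s)) \<inter> carr (snd (snd t)) \<and>
     fst s \<in> J \<rightarrow>\<^sub>E carr (snd (snd s)) \<and> fst t \<in> J \<rightarrow>\<^sub>E carr (snd (snd t)) \<and>
     (\<exists>w. fst w \<in> Mods K \<and> K_embedding K (fst (snd w)) (snd (snd s)) (fst w) \<and>
       K_embedding K (snd (snd w)) (snd (snd t)) (fst w) \<and>
       (\<forall>x\<in>fst (snd s). fst (snd w) x = x \<and> snd (snd w) x = x) \<and>
       compose J (fst (snd w)) (fst s) = compose J (snd (snd w)) (fst t))"
  by (cases s, cases t) (simp add: E_at_def)

text \<open>
  The chains of \<open>E_at\<close>-steps witnessing the small restrictions have varying lengths, but by countable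
  completeness the length is almost everywhere constant, so the ultraproduct of the chains is a
  finite chain.
\<close>
lemma Galois_type_compactness:
  fixes \<mu> \<kappa> :: "'u rel" and K :: "('f, 'r, 'u) aclass"
  assumes inac: "inaccessible |UNIV :: 'u set|" and AEC: "mu_AEC \<mu> K"
    and asc: "almost_strongly_compact \<kappa>" and LS: "LS \<mu> K <o \<kappa>"
    and N1: "N1 \<in> Mods K" and N2: "N2 \<in> Mods K" and B: "B \<subseteq> carr N1" "B \<subseteq> carr N2" and J: "small J"
    and a: "a \<in> J \<rightarrow>\<^sub>E carr N1" and b: "b \<in> J \<rightarrow>\<^sub>E carr N2"
    and small_parts: "\<And>I A. I \<subseteq> J \<Longrightarrow> A \<subseteq> B \<Longrightarrow> |I| +c |A| <o \<kappa> \<Longrightarrow>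
      (E_at K I)\<^sup>+\<^sup>+ (restrict a I, A, N1) (restrict b I, A, N2)"
  shows "(E_at K J)\<^sup>+\<^sup>+ (a, B, N1) (b, B, N2)"
proof -
  define \<rho> where "\<rho> = LS \<mu> K"
  have LST: "LST_cardinal \<mu> K \<rho>" unfolding \<rho>_def by (rule LST_LS[OF AEC])
  note LST' = LST_mu_le[OF AEC LST]
  have \<rho>: "Card_order \<rho>" using LST'(2) by (rule conjunct2)
  obtain \<nu> :: "'u rel" where \<nu>: "Card_order \<nu>" "\<rho> <o \<nu>" "\<nu> <o \<kappa>"
    using almost_strongly_compact_above[OF asc \<rho> LS[folded \<rho>_def]] .
  have nat_\<nu>: "|UNIV :: nat set| <o \<nu>"
    by (rule ordLeq_ordLess_trans[OF countable_ordLeq_Cinfinite[OF LST'(2)] \<nu>(2)])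
  note inf = inaccessible_Cinfinite[OF inac]
  have carr_less: "|carr M| <o |UNIV :: 'u set|" if "M \<in> Mods K" for M
    using mu_AEC_struct[OF AEC that] unfolding is_struct_def small_def by (elim conjE)
  have "|B| <o |UNIV :: 'u set|" by (rule card_of_subset_less[OF B(1) carr_less[OF N1]])
  then have S: "|J <+> B| <o |UNIV :: 'u set|"
    using card_of_Plus_ordLess_infinite_Field[of "|UNIV :: 'u set|" J B] inf J
    unfolding cinfinite_def small_def by blast
  \<comment> \<open>Fineness on the disjoint sum treats indices and parameters together: the two
    parts of \<open>d x\<close> have sizes that add up to less than \<kappa>, as
    \<open>small_parts\<close> requires.\<close>
  obtain X :: "'u set" and U and d
    where X: "small X" "U \<le> principal X" "ultrafilter U" "complete_filter \<nu> U"
      and d: "\<And>x. x \<in> X \<Longrightarrow> d x \<subseteq> J <+> B \<and> |d x| <o \<kappa>"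
        "\<And>s. s \<in> J <+> B \<Longrightarrow> eventually (\<lambda>x. s \<in> d x) U"
    using fine_ultrafilter[OF inac asc \<nu>(1,3) nat_\<nu> S] by blast
  have evX: "eventually (\<lambda>x. x \<in> X) U" using X(2) by (simp add: le_principal)
  define I where "I x = Inl -` d x" for x
  define A where "A x = Inr -` d x" for x
  have I_ev: "eventually (\<lambda>x. i \<in> I x) U" if "i \<in> J" for i
    using d(2)[OF InlI[OF that]] unfolding I_def by simp
  have A_ev: "eventually (\<lambda>x. m \<in> A x) U" if "m \<in> B" for m
    using d(2)[OF InrI[OF that]] unfolding A_def by simp
  have "\<exists>n c. c 0 = (restrict a (I x), A x, N1) \<and> c n = (restrict b (I x), A x, N2) \<and>
      0 < n \<and> (\<forall>k<n. E_at K (I x) (c k) (c (Suc k)))" if x: "x \<in> X" for x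
  proof -
    have sub: "I x \<subseteq> J" "A x \<subseteq> B" using d(1)[OF x] unfolding I_def A_def by auto
    have "I x <+> A x = d x" using d(1)[OF x] unfolding I_def A_def by auto
    then have "|I x| +c |A x| <o \<kappa>" using d(1)[OF x] unfolding csum_def Field_card_of by simp
    from small_parts[OF sub this] show ?thesis
      unfolding tranclp_power relpowp_fun_conv by blast
  qed
  then have "\<forall>x\<in>X. \<exists>p. snd p 0 = (restrict a (I x), A x, N1) \<and>
      snd p (fst p) = (restrict b (I x), A x, N2) \<and>
      0 < fst p \<and> (\<forall>k<fst p. E_at K (I x) (snd p k) (snd p (Suc k)))"
    by simp
  from bchoice[OF this] obtain p where p: "\<forall>x\<in>X. snd (p x) 0 = (restrict a (I x), A x, N1) \<and>
      snd (p x) (fst (p x)) = (restrict b (I x), A x, N2) \<and>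
      0 < fst (p x) \<and> (\<forall>k<fst (p x). E_at K (I x) (snd (p x) k) (snd (p x) (Suc k)))" ..
  have "\<exists>n\<in>UNIV. eventually (\<lambda>x. fst (p x) = n) U"
    by (rule complete_ultrafilter_bex[OF X(3,4) nat_\<nu>]) simp
  then obtain n where n: "eventually (\<lambda>x. fst (p x) = n) U" by blast
  define c where "c x = snd (p x)" for x
  have ev_c: "eventually (\<lambda>x. c x 0 = (restrict a (I x), A x, N1) \<and>
      c x n = (restrict b (I x), A x, N2) \<and> 0 < n \<and>
      (\<forall>k<n. E_at K (I x) (c x k) (c x (Suc k)))) U"
    using evX n by eventually_elim (use p in \<open>auto simp: c_def\<close>)
  then have n0: "0 < n" using ultrafilter_ex[OF X(3)] by blast
  define wit where "wit x k w \<longleftrightarrow> fst w \<in> Mods K \<and>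
      K_embedding K (fst (snd w)) (snd (snd (c x k))) (fst w) \<and>
      K_embedding K (snd (snd w)) (snd (snd (c x (Suc k)))) (fst w) \<and>
      (\<forall>m\<in>fst (snd (c x k)). fst (snd w) m = m \<and> snd (snd w) m = m) \<and>
      compose (I x) (fst (snd w)) (fst (c x k)) = compose (I x) (snd (snd w)) (fst (c x (Suc k)))"
    for x k w
  define w where "w x k = (SOME w. wit x k w)" for x k
  have step: "eventually (\<lambda>x. E_at K (I x) (c x k) (c x (Suc k)) \<and> wit x k (w x k)) U" if "k < n" for k
    using ev_c
  proof (rule eventually_mono)
    fix x assume "c x 0 = (restrict a (I x), A x, N1) \<and>
      c x n = (restrict b (I x), A x, N2) \<and> 0 < n \<and>
      (\<forall>k<n. E_at K (I x) (c x k) (c x (Suc k)))"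
    then have E: "E_at K (I x) (c x k) (c x (Suc k))" using that by blast
    then have "\<exists>w. wit x k w" using E_at_projections unfolding wit_def by blast
    then have "wit x k (w x k)" unfolding w_def by (rule someI_ex)
    with E show "E_at K (I x) (c x k) (c x (Suc k)) \<and> wit x k (w x k)" ..
  qed
  \<comment> \<open>Beyond the length of a chain, and at exceptional \<open>x\<close>, the terms of
    \<open>c\<close> and \<open>w\<close> are arbitrary and need not be models. Replacing their
    carriers by \<open>{}\<close> keeps the union \<open>V\<close> over all \<open>x\<close> and
    \<open>k\<close> small.\<close>
  define mc where "mc M = (if M \<in> Mods K then carr M else {})" for M
  have mc: "|mc M| <o |UNIV :: 'u set|" for M
    using carr_less finite_ordLess_Cinfinite[OF finite.emptyI[where 'a = 'u] inf]
    unfolding mc_def by simp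
  define V where "V = carr N1 \<union> carr N2 \<union>
    (\<Union>x\<in>X. \<Union>k. mc (snd (snd (c x k))) \<union> mc (fst (w x k)))"
  have "|UNIV :: nat set| <o |UNIV :: 'u set|"
    using ordLess_transitive[OF nat_\<nu> ordLess_transitive[OF \<nu>(3)]] asc
    unfolding almost_strongly_compact_def cardinal_def by blast
  then have V: "small V"
    unfolding V_def small_def
    by (intro Un_Cinfinite_bound_strict card_of_UN_less[OF inac] carr_less[OF N1] carr_less[OF N2] mc inf
        X(1)[unfolded small_def])
  obtain W e where W: "small W" "V \<subseteq> W"
    "\<And>v w. v \<in> W \<Longrightarrow> w \<in> W \<Longrightarrow> eventually (\<lambda>x. e x v = e x w) U \<Longrightarrow> v = w"
    "\<And>f. eventually (\<lambda>x. f x \<in> V) U \<Longrightarrow> \<exists>v\<in>W. eventually (\<lambda>x. e x v = f x) U"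
    "\<And>v. v \<in> V \<Longrightarrow> eventually (\<lambda>x. e x v = v) U"
    using ex_ultrapower_coding[OF inac X(1-3) V] by blast
  have wo: "Well_order \<mu>" using mu_AEC_Cinfinite[OF AEC] by (simp add: card_order_on_def)
  interpret mu_AEC_ultrapower \<mu> \<rho> \<nu> K U V W e
  proof
    show "|Field \<alpha> \<rightarrow>\<^sub>E T| \<le>o \<rho>" if "Well_order \<alpha>" "\<alpha> <o \<mu>" "|T| \<le>o \<rho>" for \<alpha> :: "'u rel" and T :: "'u set"
      by (rule ordLeq_transitive[OF card_of_tuples_le_cpow_less[OF wo that(1,2)] LST_cpow_less[OF LST that(3)]])
  qed (use X(3,4) \<nu>(2) LST' mu_AEC_ary[OF AEC] W inac AEC LST in \<open>(assumption | blast)\<close>)+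
  define N where "N k x = snd (snd (c x k))" for k x
  have fam_step: "model_family (N k) \<and> model_family (N (Suc k)) \<and> model_family (\<lambda>x. fst (w x k))"
    if k: "k < n" for k
  proof -
    have "eventually (\<lambda>x. x \<in> X \<and> N k x \<in> Mods K \<and> N (Suc k) x \<in> Mods K \<and> fst (w x k) \<in> Mods K) U"
      using step[OF k] evX
    proof eventually_elim
      case (elim x)
      then show ?case
        using E_at_projections[of K "I x" "c x k" "c x (Suc k)"] unfolding wit_def N_def by simp
    qed
    then have "eventually (\<lambda>x. (N k x \<in> Mods K \<and> carr (N k x) \<subseteq> V) \<and>
        (N (Suc k) x \<in> Mods K \<and> carr (N (Suc k) x) \<subseteq> V) \<and>
        (fst (w x k) \<in> Mods K \<and> carr (fst (w x k)) \<subseteq> V)) U"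
    proof (rule eventually_mono)
      fix x assume x: "x \<in> X \<and> N k x \<in> Mods K \<and> N (Suc k) x \<in> Mods K \<and> fst (w x k) \<in> Mods K"
      have "mc (N k x) \<subseteq> V" "mc (N (Suc k) x) \<subseteq> V" "mc (fst (w x k)) \<subseteq> V"
        using x unfolding V_def N_def by blast+
      then show "(N k x \<in> Mods K \<and> carr (N k x) \<subseteq> V) \<and>
        (N (Suc k) x \<in> Mods K \<and> carr (N (Suc k) x) \<subseteq> V) \<and>
        (fst (w x k) \<in> Mods K \<and> carr (fst (w x k)) \<subseteq> V)"
        using x unfolding mc_def by simp
    qed
    then show ?thesis unfolding model_family_def by (simp add: eventually_conj_iff)
  qed
  have A_c: "eventually (\<lambda>x. fst (snd (c x k)) = A x) U" if "k \<le> n" for k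
    using that
  proof (induction k)
    case 0
    show ?case using ev_c by (rule eventually_mono) simp
  next
    case (Suc k)
    then have "eventually (\<lambda>x. fst (snd (c x k)) = A x) U" "k < n" by simp_all
    from this(1) step[OF this(2)] show ?case
      by eventually_elim (use E_at_projections in metis)
  qed
  \<comment> \<open>The full sets \<open>J\<close> and \<open>B\<close> replace \<open>I x\<close>
    and \<open>A x\<close>: each index and each parameter belongs to these for almost all
    \<open>x\<close>.\<close>
  define t where "t k = (ult_tuple J (\<lambda>x. fst (c x k)), B, ult (N k))" for k
  have "E_at K J (t k) (t (Suc k))" if k: "k < n" for k
    unfolding t_def
  proof (rule E_at_ult)
    show "model_family (N k)" "model_family (N (Suc k))" "model_family (\<lambda>x. fst (w x k))"
      using fam_step[OF k] by blast+
    show "eventually (\<lambda>x. K_embedding K (fst (snd (w x k))) (N k x) (fst (w x k))) U"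
      "eventually (\<lambda>x. K_embedding K (snd (snd (w x k))) (N (Suc k) x) (fst (w x k))) U"
      using step[OF k] unfolding wit_def N_def by (auto elim: eventually_mono)
    show "eventually (\<lambda>x. m \<in> carr (N k x) \<and> m \<in> carr (N (Suc k) x) \<and>
        fst (snd (w x k)) m = m \<and> snd (snd (w x k)) m = m) U" if "m \<in> B" for m
      using step[OF k] A_ev[OF that] A_c[OF less_imp_le[OF k]]
    proof eventually_elim
      case (elim x)
      then show ?case
        using E_at_projections[of K "I x" "c x k" "c x (Suc k)"] unfolding wit_def N_def by blast
    qed
    show "eventually (\<lambda>x. fst (c x k) i \<in> carr (N k x) \<and> fst (c x (Suc k)) i \<in> carr (N (Suc k) x) \<and>
        fst (snd (w x k)) (fst (c x k) i) = snd (snd (w x k)) (fst (c x (Suc k)) i)) U" if "i \<in> J" for i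
      using step[OF k] I_ev[OF that]
    proof eventually_elim
      case (elim x)
      have "compose (I x) (fst (snd (w x k))) (fst (c x k)) i =
          compose (I x) (snd (snd (w x k))) (fst (c x (Suc k))) i"
        using elim(1) unfolding wit_def by simp
      then have "fst (snd (w x k)) (fst (c x k) i) = snd (snd (w x k)) (fst (c x (Suc k)) i)"
        using elim(2) by (simp add: compose_def)
      then show ?case
        using E_at_projections[of K "I x" "c x k" "c x (Suc k)"] elim unfolding N_def by blast
    qed
  qed
  then have chain: "(E_at K J)\<^sup>+\<^sup>+ (t 0) (t n)"
    unfolding tranclp_power relpowp_fun_conv using n0 by blast
  \<comment> \<open>The ends of the ultraproduct chain live in ultrapowers of \<open>N1\<close> and
    \<open>N2\<close>. The diagonal inclusion is one more step, linking the given triples to these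
    ends.\<close>
  have const: "E_at K J (a', B, N') (t k)"
    if N': "N' \<in> Mods K" "carr N' \<subseteq> V" "B \<subseteq> carr N'" and a': "a' \<in> J \<rightarrow>\<^sub>E carr N'"
      and ev: "eventually (\<lambda>x. c x k = (restrict a' (I x), A x, N')) U" for a' N' k
  proof -
    have fam: "model_family (\<lambda>_. N')" unfolding model_family_def using N' by simp
    have "eventually (\<lambda>x. N' = N k x) U" using ev by (rule eventually_mono) (simp add: N_def)
    from ult_cong[OF fam this] have "ult (N k) = ult (\<lambda>_. N')" by (rule sym)
    moreover have "ult_tuple J (\<lambda>x. fst (c x k)) = a'"
    proof (rule ult_tuple_const)
      show "a' \<in> J \<rightarrow>\<^sub>E V" using a' PiE_range_mono[OF N'(2)] by blast
      show "eventually (\<lambda>x. fst (c x k) i = a' i) U" if "i \<in> J" for i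
        using ev I_ev[OF that] by eventually_elim simp
    qed
    ultimately show ?thesis
      unfolding t_def using E_at_Le[OF AEC Le_ult_const[OF N'(1,2)] N'(3) a'] by simp
  qed
  have "E_at K J (a, B, N1) (t 0)"
    by (rule const[OF N1 _ B(1) a]) (use ev_c in \<open>auto simp: V_def elim: eventually_mono\<close>)
  moreover have "E_at K J (b, B, N2) (t n)"
    by (rule const[OF N2 _ B(2) b]) (use ev_c in \<open>auto simp: V_def elim: eventually_mono\<close>)
  ultimately show ?thesis
    using chain by (meson E_at_sym tranclp.trancl_into_trancl tranclp_into_tranclp2)
qed

theorem theorem5p5:
  fixes \<mu> \<kappa> :: "'u rel" and K :: "('f, 'r, 'u) aclass"
  assumes "inaccessible |UNIV :: 'u set|"
    and "mu_AEC \<mu> K"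
    and "almost_strongly_compact \<kappa>"
    and "LS \<mu> K <o \<kappa>"
  shows "fully_tame_short \<kappa> K"
  unfolding fully_tame_short_def
proof (intro ballI allI impI)
  fix M :: "('f, 'r, 'u) struct" and \<alpha> :: "'u rel" and p q
  assume M: "M \<in> Mods K" and \<alpha>: "ordinal \<alpha>" and p: "p \<in> gS K \<alpha> M" and q: "q \<in> gS K \<alpha> M"
    and pq: "p \<noteq> q"
  let ?J = "Field \<alpha>" and ?B = "carr M"
  note abs = mu_AEC_abstract_class[OF assms(2)]
  obtain a N1 where 1: "p = gtp K ?J a ?B N1" "Le K M N1" "a \<in> ?J \<rightarrow>\<^sub>E carr N1"
    using p unfolding gS_def by blast
  obtain b N2 where 2: "q = gtp K ?J b ?B N2" "Le K M N2" "b \<in> ?J \<rightarrow>\<^sub>E carr N2"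
    using q unfolding gS_def by blast
  have N: "N1 \<in> Mods K" "N2 \<in> Mods K"
    using mu_AEC_Mods[OF assms(2) 1(2)] mu_AEC_Mods[OF assms(2) 2(2)] by blast+
  have B: "?B \<subseteq> carr N1" "?B \<subseteq> carr N2"
    using substruct_carr mu_AEC_substruct[OF assms(2)] 1(2) 2(2) by blast+
  have J: "small ?J"
    using \<alpha> ordLess_Field unfolding ordinal_def small_def by blast
  show "\<exists>I A. I \<subseteq> ?J \<and> A \<subseteq> ?B \<and> |I| +c |A| <o \<kappa> \<and>
      gtp_restrict K I A p \<noteq> gtp_restrict K I A q"
  proof (rule ccontr)
    assume "\<not> ?thesis"
    then have eq: "gtp_restrict K I A p = gtp_restrict K I A q"
      if "I \<subseteq> ?J" "A \<subseteq> ?B" "|I| +c |A| <o \<kappa>" for I A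
      using that by simp
    have "(E_at K ?J)\<^sup>+\<^sup>+ (a, ?B, N1) (b, ?B, N2)"
    proof (rule Galois_type_compactness[OF assms N B J 1(3) 2(3)])
      fix I A assume IA: "I \<subseteq> ?J" "A \<subseteq> ?B" "|I| +c |A| <o \<kappa>"
      have "gtp K I (restrict a I) A N1 = gtp K I (restrict b I) A N2"
        using eq[OF IA] gtp_restrict_gtp[OF abs N(1) B(1) 1(3) IA(1,2)]
          gtp_restrict_gtp[OF abs N(2) B(2) 2(3) IA(1,2)] unfolding 1(1) 2(1) by simp
      \<comment> \<open>A class \<open>gtp\<close> consists of what is reachable by at least one
        step, so reflexivity is what puts the triple into its own class and turns the equality of
        classes into a chain.\<close>
      moreover have "E_at K I (restrict b I, A, N2) (restrict b I, A, N2)"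
        using 2(3) IA(1,2) B(2) by (intro E_at_refl[OF abs N(2)]) auto
      then have "(restrict b I, A, N2) \<in> gtp K I (restrict b I) A N2"
        unfolding gtp_def by blast
      ultimately show "(E_at K I)\<^sup>+\<^sup>+ (restrict a I, A, N1) (restrict b I, A, N2)"
        unfolding gtp_def by blast
    qed
    then have "p = q" unfolding 1(1) 2(1) by (rule gtp_eqI)
    then show False using pq by contradiction
  qed
qed

end
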